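(* Let $k \geq 2$ be an integer and let $G$ be a planar graph. If \[ |H_{k}(G)| - |L_{k}(G)| \geq 2k, \] then $G$ contains $k$ pairwise vertex-disjoint cycles.
   Context: All graphs are finite and simple. For a graph $G$ and a positive integer $k$, $H_k(G)$ denotes the set of vertices of $G$ of degree at least $2k$, and $L_k(G)$ denotes the set of vertices of $G$ of degree at most $2k-2$. *)

theory Defs
  imports "HOL-Analysis.Analysis" "Graph_Theory.Pair_Digraph"
begin

text \<open>
  Finite simple graphs are the library's \<^locale>\<open>pair_graph\<close>s: finite, loopless, symmetric
  digraphs whose arcs are ordered pairs of vertices.  An edge \<open>{u, v}\<close> is represented by the two
  arcs \<open>(u, v)\<close> and \<open>(v, u)\<close>, so the degree of a vertex is its \<^const>\<open>out_degree\<close>.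
\<close>

definition high_verts :: "nat \<Rightarrow> 'a pair_pre_digraph \<Rightarrow> 'a set" where
  "high_verts k G = {v \<in> pverts G. out_degree (with_proj G) v \<ge> 2 * k}"

text \<open>The truncated subtraction below is the true one for \<open>k \<ge> 1\<close>.\<close>

definition low_verts :: "nat \<Rightarrow> 'a pair_pre_digraph \<Rightarrow> 'a set" where
  "low_verts k G = {v \<in> pverts G. out_degree (with_proj G) v \<le> 2 * k - 2}"

text \<open>
  The library's \<^const>\<open>pre_digraph.cycle\<close> admits the closed walk \<open>u, v, u\<close> along a single edge;
  the bound on the length excludes it.
\<close>

definition graph_cycle :: "'a pair_pre_digraph \<Rightarrow> ('a \<times> 'a) awalk \<Rightarrow> bool" where
  "graph_cycle G p \<longleftrightarrow> pre_digraph.cycle (with_proj G) p \<and> length p \<ge> 3"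

text \<open>Every vertex of a closed walk is the tail of one of its arcs.\<close>

definition cycle_verts :: "('a \<times> 'a) awalk \<Rightarrow> 'a set" where
  "cycle_verts p = fst ` set p"

definition has_disjoint_cycles :: "nat \<Rightarrow> 'a pair_pre_digraph \<Rightarrow> bool" where
  "has_disjoint_cycles k G \<longleftrightarrow>
     (\<exists>C. (\<forall>i<k. graph_cycle G (C i)) \<and>
          (\<forall>i<k. \<forall>j<k. i \<noteq> j \<longrightarrow> cycle_verts (C i) \<inter> cycle_verts (C j) = {}))"

text \<open>
  A drawing without crossings in the plane \<^typ>\<open>complex\<close>: vertices are distinct points, edges are
  arcs joining the points of their ends and avoiding all other vertices, and the arcs of two distinct
  edges meet only in common ends.  The two orientations of an edge are drawn as the same curve.
\<close>

definition plane_drawing ::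
    "'a pair_pre_digraph \<Rightarrow> ('a \<Rightarrow> complex) \<Rightarrow> ('a \<times> 'a \<Rightarrow> real \<Rightarrow> complex) \<Rightarrow> bool" where
  "plane_drawing G pos \<gamma> \<longleftrightarrow>
     inj_on pos (pverts G) \<and>
     (\<forall>u v. (u, v) \<in> parcs G \<longrightarrow>
        arc (\<gamma> (u, v)) \<and> pathstart (\<gamma> (u, v)) = pos u \<and> pathfinish (\<gamma> (u, v)) = pos v \<and>
        \<gamma> (v, u) = reversepath (\<gamma> (u, v)) \<and>
        path_image (\<gamma> (u, v)) \<inter> pos ` pverts G = {pos u, pos v}) \<and>
     (\<forall>u v x y. (u, v) \<in> parcs G \<and> (x, y) \<in> parcs G \<and> {u, v} \<noteq> {x, y} \<longrightarrow>
        path_image (\<gamma> (u, v)) \<inter> path_image (\<gamma> (x, y)) \<subseteq> pos ` ({u, v} \<inter> {x, y}))"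

definition planar :: "'a pair_pre_digraph \<Rightarrow> bool" where
  "planar G \<longleftrightarrow> (\<exists>pos \<gamma>. plane_drawing G pos \<gamma>)"

end

theory Submission
  imports Defs
begin

text \<open>
  Take a counterexample with as few vertices and edges as possible, in a class of graphs closed under
  minors that contains neither \<open>K\<^sub>5\<close> nor \<open>K\<^sub>3\<^sub>,\<^sub>3\<close>.  Deleting or contracting an edge shows that every
  edge not inside \<open>H\<^sub>k\<close> lies in a triangle.  For \<open>k \<ge> 3\<close>, removing a triangle and passing to \<open>k - 1\<close>
  lowers \<open>|H| - |L|\<close> by the weight of the triangle and by the number of vertices adjacent to all
  of it, of which there are at most two.  This makes the common neighbourhood of the ends of an edge
  outside \<open>H\<^sub>k\<close> so dense that Mader's bound \<open>|E| \<le> 3|V| - 6\<close> is violated, unless the vertices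
  outside \<open>H\<^sub>k\<close> are independent and of degree \<open>2k - 1\<close>; then at least twelve of them exist, and almost all of
  them share three neighbours, which is a \<open>K\<^sub>3\<^sub>,\<^sub>3\<close>.  For \<open>k = 2\<close> the complement of any triangle is
  a forest, and counting edges suffices.

  Mader's bound needs only that there is no \<open>K\<^sub>5\<close> minor, so the whole topological input is that
  plane graphs have no \<open>K\<^sub>5\<close> and no \<open>K\<^sub>3\<^sub>,\<^sub>3\<close> minors; this follows from the Jordan curve theorem
  and Janiszewski's theorem applied to theta curves.
\<close>

section \<open>Graphs as symmetric relations\<close>

text \<open>The class in question is that of the minors of one fixed plane graph, described by
  branch sets. Contracting an edge then just unites two branch sets, and no drawing is ever
  contracted. The price is that topology has to exclude K5 and K33 whose vertices are arbitrary
  connected sets. For K33, two branch sets supply the common ends of three arcs and a third supplies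
  a connected set reaching all three arcs. For K5 an obstacle appears: the paths from one branch set
  to the other four need not meet in a single vertex. If they do not, the branch set splits into two
  adjacent halves serving two of the others each, and this is a K33 model.

  Passing from \<open>k\<close> to \<open>k - 1\<close> relaxes the required excess by 2 only, so
  the removal of a triangle must cost at least 3 in a counterexample. This descent cannot go below
  \<open>k = 2\<close>: the statement fails for \<open>k = 1\<close>, as a path on four vertices
  shows. Hence \<open>k = 2\<close> needs its own argument, by counting edges of forests.\<close>

definition sgraph :: "'a set \<Rightarrow> ('a \<times> 'a) set \<Rightarrow> bool" where
  "sgraph V R \<longleftrightarrow> finite V \<and> R \<subseteq> V \<times> V \<and> sym R \<and> irrefl R"

definition deg :: "('a \<times> 'a) set \<Rightarrow> 'a \<Rightarrow> nat" where
  "deg R v = card (R `` {v})"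

text \<open>The vertex \<open>y\<close> is absorbed by \<open>x\<close>, which keeps its name. The
  condition \<open>a \<noteq> b\<close> removes the loop left by the contracted edge, and parallel
  edges merge because arcs form a set.\<close>

definition contract :: "'a \<Rightarrow> 'a \<Rightarrow> ('a \<times> 'a) set \<Rightarrow> ('a \<times> 'a) set" where
  "contract x y R = {(a, b). a \<noteq> y \<and> b \<noteq> y \<and> a \<noteq> b \<and>
     ((a, b) \<in> R \<or> a = x \<and> (y, b) \<in> R \<or> b = x \<and> (a, y) \<in> R)}"

text \<open>A set inducing minimum degree two stands in for a cycle: it contains one, and it is far
  easier to lift through a contraction than a closed walk. Actual cycles are extracted only at the
  end, in \<open>cyclic_set_closed_path\<close>.\<close>

definition cyclic_set :: "('a \<times> 'a) set \<Rightarrow> 'a set \<Rightarrow> bool" where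
  "cyclic_set R W \<longleftrightarrow>
     W \<noteq> {} \<and> (\<forall>v\<in>W. \<exists>a\<in>W. \<exists>b\<in>W. a \<noteq> b \<and> (v, a) \<in> R \<and> (v, b) \<in> R)"

definition disjoint_cyclic :: "nat \<Rightarrow> 'a set \<Rightarrow> ('a \<times> 'a) set \<Rightarrow> bool" where
  "disjoint_cyclic k V R \<longleftrightarrow>
     (\<exists>C. (\<forall>i<k. C i \<subseteq> V \<and> cyclic_set R (C i)) \<and>
          (\<forall>i<k. \<forall>j<k. i \<noteq> j \<longrightarrow> C i \<inter> C j = {}))"

section \<open>Degrees and arc counts\<close>

lemma sgraphD:
  assumes "sgraph V R"
  shows "finite V" "finite R" "(a, b) \<in> R \<Longrightarrow> a \<in> V" "(a, b) \<in> R \<Longrightarrow> b \<in> V"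
    "(a, b) \<in> R \<Longrightarrow> (b, a) \<in> R" "(a, a) \<notin> R" "R `` {a} \<subseteq> V" "finite (R `` X)"
proof -
  show f: "finite V" "finite R" using assms finite_subset by (auto simp: sgraph_def)
  show "(a, b) \<in> R \<Longrightarrow> a \<in> V" "(a, b) \<in> R \<Longrightarrow> b \<in> V"
    "(a, b) \<in> R \<Longrightarrow> (b, a) \<in> R" "(a, a) \<notin> R" "R `` {a} \<subseteq> V" 
    using assms by (auto simp: sgraph_def sym_def irrefl_def)
  show "finite (R `` X)" using f by (simp add: finite_Image)
qed

lemma deg_pos_iff: "sgraph V R \<Longrightarrow> deg R v = 0 \<longleftrightarrow> R `` {v} = {}"
  by (simp add: deg_def sgraphD)

text \<open>Both orientations of an edge are in \<open>R\<close>, so \<open>card R\<close> is twice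
  the number of edges; every edge bound in the proof appears doubled accordingly.\<close>

lemma sum_deg:
  assumes "sgraph V R"
  shows "(\<Sum>v\<in>V. deg R v) = card R"
proof -
  have "R = Sigma V (\<lambda>v. R `` {v})" using sgraphD[OF assms] by auto
  then have "card R = card (Sigma V (\<lambda>v. R `` {v}))" by simp
  also have "\<dots> = (\<Sum>v\<in>V. deg R v)"
    unfolding deg_def by (rule card_SigmaI) (auto simp: sgraphD[OF assms])
  finally show ?thesis by simp
qed

lemma card_arcs:
  assumes "sgraph V R" "finite A"
  shows "card (R \<inter> A \<times> B) = (\<Sum>a\<in>A. card (R `` {a} \<inter> B))"
proof -
  have "R \<inter> A \<times> B = Sigma A (\<lambda>v. R `` {v} \<inter> B)" by auto
  then show ?thesis using assms by (simp add: sgraphD)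
qed

lemma card_arcs_swap:
  assumes "sgraph V R"
  shows "card (R \<inter> A \<times> B) = card (R \<inter> B \<times> A)"
proof -
  have "R \<inter> B \<times> A = prod.swap ` (R \<inter> A \<times> B)"
    using sgraphD(5)[OF assms] by (force simp: image_iff)
  then show ?thesis by (simp add: card_image)
qed

lemma card_arcs_insert:
  assumes R: "sgraph V R" and "finite U" "u \<notin> U"
  shows "card (R \<inter> insert u U \<times> insert u U) = card (R \<inter> U \<times> U) + 2 * card (R `` {u} \<inter> U)"
proof -
  have "R \<inter> insert u U \<times> insert u U = (R \<inter> U \<times> U) \<union> ((R \<inter> {u} \<times> U) \<union> (R \<inter> U \<times> {u}))"
    using sgraphD[OF R] by auto
  also have "card \<dots> = card (R \<inter> U \<times> U) + (card (R \<inter> {u} \<times> U) + card (R \<inter> U \<times> {u}))"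
    using assms sgraphD[OF R] by (subst card_Un_disjoint, auto)+
  finally show ?thesis
    using card_arcs_swap[OF R, of U "{u}"] card_arcs[OF R, of "{u}" U] by simp
qed

lemma deg_split:
  assumes R: "sgraph V R" and "U \<union> W = V" "U \<inter> W = {}"
  shows "deg R v = card (R `` {v} \<inter> U) + card (R `` {v} \<inter> W)"
proof -
  have "R `` {v} = (R `` {v} \<inter> U) \<union> (R `` {v} \<inter> W)" using sgraphD(7)[OF R] assms by auto
  then have "deg R v = card ((R `` {v} \<inter> U) \<union> (R `` {v} \<inter> W))" by (simp add: deg_def)
  also have "\<dots> = card (R `` {v} \<inter> U) + card (R `` {v} \<inter> W)"
    by (rule card_Un_disjoint) (use assms sgraphD(8)[OF R] in auto)
  finally show ?thesis .
qed

lemma two_elements: "card A \<ge> 2 \<Longrightarrow> \<exists>a\<in>A. \<exists>b\<in>A. a \<noteq> b"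
  by (metis card_le_Suc0_iff_eq card.infinite not_less_eq_eq numeral_2_eq_2 zero_le)

lemma ex_subset_card_3: "card A \<ge> 3 \<Longrightarrow> \<exists>B\<subseteq>A. card B = 3"
  by (metis obtain_subset_with_card_n)

text \<open>The bound of n - 1 edges for a forest on n vertices. As \<open>U\<close> itself is not
  cyclic, some vertex has at most one neighbour in \<open>U\<close>; removing it loses at most two
  arcs.\<close>

lemma acyclic_card_arcs:
  assumes R: "sgraph V R"
  shows "finite U \<Longrightarrow> U \<noteq> {} \<Longrightarrow> (\<And>W. W \<subseteq> U \<Longrightarrow> \<not> cyclic_set R W) \<Longrightarrow>
    card (R \<inter> U \<times> U) + 2 \<le> 2 * card U"
proof (induction "card U" arbitrary: U rule: less_induct)
  case less
  obtain u where u: "u \<in> U" "card (R `` {u} \<inter> U) \<le> 1"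
  proof (rule ccontr)
    assume "\<not> thesis"
    then have "\<forall>u\<in>U. \<not> card (R `` {u} \<inter> U) \<le> 1" using that by blast
    then have *: "card (R `` {u} \<inter> U) \<ge> 2" if "u \<in> U" for u using that by fastforce
    have "cyclic_set R U"
      unfolding cyclic_set_def using less.prems(2) two_elements[OF *] by auto
    then show False using less.prems by blast
  qed
  let ?U = "U - {u}"
  have c: "card U = Suc (card ?U)" using less.prems u by (metis card_Suc_Diff1)
  have "R `` {u} \<inter> ?U = R `` {u} \<inter> U" using sgraphD(6)[OF R] by auto
  then have e: "card (R \<inter> U \<times> U) \<le> card (R \<inter> ?U \<times> ?U) + 2"
    using card_arcs_insert[OF R, of ?U u, unfolded insert_Diff[OF u(1)]] less.prems(1) u(2) by simp
  show ?case
  proof (cases "?U = {}")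
    case True
    then have "U = {u}" using u(1) by blast
    then have "R \<inter> U \<times> U = {}" using sgraphD(6)[OF R, of u] by blast
    then show ?thesis using c by simp
  next
    case False
    have "card (R \<inter> ?U \<times> ?U) + 2 \<le> 2 * card ?U"
    proof (rule less.hyps)
      show "card ?U < card U" using c by simp
      show "finite ?U" using less.prems(1) by simp
      show "\<not> cyclic_set R W" if "W \<subseteq> ?U" for W using less.prems(3)[of W] that by blast
    qed (fact False)
    then show ?thesis using e c by simp
  qed
qed

section \<open>Deleting and contracting\<close>

lemma sgraph_restrict: "sgraph V R \<Longrightarrow> U \<subseteq> V \<Longrightarrow> sgraph U (R \<inter> U \<times> U)"
  unfolding sgraph_def sym_def irrefl_def using finite_subset by blast

lemma card_arcs_restrict_less:
  assumes "sgraph V R" "U \<subset> V"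
  shows "card U + card (R \<inter> U \<times> U) < card V + card R"
  using psubset_card_mono[of V U] card_mono[of R "R \<inter> U \<times> U"] assms sgraphD[OF assms(1)]
  by (meson add_less_le_mono inf_le1)

lemma sgraph_contract: "sgraph V R \<Longrightarrow> (x, y) \<in> R \<Longrightarrow> sgraph (V - {y}) (contract x y R)"
  unfolding sgraph_def sym_def irrefl_def contract_def by blast

lemma contract_Image_other:
  assumes "sgraph V R" "x \<noteq> y" "a \<noteq> x" "a \<noteq> y"
  shows "contract x y R `` {a} = (if (a, y) \<in> R then insert x (R `` {a} - {y}) else R `` {a})"
  using assms sgraphD[OF assms(1)] unfolding contract_def by auto

lemma contract_Image_same:
  assumes "sgraph V R" "x \<noteq> y"
  shows "contract x y R `` {x} = (R `` {x} \<union> R `` {y}) - {x, y}"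
  using assms sgraphD[OF assms(1)] unfolding contract_def by auto

lemma deg_contract_other:
  assumes R: "sgraph V R" and ne: "x \<noteq> y" and "a \<noteq> x" "a \<noteq> y"
  shows "deg (contract x y R) a + (if a \<in> R `` {x} \<inter> R `` {y} then 1 else 0) = deg R a"
proof (cases "(a, y) \<in> R")
  case False
  then have "a \<notin> R `` {y}" using sgraphD(5)[OF R] by auto
  then show ?thesis using False assms by (simp add: deg_def contract_Image_other[OF R ne])
next
  case True
  then have y: "(y, a) \<in> R" using sgraphD(5)[OF R] by auto
  have d: "deg R a = Suc (card (R `` {a} - {y}))"
    unfolding deg_def by (rule card.remove) (use True sgraphD(8)[OF R] in auto)
  have "(x, a) \<in> R \<longleftrightarrow> x \<in> R `` {a} - {y}" using ne sgraphD(5)[OF R] by auto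
  then show ?thesis using d y assms \<open>(a, y) \<in> R\<close> sgraphD(8)[OF R]
    by (auto simp: deg_def contract_Image_other[OF R ne] card_insert_if)
qed

lemma deg_contract_same:
  assumes R: "sgraph V R" and "(x, y) \<in> R"
  shows "deg (contract x y R) x + 2 + card (R `` {x} \<inter> R `` {y}) = deg R x + deg R y"
proof -
  have ne: "x \<noteq> y" and yx: "(y, x) \<in> R" using assms sgraphD[OF R] by auto
  have "card ((R `` {x} \<union> R `` {y}) - {x, y}) + 2 = card (R `` {x} \<union> R `` {y})"
    using card_Diff_subset[of "{x, y}" "R `` {x} \<union> R `` {y}"]
      card_mono[of "R `` {x} \<union> R `` {y}" "{x, y}"] ne yx assms sgraphD(8)[OF R] by auto
  then show ?thesis
    using card_Un_Int[of "R `` {x}" "R `` {y}"] sgraphD(8)[OF R]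
    by (simp add: deg_def contract_Image_same[OF R ne])
qed

text \<open>Contraction destroys the edge itself and, for each common neighbour of its ends, one of
  two edges that become parallel. The count goes through degree sums.\<close>

lemma card_contract:
  assumes R: "sgraph V R" and xy: "(x, y) \<in> R"
  shows "card R = card (contract x y R) + 2 + 2 * card (R `` {x} \<inter> R `` {y})"
proof -
  let ?C = "R `` {x} \<inter> R `` {y}" and ?R = "contract x y R"
  have V: "x \<in> V" "y \<in> V" "x \<noteq> y" "finite V" "finite ?C" "?C \<subseteq> V - {x, y}"
    using xy sgraphD[OF R] by auto
  have eq: "(\<Sum>a\<in>V - {x, y}. deg R a)
      = (\<Sum>a\<in>V - {x, y}. deg ?R a + (if a \<in> ?C then 1 else 0))"
    by (rule sum.cong[OF refl], rule deg_contract_other[OF R \<open>x \<noteq> y\<close>, symmetric]) auto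
  have "(\<Sum>a\<in>V - {x, y}. if a \<in> ?C then 1 else 0::nat) = card ((V - {x, y}) \<inter> ?C)"
    using V(4) by (subst sum.inter_restrict[symmetric]) auto
  also have "(V - {x, y}) \<inter> ?C = ?C" using V(6) by blast
  finally have "(\<Sum>a\<in>V - {x, y}. if a \<in> ?C then 1 else 0::nat) = card ?C" .
  then have s: "(\<Sum>a\<in>V - {x, y}. deg R a) = (\<Sum>a\<in>V - {x, y}. deg ?R a) + card ?C"
    unfolding eq by (simp only: sum.distrib)
  have "V = insert x (insert y (V - {x, y}))" using V by auto
  then have 1: "card R = deg R x + (deg R y + (\<Sum>a\<in>V - {x, y}. deg R a))"
    unfolding sum_deg[OF R, symmetric]
    by (metis (no_types, lifting) V Diff_iff finite_Diff finite_insert insertE insert_iff singletonD sum.insert)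
  have "V - {y} = insert x (V - {x, y})" using V by auto
  then have "card ?R = (\<Sum>a\<in>insert x (V - {x, y}). deg ?R a)"
    unfolding sum_deg[OF sgraph_contract[OF R xy], symmetric] by (simp only:)
  then have 2: "card ?R = deg ?R x + (\<Sum>a\<in>V - {x, y}. deg ?R a)"
    using V(4) by simp
  show ?thesis using 1 2 s deg_contract_same[OF R xy] by linarith
qed

lemma deg_delete_edge:
  assumes R: "sgraph V R" and xy: "(x, y) \<in> R"
  shows "deg (R - {(x, y), (y, x)}) a = (if a = x \<or> a = y then deg R a - 1 else deg R a)"
proof -
  have "x \<noteq> y" "(y, x) \<in> R" using assms sgraphD[OF R] by auto
  have "(R - {(x, y), (y, x)}) `` {a} =
      (if a = x then R `` {a} - {y} else if a = y then R `` {a} - {x} else R `` {a})"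
    by auto
  then show ?thesis
    using \<open>x \<noteq> y\<close> \<open>(y, x) \<in> R\<close> xy sgraphD(8)[OF R] by (auto simp: deg_def)
qed

lemma card_delete_edge:
  assumes R: "sgraph V R" and xy: "(x, y) \<in> R"
  shows "card (R - {(x, y), (y, x)}) + 2 = card R"
proof -
  have "x \<noteq> y" "(y, x) \<in> R" using assms sgraphD[OF R] by auto
  then have "card {(x, y), (y, x)} = 2" "{(x, y), (y, x)} \<subseteq> R" using xy by auto
  then show ?thesis
    using card_Diff_subset[of "{(x, y), (y, x)}" R] card_mono[of R "{(x, y), (y, x)}"] sgraphD(2)[OF R]
    by auto
qed

section \<open>Lifting disjoint cyclic sets\<close>

lemma cyclic_set_mono: "cyclic_set R W \<Longrightarrow> R \<subseteq> R' \<Longrightarrow> cyclic_set R' W"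
  unfolding cyclic_set_def by blast

lemma disjoint_cyclic_mono:
  assumes "disjoint_cyclic k V R" "V \<subseteq> V'" "R \<subseteq> R'"
  shows "disjoint_cyclic k V' R'"
proof -
  obtain C where "\<forall>i<k. C i \<subseteq> V \<and> cyclic_set R (C i)" "\<forall>i<k. \<forall>j<k. i \<noteq> j \<longrightarrow> C i \<inter> C j = {}"
    using assms(1) unfolding disjoint_cyclic_def by blast
  then show ?thesis
    unfolding disjoint_cyclic_def using cyclic_set_mono[OF _ assms(3)] assms(2)
    by (intro exI[of _ C]) blast
qed

text \<open>A neighbour other than \<open>x\<close> lifts to itself, and \<open>x\<close> lifts to
  whichever of \<open>x\<close>, \<open>y\<close> is adjacent to \<open>v\<close> in
  \<open>R\<close>. Since \<open>y \<notin> W\<close>, two distinct neighbours have distinct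
  lifts.\<close>

lemma contract_two_neighbours:
  assumes "y \<notin> W" and two: "\<exists>a\<in>W. \<exists>b\<in>W. a \<noteq> b \<and> (v, a) \<in> contract x y R \<and> (v, b) \<in> contract x y R"
    and v: "v \<noteq> x" and W': "W - {x} \<subseteq> W'" "x \<in> W \<and> (v, x) \<in> R \<longrightarrow> x \<in> W'"
      "x \<in> W \<and> (v, y) \<in> R \<and> (v, x) \<notin> R \<longrightarrow> y \<in> W'"
  shows "\<exists>a\<in>W'. \<exists>b\<in>W'. a \<noteq> b \<and> (v, a) \<in> R \<and> (v, b) \<in> R"
proof -
  obtain a b where ab: "a \<in> W" "b \<in> W" "a \<noteq> b" "(v, a) \<in> contract x y R" "(v, b) \<in> contract x y R"
    using two by blast
  have lift: "\<exists>a'\<in>W'. (v, a') \<in> R \<and> (if a = x then a' \<in> {x, y} else a' = a)"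
    if "a \<in> W" "(v, a) \<in> contract x y R" for a
  proof (cases "a = x")
    case True
    then have "(v, x) \<in> R \<or> (v, x) \<notin> R \<and> (v, y) \<in> R" using that(2) v unfolding contract_def by auto
    then show ?thesis using True that(1) W'(2,3) by auto
  next
    case False
    then have "(v, a) \<in> R" using that(2) v unfolding contract_def by auto
    then show ?thesis using False that(1) W'(1) by auto
  qed
  obtain a' where a': "a' \<in> W'" "(v, a') \<in> R" "if a = x then a' \<in> {x, y} else a' = a"
    using lift[OF ab(1,4)] by blast
  obtain b' where b': "b' \<in> W'" "(v, b') \<in> R" "if b = x then b' \<in> {x, y} else b' = b"
    using lift[OF ab(2,5)] by blast
  have "a' \<noteq> b'" using a'(3) b'(3) ab(1-3) assms(1) by (auto split: if_splits)
  then show ?thesis using a' b' by blast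
qed

text \<open>The four cases ask which of \<open>x\<close>, \<open>y\<close> owns the edges of the
  merged vertex into \<open>W\<close>. If \<open>x\<close> has none, \<open>y\<close> replaces it;
  if \<open>y\<close> has none besides \<open>x\<close>, then \<open>W\<close> itself works; if both
  have some, both are kept and the edge between them gives each its second neighbour.\<close>

lemma cyclic_set_contract:
  assumes R: "sgraph V R" and xy: "(x, y) \<in> R"
    and W: "cyclic_set (contract x y R) W" "W \<subseteq> V - {y}"
  shows "\<exists>W'. cyclic_set R W' \<and> W' \<subseteq> (if x \<in> W then insert y W else W)"
proof -
  have ne: "x \<noteq> y" and yx: "(y, x) \<in> R" and yW: "y \<notin> W"
    using xy W(2) sgraphD(5,6)[OF R] by blast+
  have nb: "\<exists>a\<in>W. \<exists>b\<in>W. a \<noteq> b \<and> (v, a) \<in> contract x y R \<and> (v, b) \<in> contract x y R"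
    if "v \<in> W" for v
    using W(1) that unfolding cyclic_set_def by blast
  note other = contract_two_neighbours[OF yW nb]
  consider "x \<notin> W" | "x \<in> W" "\<forall>w\<in>W. (x, w) \<notin> R" | "x \<in> W" "\<forall>w\<in>W - {x}. (y, w) \<notin> R"
    | "x \<in> W" "\<exists>w\<in>W. (x, w) \<in> R" "\<exists>w\<in>W - {x}. (y, w) \<in> R" by blast
  then show ?thesis
  proof cases
    case 1
    have "cyclic_set R W" unfolding cyclic_set_def
    proof (intro conjI ballI)
      fix v assume v: "v \<in> W"
      then have "v \<noteq> x" using 1 by auto
      then show "\<exists>a\<in>W. \<exists>b\<in>W. a \<noteq> b \<and> (v, a) \<in> R \<and> (v, b) \<in> R"
        by (rule other[OF v]) (use 1 in auto)
    qed (use W in \<open>auto simp: cyclic_set_def\<close>)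
    then show ?thesis using 1 by auto
  next
    case 2
    obtain a b where ab: "a \<in> W" "b \<in> W" "a \<noteq> b" "(x, a) \<in> contract x y R" "(x, b) \<in> contract x y R"
      using nb[OF 2(1)] by auto
    then have ab': "a \<noteq> x" "b \<noteq> x" "(y, a) \<in> R" "(y, b) \<in> R"
      using 2 ne sgraphD[OF R] unfolding contract_def by auto
    have "cyclic_set R (insert y (W - {x}))" unfolding cyclic_set_def
    proof (intro conjI ballI)
      fix v assume "v \<in> insert y (W - {x})"
      then consider "v = y" | "v \<in> W" "v \<noteq> x" by auto
      then show "\<exists>a\<in>insert y (W - {x}). \<exists>b\<in>insert y (W - {x}). a \<noteq> b \<and> (v, a) \<in> R \<and> (v, b) \<in> R"
      proof cases
        case 1
        then show ?thesis using ab ab' by auto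
      next
        case v: 2
        have "(v, x) \<notin> R" using v 2 sgraphD(5)[OF R] by blast
        show ?thesis by (rule other[OF v]) (use \<open>(v, x) \<notin> R\<close> in auto)
      qed
    qed simp
    then show ?thesis using 2 by auto
  next
    case 3
    obtain a b where ab: "a \<in> W" "b \<in> W" "a \<noteq> b" "(x, a) \<in> contract x y R" "(x, b) \<in> contract x y R"
      using nb[OF 3(1)] by auto
    then have ab': "(x, a) \<in> R" "(x, b) \<in> R"
      using 3 ne sgraphD[OF R] unfolding contract_def by auto
    have "cyclic_set R W" unfolding cyclic_set_def
    proof (intro conjI ballI)
      fix v assume v: "v \<in> W"
      show "\<exists>a\<in>W. \<exists>b\<in>W. a \<noteq> b \<and> (v, a) \<in> R \<and> (v, b) \<in> R"
      proof (cases "v = x")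
        case True
        then show ?thesis using ab ab' by auto
      next
        case False
        have "(v, y) \<notin> R" using False v 3 sgraphD(5)[OF R] by blast
        show ?thesis by (rule other[OF v False]) (use 3 \<open>(v, y) \<notin> R\<close> in auto)
      qed
    qed (use 3 in auto)
    then show ?thesis using 3 by auto
  next
    case 4
    then obtain p q where pq: "p \<in> W" "(x, p) \<in> R" "q \<in> W" "q \<noteq> x" "(y, q) \<in> R" by blast
    have "cyclic_set R (insert y W)" unfolding cyclic_set_def
    proof (intro conjI ballI)
      fix v assume "v \<in> insert y W"
      then consider "v = y" | "v = x" | "v \<in> W" "v \<noteq> x" by auto
      then show "\<exists>a\<in>insert y W. \<exists>b\<in>insert y W. a \<noteq> b \<and> (v, a) \<in> R \<and> (v, b) \<in> R"
      proof cases
        case 1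
        then show ?thesis using pq 4(1) yx by blast
      next
        case 2
        moreover have "p \<noteq> y" using pq(1) yW by blast
        ultimately show ?thesis using pq(1,2) xy by blast
      next
        case v: 3
        show ?thesis by (rule other[OF v]) (use 4 in auto)
      qed
    qed simp
    then show ?thesis using 4 by auto
  qed
qed

lemma disjoint_cyclicE:
  assumes "disjoint_cyclic k V R"
  obtains C where "\<And>i. i < k \<Longrightarrow> C i \<subseteq> V" "\<And>i. i < k \<Longrightarrow> cyclic_set R (C i)"
    "\<And>i j. i < k \<Longrightarrow> j < k \<Longrightarrow> i \<noteq> j \<Longrightarrow> C i \<inter> C j = {}"
proof -
  obtain C where "\<forall>i<k. C i \<subseteq> V \<and> cyclic_set R (C i)" "\<forall>i<k. \<forall>j<k. i \<noteq> j \<longrightarrow> C i \<inter> C j = {}"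
    using assms unfolding disjoint_cyclic_def by (elim exE conjE)
  then show ?thesis by (intro that[of C]) simp_all
qed

text \<open>At most one of the disjoint sets contains \<open>x\<close>, so at most one lifted set
  acquires \<open>y\<close>.\<close>

lemma disjoint_cyclic_contract:
  assumes R: "sgraph V R" and xy: "(x, y) \<in> R"
    and "disjoint_cyclic k (V - {y}) (contract x y R)"
  shows "disjoint_cyclic k V R"
proof -
  obtain C where C: "\<And>i. i < k \<Longrightarrow> C i \<subseteq> V - {y}" "\<And>i. i < k \<Longrightarrow> cyclic_set (contract x y R) (C i)"
    "\<And>i j. i < k \<Longrightarrow> j < k \<Longrightarrow> i \<noteq> j \<Longrightarrow> C i \<inter> C j = {}"
    using disjoint_cyclicE[OF assms(3)] by metis
  have "\<forall>i. \<exists>W'. i < k \<longrightarrow> cyclic_set R W' \<and> W' \<subseteq> (if x \<in> C i then insert y (C i) else C i)"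
  proof
    fix i show "\<exists>W'. i < k \<longrightarrow> cyclic_set R W' \<and> W' \<subseteq> (if x \<in> C i then insert y (C i) else C i)"
      using cyclic_set_contract[OF R xy C(2)[of i] C(1)[of i]] by blast
  qed
  then obtain D where D: "\<And>i. i < k \<Longrightarrow> cyclic_set R (D i)"
    "\<And>i. i < k \<Longrightarrow> D i \<subseteq> (if x \<in> C i then insert y (C i) else C i)" by metis
  have "y \<in> V" using sgraphD(4)[OF R xy] .
  then have "D i \<subseteq> V" if "i < k" for i
    using D(2)[OF that] C(1)[OF that] by (auto split: if_splits)
  moreover have "D i \<inter> D j = {}" if "i < k" "j < k" "i \<noteq> j" for i j
  proof (cases "x \<in> C i")
    case True
    then have "x \<notin> C j" using C(3)[OF that] by blast
    then show ?thesis
      using True D(2)[OF that(1)] D(2)[OF that(2)] C(1)[OF that(2)] C(3)[OF that] by auto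
  next
    case False
    then have "D i \<subseteq> C i" "D j \<subseteq> insert y (C j)"
      using D(2)[OF that(1)] D(2)[OF that(2)] by (auto split: if_splits)
    then show ?thesis using C(1)[OF that(1)] C(3)[OF that] by auto
  qed
  ultimately show ?thesis unfolding disjoint_cyclic_def using D(1) by (intro exI[of _ D]) simp
qed

lemma disjoint_cyclic_Suc:
  assumes "disjoint_cyclic k (V - Q) (R \<inter> (V - Q) \<times> (V - Q))" "cyclic_set R Q" "Q \<subseteq> V"
  shows "disjoint_cyclic (Suc k) V R"
proof -
  have "disjoint_cyclic k (V - Q) R" using assms(1) by (rule disjoint_cyclic_mono) auto
  from disjoint_cyclicE[OF this] obtain C where C: "\<And>i. i < k \<Longrightarrow> C i \<subseteq> V - Q" "\<And>i. i < k \<Longrightarrow> cyclic_set R (C i)"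
    "\<And>i j. i < k \<Longrightarrow> j < k \<Longrightarrow> i \<noteq> j \<Longrightarrow> C i \<inter> C j = {}" by metis
  show ?thesis unfolding disjoint_cyclic_def
  proof (intro exI[of _ "C(k := Q)"] conjI allI impI)
    fix i assume "i < Suc k"
    then show "(C(k := Q)) i \<subseteq> V" "cyclic_set R ((C(k := Q)) i)"
      using assms C(1,2)[of i] by (auto simp: less_Suc_eq)
  next
    fix i j assume "i < Suc k" "j < Suc k" "i \<noteq> j"
    then show "(C(k := Q)) i \<inter> (C(k := Q)) j = {}"
      using C(1)[of i] C(1)[of j] C(3)[of i j] by (cases "i = k"; cases "j = k") (simp_all, blast+)
  qed
qed

section \<open>Mader's bound\<close>

text \<open>The interface between the two halves of the proof: the counting arguments see planarity
  only through these properties.\<close>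

locale minor_class =
  fixes P :: "'a set \<Rightarrow> ('a \<times> 'a) set \<Rightarrow> bool"
  assumes P_sgraph: "P V R \<Longrightarrow> sgraph V R"
    and P_restrict: "P V R \<Longrightarrow> U \<subseteq> V \<Longrightarrow> P U (R \<inter> U \<times> U)"
    and P_delete_edge: "P V R \<Longrightarrow> P V (R - {(x, y), (y, x)})"
    and P_contract: "P V R \<Longrightarrow> (x, y) \<in> R \<Longrightarrow> P (V - {y}) (contract x y R)"
    and P_no_K5: "P V R \<Longrightarrow> card S = 5 \<Longrightarrow> \<exists>a\<in>S. \<exists>b\<in>S. a \<noteq> b \<and> (a, b) \<notin> R"
    and P_no_K33: "P V R \<Longrightarrow> card A = 3 \<Longrightarrow> card B = 3 \<Longrightarrow> \<not> A \<times> B \<subseteq> R"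

lemma card_arcs_le:
  assumes "sgraph V R"
  shows "card R \<le> card V * (card V - 1)"
proof -
  have "deg R v \<le> card V - 1" if "v \<in> V" for v
  proof -
    have "R `` {v} \<subseteq> V - {v}" using sgraphD(4,6)[OF assms] by auto
    then have "deg R v \<le> card (V - {v})"
      unfolding deg_def using sgraphD(1)[OF assms] by (intro card_mono) auto
    then show ?thesis using that sgraphD(1)[OF assms] by simp
  qed
  then show ?thesis using sum_bounded_above[of V "deg R" "card V - 1"] sum_deg[OF assms] by simp
qed

lemma card_delete_vertex:
  assumes R: "sgraph V R" and "v \<in> V"
  shows "card R = card (R \<inter> (V - {v}) \<times> (V - {v})) + 2 * deg R v"
proof -
  have 1: "insert v (V - {v}) = V" using assms by auto
  have 2: "R \<inter> V \<times> V = R" "R `` {v} \<inter> (V - {v}) = R `` {v}"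
    using sgraphD(3,4,6)[OF R] by auto
  show ?thesis
    using card_arcs_insert[OF R, of "V - {v}" v, unfolded 1 2] sgraphD(1)[OF R] by (simp add: deg_def)
qed

text \<open>By density the non-edges inside \<open>N\<close> form a matching. There is at least one,
  \<open>ab\<close>, as otherwise \<open>v\<close> and four neighbours form a K5. Contracting an
  edge from \<open>a\<close> to a third neighbour repairs this non-edge and yields a K5.\<close>

lemma (in minor_class) no_dense_five_neighbours:
  assumes P: "P V R" and N: "N = R `` {v}" "card N = 5"
    and dense: "\<And>u. u \<in> N \<Longrightarrow> card (R `` {u} \<inter> N) \<ge> 3"
  shows False
proof -
  note R = P_sgraph[OF P]
  have sym: "\<And>a b. (a, b) \<in> R \<Longrightarrow> (b, a) \<in> R" and irr: "\<And>a. (a, a) \<notin> R"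
    using sgraphD(5,6)[OF R] by auto
  have finN: "finite N" using N(2) card.infinite by fastforce
  \<comment> \<open>Each vertex of \<open>N\<close> misses at most one other: two misses would leave
    it only two possible neighbours in \<open>N\<close>.\<close>
  have unique: "b = c" if "a \<in> N" "b \<in> N" "c \<in> N" "a \<noteq> b" "a \<noteq> c" "(a, b) \<notin> R" "(a, c) \<notin> R" for a b c
  proof (rule ccontr)
    assume "b \<noteq> c"
    have "R `` {a} \<inter> N \<subseteq> N - {a, b, c}" using that irr by auto
    then have "card (R `` {a} \<inter> N) \<le> card (N - {a, b, c})" using finN by (intro card_mono) auto
    also have "\<dots> = card N - card {a, b, c}" using that by (intro card_Diff_subset) auto
    also have "\<dots> = 2" using that \<open>b \<noteq> c\<close> N(2) by simp
    finally show False using dense[OF that(1)] by simp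
  qed
  obtain S where S: "S \<subseteq> N" "card S = 4" using N(2) obtain_subset_with_card_n[of 4 N] by auto
  have vN: "v \<notin> N" and vR: "\<And>u. u \<in> N \<Longrightarrow> (v, u) \<in> R" using N(1) irr by auto
  have "card (insert v S) = 5" using S vN finite_subset[OF S(1) finN] by (subst card_insert_disjoint) auto
  from P_no_K5[OF P this] obtain a b where ab: "a \<in> N" "b \<in> N" "a \<noteq> b" "(a, b) \<notin> R"
    using S(1) vR sym by blast
  have "card (N - {a, b}) = 3" using ab N(2) card_Diff_subset[of "{a, b}" N] by simp
  then obtain x y z where xyz: "N - {a, b} = {x, y, z}" "x \<noteq> y" "x \<noteq> z" "y \<noteq> z"
    by (auto simp: card_3_iff)
  \<comment> \<open>Among the three vertices besides \<open>a\<close> and \<open>b\<close> at most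
    one pair is non-adjacent. It is named \<open>p\<close>, \<open>q\<close>, so that
    \<open>w\<close> is adjacent to both.\<close>
  obtain p q w where pqw: "N - {a, b} = {p, q, w}" "p \<noteq> q" "p \<noteq> w" "q \<noteq> w" "(w, p) \<in> R" "(w, q) \<in> R"
  proof -
    have N3: "x \<in> N" "y \<in> N" "z \<in> N" using xyz by auto
    consider "(x, y) \<in> R" "(x, z) \<in> R" | "(x, y) \<notin> R" | "(x, z) \<notin> R" by blast
    then show thesis
    proof cases
      case 1
      then show thesis using that[of y z x] xyz by auto
    next
      case 2
      then have "(x, z) \<in> R" "(y, z) \<in> R"
        using unique[of x y z] unique[of y x z] xyz(2-4) N3 sym by metis+
      then show thesis using that[of x y z] xyz sym by auto
    next
      case 3
      then have "(x, y) \<in> R" "(z, y) \<in> R"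
        using unique[of x y z] unique[of z x y] xyz(2-4) N3 sym by metis+
      then show thesis using that[of x z y] xyz sym by auto
    qed
  qed
  have N5: "p \<in> N" "q \<in> N" "w \<in> N" and ne: "p \<noteq> a" "p \<noteq> b" "q \<noteq> a" "q \<noteq> b" "w \<noteq> a" "w \<noteq> b"
    using pqw(1) by auto
  have adj: "(a, t) \<in> R" "(b, t) \<in> R" if "t \<in> {p, q, w}" for t
  proof -
    have t: "t \<in> N" "t \<noteq> a" "t \<noteq> b" using that N5 ne by auto
    have "(b, a) \<notin> R" using ab(4) sym by blast
    then show "(a, t) \<in> R" "(b, t) \<in> R"
      using unique[of a b t] unique[of b a t] ab t by blast+
  qed
  \<comment> \<open>The vertex \<open>p\<close> is adjacent to both \<open>a\<close> and
    \<open>b\<close>, so absorbing it into \<open>a\<close> creates the edge \<open>ab\<close>; the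
    possible non-edge \<open>pq\<close> disappears with \<open>p\<close>.\<close>
  let ?R = "contract a p R" and ?S = "{a, b, q, w, v}"
  have vne: "v \<noteq> p" "v \<noteq> a" "v \<noteq> b" "v \<noteq> q" "v \<noteq> w" using vN N5 ab(1,2) by blast+
  have c5: "card ?S = 5" using pqw(4) ne(3-6) ab(3) vne by simp
  have P': "P (V - {p}) ?R" by (rule P_contract[OF P adj(1)]) simp
  obtain c d where cd: "c \<in> ?S" "d \<in> ?S" "c \<noteq> d" "(c, d) \<notin> ?R"
    using P_no_K5[OF P' c5] by (elim bexE conjE)
  have all: "(a, q) \<in> R" "(a, w) \<in> R" "(a, v) \<in> R" "(b, q) \<in> R" "(b, w) \<in> R" "(b, v) \<in> R"
    "(q, w) \<in> R" "(q, v) \<in> R" "(w, v) \<in> R" "(b, p) \<in> R"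
    using adj[of p] adj[of q] adj[of w] vR[THEN sym] sym[OF pqw(6)] N5 ab(1,2) by simp_all
  have "(c, d) \<in> ?R"
    using cd(1-3) all all[THEN sym] pqw(2-4) ne vne ab(3) unfolding contract_def
    by (elim insertE emptyE) simp_all
  then show False using cd by blast
qed

text \<open>Mader's bound by minimal counterexample. Deleting an edge shows that the bound is
  exceeded by at most one edge, so some degree is at most 5; deleting a vertex gives minimum degree
  4; contracting an edge shows that its ends have at least three common neighbours. A vertex of
  degree 4 thus lies in a K5, and degree 5 is \<open>no_dense_five_neighbours\<close>.\<close>

lemma (in minor_class) card_arcs_bound:
  "P V R \<Longrightarrow> card V \<ge> 3 \<Longrightarrow> card R + 12 \<le> 6 * card V"
proof (induction "card V + card R" arbitrary: V R rule: less_induct)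
  case less
  note R = P_sgraph[OF less.prems(1)]
  show ?case
  proof (rule ccontr)
    assume big: "\<not> ?case"
    \<comment> \<open>Complete graphs on three and four vertices meet the bound with equality. With
      five vertices, the smaller graphs below still satisfy the size condition of the
      induction.\<close>
    have "card V \<noteq> 3" "card V \<noteq> 4" using big card_arcs_le[OF R] by auto
    then have V5: "card V \<ge> 5" using less.prems(2) by simp
    have edge: "card R + 10 \<le> 6 * card V"
    proof (rule ccontr)
      assume *: "\<not> ?thesis"
      then have "card R \<noteq> 0" using V5 big card_arcs_le[OF R] by (auto)
      then have "R \<noteq> {}" by auto
      then obtain x y where xy: "(x, y) \<in> R" by auto
      show False
        using less.hyps[OF _ P_delete_edge[OF less.prems(1), of x y]] card_delete_edge[OF R xy] * V5
        by auto
    qed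
    have deg4: "deg R v \<ge> 4" if v: "v \<in> V" for v
    proof (rule ccontr)
      assume *: "\<not> ?thesis"
      have c: "card (V - {v}) = card V - 1" using v sgraphD(1)[OF R] by simp
      have "card (V - {v}) + card (R \<inter> (V - {v}) \<times> (V - {v})) < card V + card R"
        using card_delete_vertex[OF R v] c V5 by linarith
      from less.hyps[OF this P_restrict[OF less.prems(1)]]
      have "card (R \<inter> (V - {v}) \<times> (V - {v})) + 12 \<le> 6 * card (V - {v})" using c V5 by auto
      then show False using card_delete_vertex[OF R v] * V5 c big by linarith
    qed
    have tri: "card (R `` {x} \<inter> R `` {y}) \<ge> 3" if xy: "(x, y) \<in> R" for x y
    proof (rule ccontr)
      assume *: "\<not> ?thesis"
      have c: "card (V - {y}) = card V - 1" using sgraphD(1)[OF R] sgraphD(4)[OF R xy] by simp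
      then have "card (V - {y}) + card (contract x y R) < card V + card R"
        using card_contract[OF R xy] V5 by linarith
      from less.hyps[OF this P_contract[OF less.prems(1) xy]]
      have "card (contract x y R) + 12 \<le> 6 * card (V - {y})" using c V5 by auto
      then show False using card_contract[OF R xy] * V5 c big by linarith
    qed
    obtain v where v: "v \<in> V" "deg R v \<le> 5"
    proof (rule ccontr)
      assume "\<not> thesis"
      then have "\<forall>v\<in>V. 6 \<le> deg R v" using that by fastforce
      then show False using sum_bounded_below[of V 6 "deg R"] sum_deg[OF R] edge by simp
    qed
    define N where "N = R `` {v}"
    have cN: "card N = 4 \<or> card N = 5" using v deg4[OF v(1)] by (auto simp: deg_def N_def)
    have dense: "card (R `` {u} \<inter> N) \<ge> 3" if "u \<in> N" for u
      using tri[of v u] that by (simp add: N_def Int_commute)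
    have finN: "finite N" using sgraphD(8)[OF R] by (simp add: N_def)
    show False
    proof (cases "card N = 5")
      case True
      then show False using no_dense_five_neighbours[OF less.prems(1) N_def _ dense] by blast
    next
      case False
      then have c4: "card N = 4" using cN by simp
      have vN: "v \<notin> N" using sgraphD(6)[OF R] by (auto simp: N_def)
      have "(a, b) \<in> R" if "a \<in> N" "b \<in> N" "a \<noteq> b" for a b
      proof -
        have sub: "R `` {a} \<inter> N \<subseteq> N - {a}" using sgraphD(6)[OF R, of a] by auto
        have "card (N - {a}) = 3" using c4 that finN by simp
        then have "R `` {a} \<inter> N = N - {a}"
          using card_seteq[OF _ sub] dense[OF that(1)] finN by simp
        then show ?thesis using that by blast
      qed
      moreover have "\<And>a. a \<in> N \<Longrightarrow> (v, a) \<in> R \<and> (a, v) \<in> R"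
        using sgraphD(5)[OF R] by (auto simp: N_def)
      ultimately have "\<And>a b. a \<in> insert v N \<Longrightarrow> b \<in> insert v N \<Longrightarrow> a \<noteq> b \<Longrightarrow> (a, b) \<in> R" by blast
      moreover have "card (insert v N) = 5" using c4 vN finN by simp
      ultimately show False using P_no_K5[OF less.prems(1)] by blast
    qed
  qed
qed

section \<open>Minimal counterexamples\<close>

text \<open>A score per vertex whose sum is \<open>|H| - |L|\<close>; it lets the effect of each
  graph operation be tracked vertex by vertex. The score 0 belongs to degree 2k - 1 alone.\<close>

definition val :: "nat \<Rightarrow> nat \<Rightarrow> int" where
  "val k d = (if d \<ge> 2 * k then 1 else if d \<le> 2 * k - 2 then - 1 else 0)"

definition excess :: "nat \<Rightarrow> 'a set \<Rightarrow> ('a \<times> 'a) set \<Rightarrow> int" where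
  "excess k V R = (\<Sum>v\<in>V. val k (deg R v))"

lemma val_le_1: "val k d \<le> 1"
  by (simp add: val_def)

lemma excess_le_card: "excess k V R \<le> int (card V)"
  unfolding excess_def using sum_bounded_above[of V "\<lambda>v. val k (deg R v)" 1] val_le_1 by simp

text \<open>The score is monotone and drops by at most 1 when the degree drops by 1. If
  \<open>val k d = 0\<close>, then \<open>d - 2\<close> is at least 1 and monotonicity suffices; if
  it is -1, a drop from \<open>e\<close> to \<open>e - 1\<close> is affordable.\<close>

lemma val_merge:
  "2 \<le> k \<Longrightarrow> 1 \<le> d \<Longrightarrow> 1 \<le> e \<Longrightarrow> val k d \<le> 0 \<Longrightarrow> val k d + val k e \<le> val k (d + e - 2)"
  unfolding val_def by (auto split: if_splits)

text \<open>A linear majorant, which turns the excess into an edge count when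
  \<open>k = 2\<close>.\<close>

lemma val_2_le: "2 \<le> d \<Longrightarrow> val 2 d \<le> int d - 3"
  unfolding val_def by auto

text \<open>The thresholds for \<open>k - 1\<close> lie 2 lower, so losing \<open>q = 2\<close>
  neighbours changes nothing. A third lost neighbour costs at most 1, while a vertex of degree 2k -
  1 losing at most one rises from score 0 to 1.\<close>

lemma val_shift:
  "3 \<le> k \<Longrightarrow> q \<le> 3 \<Longrightarrow> val k (d + q) \<le> val (k - 1) d +
    ((if q = 3 then 1 else 0) - (if d + q = 2 * k - 1 \<and> q \<le> 1 then 1 else 0))"
  unfolding val_def by (auto split: if_splits)

lemma sum_diff_two:
  fixes f g :: "'a \<Rightarrow> int"
  assumes "finite V" "x \<in> V" "y \<in> V" "x \<noteq> y" "\<And>a. a \<in> V \<Longrightarrow> a \<noteq> x \<Longrightarrow> a \<noteq> y \<Longrightarrow> f a = g a"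
  shows "sum f V - sum g V = (f x - g x) + (f y - g y)"
proof -
  have "sum f V - sum g V = (\<Sum>a\<in>V. f a - g a)" by (simp add: sum_subtractf)
  also have "\<dots> = (\<Sum>a\<in>{x, y}. f a - g a)"
    by (rule sum.mono_neutral_right) (use assms in auto)
  finally show ?thesis using assms(4) by simp
qed

lemma cyclic_triangle:
  assumes "sgraph V R" "(x, y) \<in> R" "(y, z) \<in> R" "(z, x) \<in> R"
  shows "cyclic_set R {x, y, z}" "x \<noteq> y" "y \<noteq> z" "x \<noteq> z" "{x, y, z} \<subseteq> V"
proof -
  show d: "x \<noteq> y" "y \<noteq> z" "x \<noteq> z" using sgraphD(6)[OF assms(1)] assms by blast+
  show "{x, y, z} \<subseteq> V" using sgraphD(3)[OF assms(1)] assms by blast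
  show "cyclic_set R {x, y, z}"
    unfolding cyclic_set_def using assms(2-4) assms(2-4)[THEN sgraphD(5)[OF assms(1)]] d by auto
qed

lemma sum_deg_split:
  assumes "sgraph V R" "F \<union> Q = V" "F \<inter> Q = {}"
  shows "(\<Sum>v\<in>F. deg R v) = card (R \<inter> F \<times> F) + card (R \<inter> F \<times> Q)"
proof -
  have F: "finite F" using sgraphD(1)[OF assms(1)] assms(2) by (metis finite_Un)
  show ?thesis
    unfolding card_arcs[OF assms(1) F] sum.distrib[symmetric]
    by (rule sum.cong[OF refl], rule deg_split[OF assms])
qed

text \<open>The measure in \<open>minimal\<close> does not involve \<open>k'\<close>, so the
  counterexample may also be compared with smaller graphs for \<open>k - 1\<close>.\<close>

locale counterexample = minor_class P for P :: "'a set \<Rightarrow> ('a \<times> 'a) set \<Rightarrow> bool" +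
  fixes V :: "'a set" and R :: "('a \<times> 'a) set" and k :: nat
  assumes PV: "P V R" and k2: "2 \<le> k" and excess: "2 * int k \<le> excess k V R"
    and no_cycles: "\<not> disjoint_cyclic k V R"
    and minimal: "\<And>V' R' k'. P V' R' \<Longrightarrow> 2 \<le> k' \<Longrightarrow> card V' + card R' < card V + card R \<Longrightarrow>
      2 * int k' \<le> excess k' V' R' \<Longrightarrow> disjoint_cyclic k' V' R'"
begin

lemmas R = P_sgraph[OF PV]
lemmas finV = sgraphD(1)[OF R]
lemmas sym = sgraphD(5)[OF R]
lemmas irr = sgraphD(6)[OF R]

text \<open>An isolated vertex scores -1, so deleting it would raise the excess.\<close>

lemma deg_pos: assumes v: "v \<in> V" shows "1 \<le> deg R v"
proof (rule ccontr)
  assume *: "\<not> 1 \<le> deg R v"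
  then have "R `` {v} = {}" using deg_pos_iff[OF R, of v] by simp
  then have "(v, b) \<notin> R" "(b, v) \<notin> R" for b using sym[of b v] by blast+
  then have eq: "R \<inter> (V - {v}) \<times> (V - {v}) = R" using sgraphD(3,4)[OF R] by auto
  have P': "P (V - {v}) R" using P_restrict[OF PV, of "V - {v}"] eq by simp
  have "excess k (V - {v}) R = excess k V R - val k (deg R v)"
    unfolding excess_def by (simp add: sum_diff1 finV v)
  moreover have "val k (deg R v) = - 1" using * k2 by (simp add: val_def)
  ultimately have "2 * int k \<le> excess k (V - {v}) R" using excess by simp
  moreover have "card (V - {v}) + card R < card V + card R" using card_Diff1_less[OF finV v] by simp
  ultimately have "disjoint_cyclic k (V - {v}) R" by (intro minimal[OF P' k2])
  then show False using no_cycles disjoint_cyclic_mono[of k "V - {v}" R V R] by blast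
qed

text \<open>Deleting an edge creates no cyclic sets, so by minimality it must push the excess below
  2k, and only the two ends change their scores.\<close>

lemma edge_cost:
  assumes xy: "(x, y) \<in> R"
  shows "excess k V R < 2 * int k + (val k (deg R x) - val k (deg R x - 1))
    + (val k (deg R y) - val k (deg R y - 1))"
proof (rule ccontr)
  assume *: "\<not> ?thesis"
  let ?R = "R - {(x, y), (y, x)}"
  have ne: "x \<noteq> y" using irr xy by blast
  have V: "x \<in> V" "y \<in> V" using sgraphD(3,4)[OF R xy] .
  have "excess k V R - excess k V ?R = (val k (deg R x) - val k (deg R x - 1))
    + (val k (deg R y) - val k (deg R y - 1))"
    unfolding excess_def by (subst sum_diff_two[OF finV V ne]) (simp_all add: deg_delete_edge[OF R xy])
  then have "2 * int k \<le> excess k V ?R" using * by simp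
  moreover have "card V + card ?R < card V + card R" using card_delete_edge[OF R xy] by simp
  ultimately have "disjoint_cyclic k V ?R" by (intro minimal[OF P_delete_edge[OF PV] k2])
  then show False using no_cycles disjoint_cyclic_mono[of k V ?R V R] by blast
qed

text \<open>The score of an end drops only when its degree passes from 2k to 2k - 1 or from 2k - 1
  to 2k - 2.\<close>

lemma edge_cost_cases:
  assumes xy: "(x, y) \<in> R"
  shows "deg R x \<in> {2 * k - 1, 2 * k} \<or> deg R y \<in> {2 * k - 1, 2 * k}"
proof -
  have "0 < (val k (deg R x) - val k (deg R x - 1)) + (val k (deg R y) - val k (deg R y - 1))"
    using edge_cost[OF xy] excess by simp
  then show ?thesis using k2 unfolding val_def by (auto split: if_splits)
qed

lemma V_nonempty: "V \<noteq> {}"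
  using excess k2 by (auto simp: excess_def)

lemma neighbour: assumes "v \<in> V" obtains x where "(v, x) \<in> R"
  using deg_pos[OF assms] deg_pos_iff[OF R, of v] by auto

lemma excess_le: "excess k V R \<le> 2 * int k + 1"
proof -
  obtain x y where xy: "(x, y) \<in> R" using V_nonempty neighbour by blast
  have "val k d - val k (d - 1) \<le> 1" for d unfolding val_def by auto
  from this[of "deg R x"] this[of "deg R y"] show ?thesis using edge_cost[OF xy] by linarith
qed

text \<open>Without a common neighbour, contraction leaves all other degrees alone and merges the
  ends into degree \<open>d + e - 2\<close>. By \<open>val_merge\<close> the excess does not drop,
  and disjoint cyclic sets of the contracted graph lift back.\<close>

lemma common_neighbour:
  assumes xy: "(x, y) \<in> R" and low: "val k (deg R x) \<le> 0"
  obtains z where "(x, z) \<in> R" "(y, z) \<in> R"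
proof (rule ccontr)
  assume "\<not> thesis"
  then have none: "R `` {x} \<inter> R `` {y} = {}" using that by blast
  let ?R = "contract x y R"
  have V: "x \<in> V" "y \<in> V" and ne: "x \<noteq> y" using sgraphD(3,4,6)[OF R] xy by blast+
  have eq: "V - {y} = insert x (V - {x, y})" using V ne by auto
  have "excess k (V - {y}) ?R = val k (deg ?R x) + (\<Sum>a\<in>V - {x, y}. val k (deg ?R a))"
    unfolding excess_def eq using finV by simp
  also have "(\<Sum>a\<in>V - {x, y}. val k (deg ?R a)) = (\<Sum>a\<in>V - {x, y}. val k (deg R a))"
  proof (rule sum.cong[OF refl])
    fix a assume "a \<in> V - {x, y}"
    then show "val k (deg ?R a) = val k (deg R a)"
      using deg_contract_other[OF R ne, of a] none by auto
  qed
  also have "\<dots> = excess k V R - val k (deg R x) - val k (deg R y)"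
    unfolding excess_def using V ne finV by (subst sum_diff) auto
  also have "deg ?R x = deg R x + deg R y - 2" using deg_contract_same[OF R xy] none by simp
  finally have "2 * int k \<le> excess k (V - {y}) ?R"
    using val_merge[OF k2 deg_pos[OF V(1)] deg_pos[OF V(2)] low] excess by simp
  moreover have "card (V - {y}) + card ?R < card V + card R"
    using card_contract[OF R xy] card_Diff1_less[OF finV V(2)] by simp
  ultimately have "disjoint_cyclic k (V - {y}) ?R" by (intro minimal[OF P_contract[OF PV xy] k2])
  then show False using no_cycles disjoint_cyclic_contract[OF R xy] by blast
qed

lemma deg_ge_2: assumes v: "v \<in> V" shows "2 \<le> deg R v"
proof (rule ccontr)
  assume *: "\<not> 2 \<le> deg R v"
  then have low: "val k (deg R v) \<le> 0" using k2 by (simp add: val_def)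
  obtain x where x: "(v, x) \<in> R" using neighbour[OF v] .
  obtain z where z: "(v, z) \<in> R" "(x, z) \<in> R" using common_neighbour[OF x low] .
  have "x \<noteq> z" using z(2) irr by blast
  then have "card {x, z} = 2" by simp
  moreover have "card {x, z} \<le> card (R `` {v})"
    by (rule card_mono) (use x z sgraphD(8)[OF R] in auto)
  ultimately show False using * by (simp add: deg_def)
qed

text \<open>
  Passing from \<open>k\<close> to \<open>k - 1\<close> offsets the loss of two neighbours, so deleting the triangle lowers only
  the values of vertices adjacent to all of it, and raises those of the vertices of degree \<open>2k - 1\<close>
  with at most one neighbour on it.
\<close>
lemma triangle_sum:
  assumes k3: "3 \<le> k" and xyz: "(x, y) \<in> R" "(y, z) \<in> R" "(z, x) \<in> R"
  shows "3 + int (card {w \<in> V - {x, y, z}. deg R w = 2 * k - 1 \<and> card (R `` {w} \<inter> {x, y, z}) \<le> 1})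
    \<le> val k (deg R x) + val k (deg R y) + val k (deg R z) + int (card {w \<in> V. {x, y, z} \<subseteq> R `` {w}})"
proof -
  define Q where "Q = {x, y, z}"
  define U where "U = V - Q"
  define d where "d w = card (R `` {w} \<inter> Q)" for w
  define F where "F = {w \<in> V. Q \<subseteq> R `` {w}}"
  define G where "G = {w \<in> U. deg R w = 2 * k - 1 \<and> d w \<le> 1}"
  let ?R = "R \<inter> U \<times> U"
  note tri = cyclic_triangle[OF R xyz]
  have Q: "cyclic_set R Q" "Q \<subseteq> V" "card Q = 3" "Q \<noteq> {}" "finite Q" using tri by (auto simp: Q_def)
  have UQ: "U \<union> Q = V" "U \<inter> Q = {}" "finite U" using Q(2) finV by (auto simp: U_def)
  have "\<not> disjoint_cyclic (k - 1) U ?R"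
    using disjoint_cyclic_Suc[OF _ Q(1,2), of "k - 1"] no_cycles k3 by (auto simp: U_def)
  moreover have "card U + card ?R < card V + card R"
    by (rule card_arcs_restrict_less[OF R]) (use Q in \<open>auto simp: U_def\<close>)
  moreover have "P U ?R" using UQ(1) by (intro P_restrict[OF PV]) blast
  \<comment> \<open>\<open>k - 1\<close> disjoint cyclic sets off the triangle would, together with
    it, make \<open>k\<close>. Hence the excess falls from at least 2k to at most 2k - 3, which is
    the constant 3 in the claim.\<close>
  ultimately have ex': "excess (k - 1) U ?R < 2 * int (k - 1)"
    using minimal[of U ?R "k - 1"] k3 by force
  have degU: "deg R w = deg ?R w + d w" if "w \<in> U" for w
  proof -
    have "?R `` {w} = R `` {w} \<inter> U" using that by auto
    then show ?thesis using deg_split[OF R UQ(1,2), of w] by (simp only: deg_def d_def)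
  qed
  have d3: "d w \<le> 3" for w
    unfolding d_def Q(3)[symmetric] by (rule card_mono) (use Q in auto)
  have full: "w \<in> F" if "d w = 3" "w \<in> U" for w
  proof -
    have "R `` {w} \<inter> Q = Q" by (rule card_subset_eq) (use that Q in \<open>auto simp: d_def\<close>)
    then show ?thesis using that UQ by (auto simp: F_def)
  qed
  have "val k (deg R w) \<le> val (k - 1) (deg ?R w) + ((if w \<in> F then 1 else 0) - (if w \<in> G then 1 else 0))"
    if w: "w \<in> U" for w
  proof -
    have "(if d w = 3 then 1 else 0) \<le> (if w \<in> F then 1 else 0::int)" using full[OF _ w] by simp
    moreover have "(if deg R w = 2 * k - 1 \<and> d w \<le> 1 then 1 else 0) = (if w \<in> G then 1 else 0::int)"
      using w by (simp add: G_def)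
    ultimately show ?thesis using val_shift[OF k3 d3[of w], of "deg ?R w"] unfolding degU[OF w] by linarith
  qed
  then have "(\<Sum>w\<in>U. val k (deg R w))
      \<le> (\<Sum>w\<in>U. val (k - 1) (deg ?R w) + ((if w \<in> F then 1 else 0) - (if w \<in> G then 1 else 0)))"
    by (rule sum_mono)
  also have "\<dots> = excess (k - 1) U ?R + ((\<Sum>w\<in>U. if w \<in> F then 1 else 0) - (\<Sum>w\<in>U. if w \<in> G then 1 else 0))"
    unfolding excess_def by (simp only: sum.distrib sum_subtractf)
  also have "(\<Sum>w\<in>U. if w \<in> F then 1 else 0::int) = int (card (U \<inter> F))"
    using UQ(3) by (subst sum.inter_restrict[symmetric]) auto
  also have "(\<Sum>w\<in>U. if w \<in> G then 1 else 0::int) = int (card (U \<inter> G))"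
    using UQ(3) by (subst sum.inter_restrict[symmetric]) auto
  also have "U \<inter> G = G" by (auto simp: G_def)
  finally have "(\<Sum>w\<in>U. val k (deg R w)) \<le> excess (k - 1) U ?R + (int (card (U \<inter> F)) - int (card G))" .
  moreover have "card (U \<inter> F) \<le> card F" by (rule card_mono) (use finV in \<open>auto simp: F_def\<close>)
  moreover have "excess k V R = (\<Sum>w\<in>U. val k (deg R w)) + (\<Sum>w\<in>Q. val k (deg R w))"
    unfolding excess_def U_def using sum.subset_diff[OF Q(2) finV] by blast
  moreover have "(\<Sum>w\<in>Q. val k (deg R w)) = val k (deg R x) + val k (deg R y) + val k (deg R z)"
    unfolding Q_def using tri(2-4) by simp
  ultimately have "3 + int (card G) \<le> val k (deg R x) + val k (deg R y) + val k (deg R z) + int (card F)"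
    using ex' excess k3 by linarith
  then show ?thesis by (simp only: G_def F_def U_def d_def Q_def)
qed

section \<open>The case \<open>3 \<le> k\<close>\<close>

lemma full_le:
  assumes "(x, y) \<in> R" "(y, z) \<in> R" "(z, x) \<in> R"
  shows "card {w \<in> V. {x, y, z} \<subseteq> R `` {w}} \<le> 2"
proof (rule ccontr)
  assume "\<not> ?thesis"
  then have "3 \<le> card {w \<in> V. {x, y, z} \<subseteq> R `` {w}}" by simp
  then obtain B where B: "B \<subseteq> {w \<in> V. {x, y, z} \<subseteq> R `` {w}}" "card B = 3"
    by (meson ex_subset_card_3)
  have "card {x, y, z} = 3" using cyclic_triangle[OF R assms] by simp
  moreover have "B \<times> {x, y, z} \<subseteq> R" using B(1) by auto
  ultimately show False using P_no_K33[OF PV B(2)] by blast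
qed

text \<open>Otherwise \<open>triangle_sum\<close> gives, for every common neighbour
  \<open>z\<close>, two vertices adjacent to all of \<open>v\<close>, \<open>x\<close>,
  \<open>z\<close>: each of the n common neighbours has at least two neighbours among the others.
  Together with \<open>v\<close> and \<open>x\<close> they span at least 6n + 2 arcs, whereas
  Mader's bound for n + 2 vertices allows 6n.\<close>

lemma edge_val_pos:
  assumes k3: "3 \<le> k" and vx: "(v, x) \<in> R"
  shows "1 \<le> val k (deg R v) + val k (deg R x)"
proof (rule ccontr)
  assume *: "\<not> ?thesis"
  let ?W = "R `` {v} \<inter> R `` {x}"
  have xv: "(x, v) \<in> R" using sym vx .
  have ne: "?W \<noteq> {}"
  proof (cases "val k (deg R v) \<le> 0")
    case True
    then show ?thesis using common_neighbour[OF vx] by blast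
  next
    case False
    then have "val k (deg R x) \<le> 0" using * by simp
    then show ?thesis using common_neighbour[OF xv] by blast
  qed
  have two: "2 \<le> card (R `` {z} \<inter> ?W)" if z: "z \<in> ?W" for z
  proof -
    have e: "(v, x) \<in> R" "(x, z) \<in> R" "(z, v) \<in> R" using z vx sym by blast+
    have "2 \<le> card {w \<in> V. {v, x, z} \<subseteq> R `` {w}}"
      using triangle_sum[OF k3 e] * val_le_1[of k "deg R z"] by linarith
    also have "\<dots> \<le> card (R `` {z} \<inter> ?W)"
      by (rule card_mono) (use sgraphD(8)[OF R] sym in auto)
    finally show ?thesis .
  qed
  have fin: "finite ?W" using sgraphD(8)[OF R] by simp
  have x: "x \<notin> ?W" and v: "v \<notin> insert x ?W" using irr vx by blast+
  let ?U = "insert v (insert x ?W)"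
  have W: "R `` {x} \<inter> ?W = ?W" "R `` {v} \<inter> insert x ?W = insert x ?W" using vx by auto
  have "2 * card ?W \<le> card (R \<inter> ?W \<times> ?W)"
    unfolding card_arcs[OF R fin] using sum_bounded_below[of ?W 2 "\<lambda>z. card (R `` {z} \<inter> ?W)"] two by simp
  then have "6 * card ?W + 2 \<le> card (R \<inter> ?U \<times> ?U)"
    using card_arcs_insert[OF R fin x] card_arcs_insert[OF R _ v] fin x W by simp
  moreover have cU: "card ?U = card ?W + 2" using fin x v by simp
  moreover have "?U \<subseteq> V" using sgraphD(3,4)[OF R] vx by blast
  moreover have "0 < card ?W" using ne fin by (simp add: card_gt_0_iff)
  ultimately show False using card_arcs_bound[OF P_restrict[OF PV, of ?U]] by simp
qed

text \<open>By \<open>edge_val_pos\<close> no score is negative and the set \<open>M\<close> of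
  vertices of score 0 is independent. Mader's bound makes \<open>M\<close> large, and
  \<open>triangle_sum\<close> makes each neighbour of a vertex of \<open>M\<close> adjacent to all
  but two vertices of \<open>M\<close>, which leads to a K33.\<close>

lemma False_if_k_ge_3: assumes k3: "3 \<le> k" shows False
proof -
  define M where "M = {v \<in> V. deg R v = 2 * k - 1}"
  have deg: "2 * k - 1 \<le> deg R v" if v: "v \<in> V" for v
  proof -
    obtain x where x: "(v, x) \<in> R" using neighbour[OF v] .
    have "0 \<le> val k (deg R v)" using edge_val_pos[OF k3 x] val_le_1[of k "deg R x"] by linarith
    then show ?thesis by (auto simp: val_def split: if_splits)
  qed
  have V3: "3 \<le> card V" using excess_le_card[of k V R] excess k3 by simp
  \<comment> \<open>All degrees are at least 5, and a degree 5 occurs only in \<open>M\<close>.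
    Crediting each vertex of \<open>M\<close> with one unit brings every vertex to 6, and the 12 is
    the deficit in Mader's bound.\<close>
  have M12: "12 \<le> card M"
  proof -
    have "6 * card V \<le> (\<Sum>v\<in>V. deg R v + (if v \<in> M then 1 else 0))"
      using sum_bounded_below[of V 6 "\<lambda>v. deg R v + (if v \<in> M then 1 else 0)"] deg k3
      by (fastforce simp: M_def)
    also have "\<dots> = card R + (\<Sum>v\<in>V. if v \<in> M then 1 else 0)"
      by (simp only: sum.distrib sum_deg[OF R])
    also have "(\<Sum>v\<in>V. if v \<in> M then 1 else 0) = card (V \<inter> M)"
      using finV by (subst sum.inter_restrict[symmetric]) auto
    also have "V \<inter> M = M" by (auto simp: M_def)
    finally show ?thesis using card_arcs_bound[OF PV V3] by linarith
  qed
  have valM: "val k (deg R v) = 0" if "v \<in> M" for v using that k3 by (auto simp: M_def val_def)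
  have indep: "(v, w) \<notin> R" if "v \<in> M" "w \<in> M" for v w
    using edge_val_pos[OF k3, of v w] valM that by auto
  have finM: "finite M" using finV by (simp add: M_def)
  have miss: "card {w \<in> M. (w, x) \<notin> R} \<le> 2" if v: "v \<in> M" and vx: "(v, x) \<in> R" for v x
  proof -
    obtain y where y: "(v, y) \<in> R" "(x, y) \<in> R" using common_neighbour[OF vx] valM[OF v] by auto
    have e: "(v, x) \<in> R" "(x, y) \<in> R" "(y, v) \<in> R" using vx y sym by blast+
    let ?G = "{w \<in> V - {v, x, y}. deg R w = 2 * k - 1 \<and> card (R `` {w} \<inter> {v, x, y}) \<le> 1}"
    \<comment> \<open>The scores of \<open>v\<close>, \<open>x\<close>, \<open>y\<close> sum to at
      most 0 + 1 + 1, and at most 2 vertices see the whole triangle; 3 of these 4 units are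
      spent.\<close>
    have "card ?G \<le> 1"
      using triangle_sum[OF k3 e] full_le[OF e] valM[OF v] val_le_1[of k "deg R x"] val_le_1[of k "deg R y"]
      by linarith
    moreover have "{w \<in> M. (w, x) \<notin> R} \<subseteq> insert v ?G"
    proof
      fix w assume w: "w \<in> {w \<in> M. (w, x) \<notin> R}"
      \<comment> \<open>Independence keeps \<open>x\<close> and \<open>y\<close> out of
        \<open>M\<close> and \<open>v\<close> out of the neighbourhood of \<open>w\<close>; a vertex
        \<open>w\<close> of \<open>M\<close> that misses \<open>x\<close> can only see
        \<open>y\<close> on the triangle.\<close>
      have "x \<notin> M" "y \<notin> M" using indep v vx y by blast+
      moreover have "R `` {w} \<inter> {v, x, y} \<subseteq> {y}" using w indep v by auto
      then have "card (R `` {w} \<inter> {v, x, y}) \<le> card {y}" by (intro card_mono) auto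
      ultimately show "w \<in> insert v ?G" using w by (auto simp: M_def)
    qed
    then have "card {w \<in> M. (w, x) \<notin> R} \<le> card (insert v ?G)" using finV by (intro card_mono) auto
    ultimately show ?thesis using card_insert_le_m1[of 2 ?G v] by simp
  qed
  have "M \<noteq> {}" using M12 by auto
  then obtain v where v: "v \<in> M" by blast
  have "3 \<le> card (R `` {v})" using v k3 by (simp add: M_def deg_def)
  then obtain A where A: "A \<subseteq> R `` {v}" "card A = 3" by (meson ex_subset_card_3)
  have finA: "finite A" using A(2) card.infinite by fastforce
  \<comment> \<open>Three neighbours of \<open>v\<close> are missed by at most 6 of the at least 12
    vertices of \<open>M\<close>, so three vertices remain for the other side of a K33.\<close>
  let ?miss = "\<Union>x\<in>A. {w \<in> M. (w, x) \<notin> R}"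
  have "card ?miss \<le> (\<Sum>x\<in>A. card {w \<in> M. (w, x) \<notin> R})" by (rule card_UN_le[OF finA])
  also have "\<dots> \<le> (\<Sum>x\<in>A. 2)" by (rule sum_mono) (use miss[OF v] A in auto)
  finally have "card ?miss \<le> 6" using A by simp
  moreover have "card M - card ?miss \<le> card (M - ?miss)"
    by (rule diff_card_le_card_Diff) (use finM finA in auto)
  ultimately have "3 \<le> card (M - ?miss)" using M12 by linarith
  then obtain B where B: "B \<subseteq> M - ?miss" "card B = 3" by (meson ex_subset_card_3)
  have "B \<times> A \<subseteq> R" using B(1) by auto
  then show False using P_no_K33[OF PV B(2) A(2)] by blast
qed

section \<open>The case \<open>k = 2\<close>\<close>

lemma not_disjoint:
  assumes "k = 2" "cyclic_set R Q" "Q \<subseteq> V" "W \<subseteq> V - Q"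
  shows "\<not> cyclic_set R W"
proof
  assume W: "cyclic_set R W"
  have "disjoint_cyclic 2 V R" unfolding disjoint_cyclic_def
    by (rule exI[of _ "\<lambda>i. if i = 0 then Q else W"]) (use assms W in \<open>auto simp: less_Suc_eq\<close>)
  then show False using no_cycles assms by simp
qed

text \<open>A vertex of degree 2 lies in a triangle whose other two vertices have degree at most 4,
  so few edges leave the triangle. The rest is a forest, whose degree sum is then too small for the
  excess.\<close>

lemma deg_ge_3:
  assumes k: "k = 2" and v: "v \<in> V" shows "3 \<le> deg R v"
proof (rule ccontr)
  assume "\<not> ?thesis"
  then have dv: "deg R v = 2" using deg_ge_2[OF v] by simp
  obtain x where x: "(v, x) \<in> R" using neighbour[OF v] .
  obtain y where y: "(v, y) \<in> R" "(x, y) \<in> R"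
    using common_neighbour[OF x] dv k by (auto simp: val_def)
  have e: "(v, x) \<in> R" "(x, y) \<in> R" "(y, v) \<in> R" using x y sym by blast+
  note tri = cyclic_triangle[OF R e]
  have "{x, y} = R `` {v}"
    by (rule card_subset_eq) (use dv tri x y sgraphD(8)[OF R] in \<open>auto simp: deg_def\<close>)
  \<comment> \<open>An edge at \<open>v\<close> needs an end of degree 3 or 4 by
    \<open>edge_cost_cases\<close>, and \<open>v\<close> has degree 2.\<close>
  have dx: "deg R x \<le> 4" "deg R y \<le> 4"
    using edge_cost_cases[OF x] edge_cost_cases[OF y(1)] dv k by auto
  let ?Q = "{v, x, y}"
  let ?F = "V - ?Q"
  have FQ: "?F \<union> ?Q = V" "?F \<inter> ?Q = {}" using tri(5) by auto
  have outer: "card (R `` {u} \<inter> ?F) + 2 \<le> deg R u" if "a \<noteq> b" "a \<in> ?Q" "b \<in> ?Q" "(u, a) \<in> R" "(u, b) \<in> R" for u a b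
  proof -
    have "card {a, b} \<le> card (R `` {u} \<inter> ?Q)" by (rule card_mono) (use that in auto)
    then show ?thesis using deg_split[OF R FQ, of u] that(1) by simp
  qed
  have "card (R `` {v} \<inter> ?F) + 2 \<le> deg R v" by (rule outer[of x y]) (use tri e sym in auto)
  moreover have "card (R `` {x} \<inter> ?F) + 2 \<le> deg R x" by (rule outer[of v y]) (use tri e sym in auto)
  moreover have "card (R `` {y} \<inter> ?F) + 2 \<le> deg R y" by (rule outer[of v x]) (use tri e sym in auto)
  moreover have "card (R \<inter> ?F \<times> ?Q) = card (R `` {v} \<inter> ?F) + card (R `` {x} \<inter> ?F) + card (R `` {y} \<inter> ?F)"
    unfolding card_arcs_swap[OF R, of ?F] using tri by (subst card_arcs[OF R]) auto
  ultimately have out: "card (R \<inter> ?F \<times> ?Q) \<le> 4" using dx dv by linarith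
  have valQ: "(\<Sum>w\<in>?Q. val k (deg R w)) \<le> 1"
    using tri dv k val_le_1[of k "deg R x"] val_le_1[of k "deg R y"] by (simp add: val_def)
  have ex: "excess k V R = (\<Sum>w\<in>?F. val k (deg R w)) + (\<Sum>w\<in>?Q. val k (deg R w))"
    unfolding excess_def using sum.subset_diff[OF tri(5) finV] by blast
  show False
  proof (cases "?F = {}")
    case True
    then have "(\<Sum>w\<in>?F. val k (deg R w)) = 0" by (simp only: sum.empty)
    then show False using ex valQ excess k by linarith
  next
    case False
    have "card (R \<inter> ?F \<times> ?F) + 2 \<le> 2 * card ?F"
      by (rule acyclic_card_arcs[OF R]) (use False finV not_disjoint[OF k tri(1,5)] in auto)
    \<comment> \<open>The forest has at most \<open>2 * card ?F - 2\<close> arcs, and at most 4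
      edges lead to the triangle. With the majorant \<open>d - 3\<close> the forest contributes at
      most \<open>2 - card ?F\<close>.\<close>
    then have "(\<Sum>w\<in>?F. deg R w) \<le> 2 * card ?F + 2" using sum_deg_split[OF R FQ] out by linarith
    moreover have "(\<Sum>w\<in>?F. val k (deg R w)) \<le> (\<Sum>w\<in>?F. int (deg R w) - 3)"
      by (rule sum_mono) (use deg_ge_2 k in \<open>auto intro: val_2_le\<close>)
    moreover have "(\<Sum>w\<in>?F. int (deg R w) - 3) = int (\<Sum>w\<in>?F. deg R w) - 3 * int (card ?F)"
      by (simp add: sum_subtractf)
    moreover have "0 < card ?F" using False finV by (simp add: card_gt_0_iff)
    ultimately show False using ex valQ excess k by linarith
  qed
qed

text \<open>The neighbourhood of a vertex \<open>v\<close> of degree 3 contains a path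
  \<open>x\<close>, \<open>y\<close>, \<open>z\<close>, giving the triangles \<open>vxy\<close> and
  \<open>vyz\<close>. Averaging the forest bounds for their complements bounds the degree sum
  outside these four vertices, which then contribute at most 3 themselves, as \<open>v\<close>
  scores 0.\<close>

lemma deg_ge_4:
  assumes k: "k = 2" and v: "v \<in> V" shows "4 \<le> deg R v"
proof (rule ccontr)
  assume "\<not> ?thesis"
  then have dv: "deg R v = 3" using deg_ge_3[OF k v] by simp
  then obtain a b c where abc: "R `` {v} = {a, b, c}" "a \<noteq> b" "a \<noteq> c" "b \<noteq> c"
    by (auto simp: deg_def card_3_iff)
  have nb: "\<exists>w\<in>{a, b, c}. (u, w) \<in> R" if "u \<in> {a, b, c}" for u
  proof -
    have "(v, u) \<in> R" using that abc(1) by blast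
    then obtain w where "(v, w) \<in> R" "(u, w) \<in> R"
      using common_neighbour[of v u] dv k by (auto simp: val_def)
    then show ?thesis using abc(1) by blast
  qed
  \<comment> \<open>Each neighbour of \<open>v\<close> has a neighbour among the other two, so at
    least two of the three pairs are edges; \<open>y\<close> is the pair's shared vertex.\<close>
  obtain x y z where N: "R `` {v} = {x, y, z}" "x \<noteq> y" "x \<noteq> z" "y \<noteq> z" and xy: "(x, y) \<in> R" "(y, z) \<in> R"
  proof -
    have "(a, b) \<in> R \<or> (a, c) \<in> R" "(b, a) \<in> R \<or> (b, c) \<in> R" "(c, a) \<in> R \<or> (c, b) \<in> R"
      using nb[of a] nb[of b] nb[of c] irr by auto
    then consider "(a, b) \<in> R" "(b, c) \<in> R" | "(b, a) \<in> R" "(a, c) \<in> R" | "(a, c) \<in> R" "(c, b) \<in> R"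
      using sym by blast
    then show thesis
    proof cases
      case 1
      then show thesis using that[of a b c] abc by auto
    next
      case 2
      then show thesis using that[of b a c] abc by auto
    next
      case 3
      then show thesis using that[of a c b] abc by auto
    qed
  qed
  have e: "(v, x) \<in> R" "(v, y) \<in> R" "(v, z) \<in> R" using N(1) by blast+
  note t1 = cyclic_triangle[OF R e(2) xy(2) sym[OF e(3)]]
  note t2 = cyclic_triangle[OF R e(1) xy(1) sym[OF e(2)]]
  let ?Q = "{v, x, y, z}"
  let ?U = "V - ?Q"
  have UQ: "?U \<union> ?Q = V" "?U \<inter> ?Q = {}" using t1(5) t2(5) by auto
  have finU: "finite ?U" using finV by simp
  \<comment> \<open>The vertex \<open>u\<close> of the quadruple is off the triangle
    \<open>Q\<close>, so it may be added to the forest \<open>?U\<close>; applied to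
    \<open>x\<close> with \<open>vyz\<close> and to \<open>z\<close> with
    \<open>vxy\<close>.\<close>
  have forest: "card (R \<inter> ?U \<times> ?U) + 2 * card (R `` {u} \<inter> ?U) \<le> 2 * card ?U"
    if Q: "cyclic_set R Q" "Q \<subseteq> ?Q" and u: "u \<in> ?Q" "u \<notin> Q" for u Q
  proof -
    have "card (R \<inter> insert u ?U \<times> insert u ?U) + 2 \<le> 2 * card (insert u ?U)"
    proof (rule acyclic_card_arcs[OF R])
      fix W assume "W \<subseteq> insert u ?U"
      then have "W \<subseteq> V - Q" "Q \<subseteq> V" using Q(2) u UQ by blast+
      then show "\<not> cyclic_set R W" using not_disjoint[OF k Q(1)] by blast
    qed (use finU in auto)
    then show ?thesis using card_arcs_insert[OF R finU, of u] u(1) finU by simp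
  qed
  have "card (R \<inter> ?U \<times> ?U) + 2 * card (R `` {x} \<inter> ?U) \<le> 2 * card ?U"
    by (rule forest[OF t1(1)]) (use N t2 in auto)
  moreover have "card (R \<inter> ?U \<times> ?U) + 2 * card (R `` {z} \<inter> ?U) \<le> 2 * card ?U"
    by (rule forest[OF t2(1)]) (use N t1 in auto)
  moreover have "card (R `` {y} \<inter> ?U) \<le> card ?U" by (rule card_mono[OF finU]) auto
  moreover have "card (R \<inter> ?U \<times> ?Q) = card (R `` {v} \<inter> ?U) + card (R `` {x} \<inter> ?U)
      + card (R `` {y} \<inter> ?U) + card (R `` {z} \<inter> ?U)"
    unfolding card_arcs_swap[OF R, of ?U] using N t1 t2 by (subst card_arcs[OF R]) auto
  moreover have "R `` {v} \<inter> ?U = {}" using N(1) by auto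
  \<comment> \<open>Half the sum of the two forest bounds gives \<open>2 * card ?U\<close> for all
    arcs of \<open>?U\<close> and its edges to \<open>x\<close> and \<open>z\<close>;
    \<open>y\<close> adds at most \<open>card ?U\<close> and \<open>v\<close> nothing.\<close>
  ultimately have "(\<Sum>w\<in>?U. deg R w) \<le> 3 * card ?U" using sum_deg_split[OF R UQ] by simp
  moreover have "(\<Sum>w\<in>?U. val k (deg R w)) \<le> (\<Sum>w\<in>?U. int (deg R w) - 3)"
    by (rule sum_mono) (use deg_ge_2 k in \<open>auto intro: val_2_le\<close>)
  moreover have "(\<Sum>w\<in>?U. int (deg R w) - 3) = int (\<Sum>w\<in>?U. deg R w) - 3 * int (card ?U)"
    by (simp add: sum_subtractf)
  moreover have "excess k V R = (\<Sum>w\<in>?U. val k (deg R w)) + (\<Sum>w\<in>?Q. val k (deg R w))"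
  proof -
    have "?Q \<subseteq> V" using UQ by blast
    then show ?thesis unfolding excess_def using sum.subset_diff[OF _ finV] by blast
  qed
  moreover have "(\<Sum>w\<in>?Q. val k (deg R w)) \<le> 3"
    using N t1 t2 dv k val_le_1[of k "deg R x"] val_le_1[of k "deg R y"] val_le_1[of k "deg R z"]
    by (simp add: val_def)
  ultimately show False using excess k by linarith
qed

text \<open>All scores are 1, so there are at most 5 vertices, while minimum degree 4 and Mader's
  bound require at least 6.\<close>

lemma False_if_k_eq_2: assumes k: "k = 2" shows False
proof -
  have "excess k V R = int (card V)"
    unfolding excess_def using deg_ge_4[OF k] k by (simp add: val_def)
  then have V: "card V \<le> 5" "3 \<le> card V" using excess_le excess k by simp_all
  have "4 * card V \<le> card R"
    using sum_bounded_below[of V 4 "deg R"] deg_ge_4[OF k] sum_deg[OF R] by simp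
  then show False using card_arcs_bound[OF PV V(2)] V by simp
qed

lemma contradiction: False
  using False_if_k_eq_2 False_if_k_ge_3 k2 by linarith

end

theorem (in minor_class) disjoint_cyclic_if_excess:
  "P V R \<Longrightarrow> 2 \<le> k \<Longrightarrow> 2 * int k \<le> excess k V R \<Longrightarrow> disjoint_cyclic k V R"
proof (induction "card V + card R" arbitrary: V R k rule: less_induct)
  case less
  show ?case
  proof (rule ccontr)
    assume "\<not> ?case"
    then interpret counterexample P V R k
      by unfold_locales (use less in auto)
    show False by (rule contradiction)
  qed
qed

section \<open>Theta curves in the plane\<close>

text \<open>Forgetting the parametrisation makes the relation usable for unions and complements of
  point sets.\<close>

definition arc_between :: "complex \<Rightarrow> complex \<Rightarrow> complex set \<Rightarrow> bool" where
  "arc_between a b Q \<longleftrightarrow> (\<exists>g. arc g \<and> pathstart g = a \<and> pathfinish g = b \<and> path_image g = Q)"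

lemma arc_betweenD:
  assumes "arc_between a b Q"
  shows "compact Q" "connected Q" "connected (Q - {a, b})" "a \<in> Q" "b \<in> Q" "a \<noteq> b" "Q - {a, b} \<noteq> {}"
proof -
  obtain g where g: "arc g" "pathstart g = a" "pathfinish g = b" "path_image g = Q"
    using assms by (auto simp: arc_between_def)
  then show "compact Q" "connected Q" "connected (Q - {a, b})" "a \<in> Q" "b \<in> Q" "a \<noteq> b" "Q - {a, b} \<noteq> {}"
    using connected_simple_path_endless[of g] arc_imp_simple_path[of g] compact_arc_image[of g]
      connected_arc_image[of g] arc_distinct_ends[of g] nonempty_simple_path_endless[of g]
    by auto
qed

lemma arc_between_Jordan:
  assumes "arc_between a b Q" "arc_between a b Q'" "Q \<inter> Q' \<subseteq> {a, b}"
  obtains U V where "U \<union> V = - (Q \<union> Q')" "U \<inter> V = {}" "connected U" "connected V"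
    "U \<noteq> {}" "V \<noteq> {}" "frontier U = Q \<union> Q'" "frontier V = Q \<union> Q'" "open U" "open V"
proof -
  obtain g where g: "arc g" "pathstart g = a" "pathfinish g = b" "path_image g = Q"
    using assms by (auto simp: arc_between_def)
  obtain h where h: "arc h" "pathstart h = a" "pathfinish h = b" "path_image h = Q'"
    using assms by (auto simp: arc_between_def)
  let ?c = "g +++ reversepath h"
  have s: "simple_path ?c"
    using g h assms(3) by (intro simple_path_join_loop) (auto simp: arc_reversepath)
  have l: "pathfinish ?c = pathstart ?c" using g h by simp
  have i: "path_image ?c = Q \<union> Q'" using g h by (simp add: path_image_join)
  show ?thesis
    using Jordan_curve[OF s l] that unfolding i by metis
qed

lemma connected_sides:
  assumes "U \<union> V = - C" "U \<inter> V = {}" "open U" "open V" "connected_component (- C) x y" "x \<in> U"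
  shows "y \<in> U"
proof -
  obtain K where K: "connected K" "K \<subseteq> U \<union> V" "x \<in> K" "y \<in> K"
    using assms by (metis connected_component_def)
  then have "V \<inter> K = {}" using connectedD[of K U V] assms by blast
  then show ?thesis using K assms(1) by auto
qed

lemma connected_component_frontier:
  assumes "connected Y" "open Y" "y \<in> Y" "z \<in> frontier Y" "Y \<subseteq> T" "z \<in> T"
  shows "connected_component T y z"
proof -
  have "connected (insert z Y)"
    using connected_intermediate_closure[of Y "insert z Y"] assms closure_subset[of Y]
    by (auto simp: frontier_def)
  then show ?thesis using assms by (auto simp: connected_component_def intro!: exI[of _ "insert z Y"])
qed

text \<open>Janiszewski's theorem moves a point on the side of the closed curve \<open>Q1 \<union> Q2\<close> not containing
  \<open>x\<close> to \<open>x\<close> in the complement of all three arcs.\<close>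
lemma theta_curve_face:
  assumes Q1: "arc_between a b Q1" and Q2: "arc_between a b Q2" and Q3: "arc_between a b Q3"
    and int: "Q1 \<inter> Q2 \<subseteq> {a, b}" "Q1 \<inter> Q3 \<subseteq> {a, b}" "Q2 \<inter> Q3 \<subseteq> {a, b}"
    and y1: "y1 \<in> Q1 - {a, b}" and y2: "y2 \<in> Q2 - {a, b}" and y3: "y3 \<in> Q3 - {a, b}"
    and c1: "connected_component (- (Q2 \<union> Q3)) x y1"
    and c2: "connected_component (- (Q1 \<union> Q3)) x y2"
    and c3: "connected_component (- (Q1 \<union> Q2)) x y3"
  shows False
proof -
  obtain U' V' where UV': "U' \<union> V' = - (Q1 \<union> Q2)" "U' \<inter> V' = {}" "connected U'" "connected V'"
    "U' \<noteq> {}" "V' \<noteq> {}" "frontier U' = Q1 \<union> Q2" "frontier V' = Q1 \<union> Q2" "open U'" "open V'"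
    using arc_between_Jordan[OF Q1 Q2 int(1)] .
  have "x \<in> - (Q1 \<union> Q2)" using c3 connected_component_in by blast
  then obtain U V where UV: "U \<union> V = - (Q1 \<union> Q2)" "U \<inter> V = {}" "connected V"
    "V \<noteq> {}" "frontier V = Q1 \<union> Q2" "open U" "open V" "x \<in> U"
  proof (cases "x \<in> U'")
    case True
    then show ?thesis using that[of U' V'] UV' by blast
  next
    case False
    then have "x \<in> V'" using UV' \<open>x \<in> - (Q1 \<union> Q2)\<close> by blast
    then show ?thesis using that[of V' U'] UV' by blast
  qed
  obtain y where y: "y \<in> V" using UV by auto
  have y3U: "y3 \<in> U" using connected_sides[OF UV(1,2,6,7) c3 UV(8)] .
  have "Q3 - {a, b} \<subseteq> U"
  proof
    fix z assume z: "z \<in> Q3 - {a, b}"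
    have "connected_component (- (Q1 \<union> Q2)) y3 z"
      unfolding connected_component_def
      by (rule exI[of _ "Q3 - {a, b}"]) (use z y3 int arc_betweenD[OF Q3] in auto)
    then show "z \<in> U" using connected_sides[OF UV(1,2,6,7) _ y3U] by blast
  qed
  then have VQ3: "V \<inter> Q3 = {}"
    using UV arc_betweenD[OF Q1] by auto
  \<comment> \<open>\<open>V\<close> is the side of \<open>Q1 \<union> Q2\<close> away from
    \<open>x\<close>, and it avoids \<open>Q3\<close>. Its frontier contains \<open>y1\<close> and
    \<open>y2\<close>, so \<open>y\<close> reaches both through \<open>V\<close>.\<close>
  have S: "connected_component (- (Q1 \<union> Q3)) y y2"
    by (rule connected_component_frontier[OF UV(3,7) y])
      (use UV VQ3 y2 int in auto)
  have T: "connected_component (- (Q2 \<union> Q3)) y y1"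
    by (rule connected_component_frontier[OF UV(3,7) y])
      (use UV VQ3 y1 int in auto)
  have S': "connected_component (- (Q1 \<union> Q3)) y x"
    using S c2 connected_component_sym connected_component_trans by metis
  have T': "connected_component (- (Q2 \<union> Q3)) y x"
    using T c1 connected_component_sym connected_component_trans by metis
  \<comment> \<open>Janiszewski's theorem needs the two closed curves to meet in a connected
    set.\<close>
  have "(Q1 \<union> Q3) \<inter> (Q2 \<union> Q3) = Q3"
    using int arc_betweenD[OF Q3] by auto
  then have "connected_component (- ((Q1 \<union> Q3) \<union> (Q2 \<union> Q3))) y x"
    using Janiszewski_weak[OF _ _ _ S' T'] arc_betweenD(1)[OF Q1] arc_betweenD(1)[OF Q2]
      arc_betweenD(1,2)[OF Q3] by (simp only: compact_Un)
  then have "connected_component (- (Q1 \<union> Q2)) x y"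
    using connected_component_of_subset[OF connected_component_sym] by (metis Compl_anti_mono Un_upper1 Un_mono)
  then have "y \<in> U" using connected_sides[OF UV(1,2,6,7) _ UV(8)] by blast
  then show False using y UV by auto
qed

lemma three_points_closed_curve:
  assumes "arc_between a b Q" "arc_between a b Q'" "Q \<inter> Q' \<subseteq> {a, b}"
    and "x \<notin> Q \<union> Q'" "y \<notin> Q \<union> Q'" "z \<notin> Q \<union> Q'"
  shows "connected_component (- (Q \<union> Q')) x y \<or> connected_component (- (Q \<union> Q')) x z
    \<or> connected_component (- (Q \<union> Q')) y z"
proof -
  obtain U V where UV: "U \<union> V = - (Q \<union> Q')" "connected U" "connected V"
    using arc_between_Jordan[OF assms(1-3)] by metis
  then have "\<And>p q. p \<in> U \<Longrightarrow> q \<in> U \<Longrightarrow> connected_component (- (Q \<union> Q')) p q"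
    "\<And>p q. p \<in> V \<Longrightarrow> q \<in> V \<Longrightarrow> connected_component (- (Q \<union> Q')) p q"
    unfolding connected_component_def by blast+
  moreover have "x \<in> U \<union> V" "y \<in> U \<union> V" "z \<in> U \<union> V" using assms UV by auto
  ultimately show ?thesis by blast
qed

text \<open>By \<open>theta_curve_face\<close>, a point reaching \<open>y1\<close> and
  \<open>y2\<close> cannot lie on the side of \<open>Q1 \<union> Q2\<close> containing
  \<open>y3\<close>, nor on that of \<open>y4\<close>. There are only two sides, so
  \<open>y3\<close> and \<open>y4\<close> share one.\<close>

lemma four_arcs_aux:
  assumes Q: "arc_between a b Q1" "arc_between a b Q2" "arc_between a b Q3" "arc_between a b Q4"
    and int: "Q1 \<inter> Q2 \<subseteq> {a, b}" "Q1 \<inter> Q3 \<subseteq> {a, b}" "Q2 \<inter> Q3 \<subseteq> {a, b}"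
      "Q1 \<inter> Q4 \<subseteq> {a, b}" "Q2 \<inter> Q4 \<subseteq> {a, b}"
    and y: "y1 \<in> Q1 - {a, b}" "y2 \<in> Q2 - {a, b}" "y3 \<in> Q3 - {a, b}" "y4 \<in> Q4 - {a, b}"
    and x: "x \<notin> Q1" "x \<notin> Q2" "connected_component (- (Q2 \<union> Q3 \<union> Q4)) x y1"
      "connected_component (- (Q1 \<union> Q3 \<union> Q4)) x y2"
  shows "connected_component (- (Q1 \<union> Q2)) y4 y3"
proof -
  have m: "connected_component (- (Q2 \<union> Q3)) x y1" "connected_component (- (Q1 \<union> Q3)) x y2"
     "connected_component (- (Q2 \<union> Q4)) x y1" "connected_component (- (Q1 \<union> Q4)) x y2"
    using x by (auto elim!: connected_component_of_subset)
  have "\<not> connected_component (- (Q1 \<union> Q2)) x y3"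
    using theta_curve_face[OF Q(1,2,3) int(1,2,3) y(1,2,3) m(1,2)] by blast
  moreover have "\<not> connected_component (- (Q1 \<union> Q2)) x y4"
    using theta_curve_face[OF Q(1,2,4) int(1,4,5) y(1,2,4) m(3,4)] by blast
  ultimately show ?thesis
    using three_points_closed_curve[OF Q(1,2) int(1), of x y4 y3] x y int by blast
qed

text \<open>The topological core of the non-planarity of K5: four arcs join two poles,
  \<open>Q4\<close> directly and the others through the remaining three vertices, and
  \<open>xij\<close> lies on the edge between two of these. Three uses of
  \<open>four_arcs_aux\<close> put a point of \<open>Q4\<close> in the forbidden position of
  \<open>theta_curve_face\<close>.\<close>

lemma four_arcs:
  assumes Q: "arc_between a b Q1" "arc_between a b Q2" "arc_between a b Q3" "arc_between a b Q4"
    and int: "Q1 \<inter> Q2 \<subseteq> {a, b}" "Q1 \<inter> Q3 \<subseteq> {a, b}" "Q2 \<inter> Q3 \<subseteq> {a, b}"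
      "Q1 \<inter> Q4 \<subseteq> {a, b}" "Q2 \<inter> Q4 \<subseteq> {a, b}" "Q3 \<inter> Q4 \<subseteq> {a, b}"
    and y: "y1 \<in> Q1 - {a, b}" "y2 \<in> Q2 - {a, b}" "y3 \<in> Q3 - {a, b}"
    and x12: "x12 \<notin> Q1" "x12 \<notin> Q2" "connected_component (- (Q2 \<union> Q3 \<union> Q4)) x12 y1"
      "connected_component (- (Q1 \<union> Q3 \<union> Q4)) x12 y2"
    and x13: "x13 \<notin> Q1" "x13 \<notin> Q3" "connected_component (- (Q2 \<union> Q3 \<union> Q4)) x13 y1"
      "connected_component (- (Q1 \<union> Q2 \<union> Q4)) x13 y3"
    and x23: "x23 \<notin> Q2" "x23 \<notin> Q3" "connected_component (- (Q1 \<union> Q3 \<union> Q4)) x23 y2"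
      "connected_component (- (Q1 \<union> Q2 \<union> Q4)) x23 y3"
  shows False
proof -
  obtain y4 where y4: "y4 \<in> Q4 - {a, b}" using arc_betweenD(7)[OF Q(4)] by blast
  have int': "Q3 \<inter> Q2 \<subseteq> {a, b}" "Q2 \<inter> Q1 \<subseteq> {a, b}" "Q3 \<inter> Q1 \<subseteq> {a, b}" using int by auto
  have "connected_component (- (Q1 \<union> Q2)) y4 y3"
    using four_arcs_aux[OF Q int(1,2,3,4,5) y y4 x12] .
  moreover have "connected_component (- (Q1 \<union> Q3)) y4 y2"
    using four_arcs_aux[OF Q(1,3,2,4) int(2,1) int'(1) int(4,6) y(1,3,2) y4 x13(1,2)] x13(3,4)
    by (simp add: Un_commute Un_left_commute)
  moreover have "connected_component (- (Q2 \<union> Q3)) y4 y1"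
    using four_arcs_aux[OF Q(2,3,1,4) int(3) int'(2,3) int(5,6) y(2,3,1) y4 x23(1,2)] x23(3,4)
    by (simp add: Un_commute Un_left_commute)
  ultimately show False
    using theta_curve_face[OF Q(1,2,3) int(1,2,3) y] by blast
qed

section \<open>Paths and spiders\<close>

definition conn :: "('a \<times> 'a) set \<Rightarrow> 'a set \<Rightarrow> bool" where
  "conn R A \<longleftrightarrow> A \<noteq> {} \<and> (\<forall>a\<in>A. \<forall>b\<in>A. (a, b) \<in> (R \<inter> A \<times> A)\<^sup>*)"

definition adj :: "('a \<times> 'a) set \<Rightarrow> 'a set \<Rightarrow> 'a set \<Rightarrow> bool" where
  "adj R A B \<longleftrightarrow> (\<exists>a\<in>A. \<exists>b\<in>B. (a, b) \<in> R)"

lemma conn_mono_rtrancl: "A \<subseteq> B \<Longrightarrow> (a, b) \<in> (R \<inter> A \<times> A)\<^sup>* \<Longrightarrow> (a, b) \<in> (R \<inter> B \<times> B)\<^sup>*"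
  by (rule subsetD[OF rtrancl_mono]) auto

lemma adj_sym: "sym R \<Longrightarrow> adj R A B \<Longrightarrow> adj R B A"
  unfolding adj_def by (meson symD)

lemma conn_Un:
  assumes "sym R" "conn R A" "conn R B" "adj R A B"
  shows "conn R (A \<union> B)"
proof -
  let ?S = "(R \<inter> (A \<union> B) \<times> (A \<union> B))\<^sup>*"
  obtain a b where ab: "a \<in> A" "b \<in> B" "(a, b) \<in> R" using assms(4) by (auto simp: adj_def)
  have ba: "(b, a) \<in> R" using assms(1) ab(3) by (rule symD)
  have A: "(x, y) \<in> ?S" if "x \<in> A" "y \<in> A" for x y
    using conn_mono_rtrancl[of A "A \<union> B" x y R] assms(2) that by (auto simp: conn_def)
  have B: "(x, y) \<in> ?S" if "x \<in> B" "y \<in> B" for x y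
    using conn_mono_rtrancl[of B "A \<union> B" x y R] assms(3) that by (auto simp: conn_def)
  have step: "(a, b) \<in> ?S" "(b, a) \<in> ?S" using ab ba by auto
  have "(x, y) \<in> ?S" if "x \<in> A \<union> B" "y \<in> A \<union> B" for x y
  proof -
    have "(x, a) \<in> ?S" using that(1) A[of x a] B[of x b] ab step(2) by (meson UnE rtrancl_trans)
    moreover have "(a, y) \<in> ?S" using that(2) A[of a y] B[of b y] ab step(1) by (meson UnE rtrancl_trans)
    ultimately show ?thesis by (rule rtrancl_trans)
  qed
  then show ?thesis using ab unfolding conn_def by blast
qed

section \<open>Paths as vertex lists\<close>

definition gpath :: "('a \<times> 'a) set \<Rightarrow> 'a list \<Rightarrow> bool" where
  "gpath R xs \<longleftrightarrow> xs \<noteq> [] \<and> distinct xs \<and> successively (\<lambda>a b. (a, b) \<in> R) xs"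

definition path_arcs :: "'a list \<Rightarrow> ('a \<times> 'a) set" where
  "path_arcs xs = set (zip xs (tl xs))"

lemma path_arcs_simps [simp]:
  "path_arcs [] = {}" "path_arcs [x] = {}" "path_arcs (x # y # zs) = insert (x, y) (path_arcs (y # zs))"
  by (simp_all add: path_arcs_def)

lemma path_arcs_subset: "path_arcs xs \<subseteq> set xs \<times> set xs"
  by (induction xs rule: induct_list012) auto

lemma path_arcs_gpath: "successively (\<lambda>a b. (a, b) \<in> R) xs \<Longrightarrow> path_arcs xs \<subseteq> R"
  by (induction xs rule: induct_list012) auto

lemma gpathD: "gpath R xs \<Longrightarrow> xs \<noteq> []" "gpath R xs \<Longrightarrow> distinct xs" "gpath R xs \<Longrightarrow> path_arcs xs \<subseteq> R"
  using path_arcs_gpath by (auto simp: gpath_def)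

lemma gpath_rev: "sym R \<Longrightarrow> gpath R (rev xs) \<longleftrightarrow> gpath R xs"
proof -
  assume "sym R"
  then have "(\<lambda>x y. (y, x) \<in> R) = (\<lambda>x y. (x, y) \<in> R)" by (auto dest: symD intro!: ext)
  then have "successively (\<lambda>x y. (y, x) \<in> R) xs = successively (\<lambda>x y. (x, y) \<in> R) xs"
    by (rule arg_cong)
  then show ?thesis unfolding gpath_def successively_rev by simp
qed

lemma gpath_append:
  "gpath R xs \<Longrightarrow> gpath R ys \<Longrightarrow> set xs \<inter> set ys = {} \<Longrightarrow> (last xs, hd ys) \<in> R \<Longrightarrow> gpath R (xs @ ys)"
  by (auto simp: gpath_def successively_append_iff)

lemma gpath_appendD:
  assumes "gpath R (xs @ ys)"
  shows "xs \<noteq> [] \<Longrightarrow> gpath R xs" "ys \<noteq> [] \<Longrightarrow> gpath R ys"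
    "xs \<noteq> [] \<Longrightarrow> ys \<noteq> [] \<Longrightarrow> (last xs, hd ys) \<in> R" "set xs \<inter> set ys = {}"
  using assms by (auto simp: gpath_def successively_append_iff)

text \<open>An edge of a path joins its two ends only if it is the whole path. This prevents paths
  that share just their ends from sharing an edge.\<close>

lemma gpath_ends_length:
  assumes "gpath R xs" "(a, b) \<in> path_arcs xs" "{a, b} \<subseteq> {hd xs, last xs}"
  shows "length xs \<le> 2"
proof (cases xs rule: list.exhaust[case_names Nil Cons])
  case Nil
  then show ?thesis by simp
next
  case (Cons x ys)
  have d: "distinct xs" using assms(1) by (rule gpathD)
  have ne: "a \<noteq> b" using assms(2) d
  proof (induction xs rule: induct_list012)
    case (3 x y zs)
    then show ?case by auto
  qed auto
  show ?thesis
  proof (cases ys)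
    case Nil
    then show ?thesis using Cons by simp
  next
    case (Cons y zs)
    then have xs: "xs = x # y # zs" using \<open>xs = x # ys\<close> by simp
    have "(a, b) = (x, y) \<or> (a, b) \<in> path_arcs (y # zs)" using assms(2) xs by auto
    then show ?thesis
    proof
      assume "(a, b) = (x, y)"
      then have "y = last xs" using assms(3) xs d by auto
      then have "zs = []" using xs d last_in_set[of zs] by (cases "zs = []") auto
      then show ?thesis using xs by simp
    next
      assume "(a, b) \<in> path_arcs (y # zs)"
      then have "a \<in> set (y # zs)" "b \<in> set (y # zs)" using path_arcs_subset by fast+
      then have "a = last xs" "b = last xs" using assms(3) xs d by auto
      then show ?thesis using ne by simp
    qed
  qed
qed

lemma gpath_first_hit:
  assumes "conn R A" "p \<in> A" "S \<inter> A \<noteq> {}"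
  obtains xs where "gpath R xs" "hd xs = p" "set xs \<subseteq> A" "set xs \<inter> S = {last xs}"
proof -
  obtain q where q: "q \<in> S" "q \<in> A" using assms(3) by blast
  have "(p, q) \<in> (R \<inter> A \<times> A)\<^sup>*" using assms(1,2) q by (auto simp: conn_def)
  then have "\<exists>xs. gpath R xs \<and> hd xs = p \<and> set xs \<subseteq> A \<and> set xs \<inter> S = {last xs}"
  proof (induction rule: converse_rtrancl_induct)
    case base
    show ?case by (rule exI[of _ "[q]"]) (use q in \<open>auto simp: gpath_def\<close>)
  next
    case (step p p')
    then obtain xs where xs: "gpath R xs" "hd xs = p'" "set xs \<subseteq> A" "set xs \<inter> S = {last xs}" by blast
    have pA: "p \<in> A" and pp: "(p, p') \<in> R" using step.hyps by auto
    consider "p \<in> S" | "p \<notin> S" "p \<notin> set xs" | "p \<notin> S" "p \<in> set xs" by blast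
    then show ?case
    proof cases
      case 1
      show ?thesis by (rule exI[of _ "[p]"]) (use 1 pA in \<open>auto simp: gpath_def\<close>)
    next
      case 2
      have "gpath R (p # xs)" using gpath_append[of R "[p]" xs] xs pp 2 by (auto simp: gpath_def)
      moreover have "set (p # xs) \<inter> S = {last (p # xs)}" using xs(4) 2 gpathD(1)[OF xs(1)] by simp
      ultimately show ?thesis using xs(3) pA by (intro exI[of _ "p # xs"]) simp
    next
      \<comment> \<open>If the new vertex is already on the path, the loop back to it is cut
        off.\<close>
      case 3
      then obtain us vs where uv: "xs = us @ p # vs" by (auto simp: in_set_conv_decomp)
      have "gpath R (p # vs)" using gpath_appendD(2)[of R us "p # vs"] xs(1) uv by simp
      moreover have "set (p # vs) \<inter> S = {last (p # vs)}"
      proof -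
        have l: "last xs = last (p # vs)" using uv by simp
        have "last xs \<in> S" using xs(4) by blast
        then have "last (p # vs) \<in> S" using l by simp
        moreover have "last (p # vs) \<in> set (p # vs)" by (rule last_in_set) simp
        moreover have "set (p # vs) \<subseteq> set xs" using uv by auto
        then have "set (p # vs) \<inter> S \<subseteq> {last (p # vs)}" using xs(4) unfolding l by blast
        ultimately show ?thesis by blast
      qed
      moreover have "set (p # vs) \<subseteq> A" using xs(3) uv by auto
      ultimately show ?thesis by (intro exI[of _ "p # vs"]) simp
    qed
  qed
  then show ?thesis using that by blast
qed

lemma gpath_between:
  assumes "conn R A" "p \<in> A" "q \<in> A"
  obtains xs where "gpath R xs" "hd xs = p" "last xs = q" "set xs \<subseteq> A"
proof -
  have "{q} \<inter> A \<noteq> {}" using assms(3) by blast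
  from gpath_first_hit[OF assms(1,2) this]
  obtain xs where xs: "gpath R xs" "hd xs = p" "set xs \<subseteq> A" "set xs \<inter> {q} = {last xs}" .
  have "last xs = q" using xs(4) by blast
  then show ?thesis using that xs by blast
qed

lemma conn_gpath:
  assumes "sym R" "gpath R xs"
  shows "conn R (set xs)"
  using assms(2)
proof (induction xs rule: induct_list012)
  case 1
  then show ?case by (simp add: gpath_def)
next
  case (2 x)
  then show ?case by (simp add: conn_def)
next
  case (3 x y zs)
  have "gpath R (y # zs)" "(x, y) \<in> R" using 3(3) by (auto simp: gpath_def)
  then have "conn R (set (y # zs))" using 3 by blast
  moreover have "conn R {x}" by (simp add: conn_def)
  moreover have "adj R {x} (set (y # zs))" using \<open>(x, y) \<in> R\<close> by (auto simp: adj_def)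
  ultimately show ?case using conn_Un[OF assms(1), of "{x}" "set (y # zs)"]
    by (simp add: insert_commute)
qed

lemma hd_last_in_gpath: "gpath R xs \<Longrightarrow> hd xs \<in> set xs" "gpath R xs \<Longrightarrow> last xs \<in> set xs"
  by (auto simp: gpath_def)

text \<open>Legs may consist of the centre alone, so feet may lie at the centre and even coincide
  there.\<close>

definition spider :: "('a \<times> 'a) set \<Rightarrow> 'a set \<Rightarrow> 'a \<Rightarrow> (nat \<Rightarrow> 'a list) \<Rightarrow> (nat \<Rightarrow> 'a) \<Rightarrow> nat set \<Rightarrow> bool" where
  "spider R A c L p I \<longleftrightarrow>
     (\<forall>i\<in>I. gpath R (L i) \<and> hd (L i) = c \<and> last (L i) = p i \<and> set (L i) \<subseteq> A) \<and>
     (\<forall>i\<in>I. \<forall>j\<in>I. i \<noteq> j \<longrightarrow> set (L i) \<inter> set (L j) = {c})"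

lemma spiderD:
  assumes "spider R A c L p I" "i \<in> I"
  shows "gpath R (L i)" "hd (L i) = c" "last (L i) = p i" "set (L i) \<subseteq> A" "c \<in> set (L i)"
    "j \<in> I \<Longrightarrow> i \<noteq> j \<Longrightarrow> set (L i) \<inter> set (L j) = {c}"
  using assms hd_last_in_gpath(1)[of R "L i"] by (auto simp: spider_def)

lemma spider_subset: "spider R A c L p I \<Longrightarrow> J \<subseteq> I \<Longrightarrow> spider R A c L p J"
  unfolding spider_def by blast

text \<open>Join two feet by a path and run from the third until this path is first met; the meeting
  point is the centre.\<close>

lemma tripod:
  assumes "sym R" "conn R A" "p i \<in> A" "p j \<in> A" "p k \<in> A" "i \<noteq> j" "i \<noteq> k" "j \<noteq> k"
  obtains c L where "spider R A c L p {i, j, k}"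
proof -
  obtain xs where xs: "gpath R xs" "hd xs = p i" "last xs = p j" "set xs \<subseteq> A"
    using gpath_between[OF assms(2-4)] .
  have "set xs \<inter> A \<noteq> {}" using xs gpathD(1)[OF xs(1)] by (metis Int_absorb2 set_empty)
  from gpath_first_hit[OF assms(2,5) this]
  obtain ys where ys: "gpath R ys" "hd ys = p k" "set ys \<subseteq> A" "set ys \<inter> set xs = {last ys}" .
  define c where "c = last ys"
  have "c \<in> set xs" using ys(4) by (auto simp: c_def)
  then obtain us vs where uv: "xs = us @ c # vs" by (auto simp: in_set_conv_decomp)
  have 1: "gpath R (us @ [c])" using gpath_appendD(1)[of R "us @ [c]" vs] xs(1) uv by simp
  have 2: "gpath R (c # vs)" using gpath_appendD(2)[of R us "c # vs"] xs(1) uv by simp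
  have d: "distinct xs" using xs(1) by (rule gpathD)
  \<comment> \<open>The default value is the leg of \<open>k\<close>.\<close>
  define L where "L = (\<lambda>_. rev ys)(i := rev (us @ [c]), j := c # vs)"
  have L: "L i = rev (us @ [c])" "L j = c # vs" "L k = rev ys" using assms(6-8) by (auto simp: L_def)
  have g: "gpath R (L i)" "gpath R (L j)" "gpath R (L k)"
    unfolding L gpath_rev[OF assms(1)] by fact+
  have hl: "hd (L i) = c" "hd (L j) = c" "hd (L k) = c" "last (L i) = p i" "last (L j) = p j" "last (L k) = p k"
  proof -
    have ne: "ys \<noteq> []" using ys(1) by (rule gpathD)
    show "hd (L k) = c" "last (L k) = p k" unfolding L using ne ys(2) by (auto simp: hd_rev last_rev c_def)
    show "hd (L i) = c" "hd (L j) = c" unfolding L by auto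
    show "last (L i) = p i" unfolding L using xs(2) uv by (cases us) (auto simp: last_rev)
    show "last (L j) = p j" unfolding L using xs(3) uv by simp
  qed
  have s: "set (L i) \<subseteq> A" "set (L j) \<subseteq> A" "set (L k) \<subseteq> A" unfolding L using xs(4) ys(3) uv by auto
  have "set ys \<inter> set xs = {c}" using ys(4) by (simp add: c_def)
  then have m: "set (L i) \<inter> set (L j) = {c}" "set (L i) \<inter> set (L k) = {c}" "set (L j) \<inter> set (L k) = {c}"
    unfolding L using uv d by auto
  have "spider R A c L p {i, j, k}"
    unfolding spider_def using g hl s m by (simp add: Int_commute)
  then show ?thesis using that by blast
qed

text \<open>A path from the fourth foot first meets a tripod at \<open>h\<close>. If
  \<open>h\<close> is the centre, a fourth leg results. Otherwise cutting the edge just before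
  \<open>h\<close> on its leg separates two feet from the other two.\<close>

lemma spider_four:
  assumes sym: "sym R" and A: "conn R A" and p: "p i \<in> A" "p j \<in> A" "p k \<in> A" "p l \<in> A"
    and dist: "distinct [i, j, k, l]"
  obtains (spider) c L where "spider R A c L p {i, j, k, l}"
    | (split) U W a b d e where "distinct [a, b, d, e]" "{a, b, d, e} = {i, j, k, l}" "U \<subseteq> A" "W \<subseteq> A"
      "U \<inter> W = {}" "conn R U" "conn R W" "adj R U W" "p a \<in> U" "p b \<in> U" "p d \<in> W" "p e \<in> W"
proof -
  obtain c L where L: "spider R A c L p {i, j, k}" using tripod[OF sym A p(1-3)] dist by auto
  let ?T = "set (L i) \<union> set (L j) \<union> set (L k)"
  have "c \<in> A" using spiderD(4,5)[OF L, of i] by blast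
  then have "?T \<inter> A \<noteq> {}" using spiderD(5)[OF L, of i] by blast
  from gpath_first_hit[OF A p(4) this]
  obtain ys where ys: "gpath R ys" "hd ys = p l" "set ys \<subseteq> A" "set ys \<inter> ?T = {last ys}" .
  define h where "h = last ys"
  show thesis
  proof (cases "h = c")
    case True
    define L' where "L' = L(l := rev ys)"
    have L': "L' i = L i" "L' j = L j" "L' k = L k" "L' l = rev ys" using dist by (auto simp: L'_def)
    have ne: "ys \<noteq> []" using ys(1) by (rule gpathD)
    have m: "set ys \<inter> set (L a) = {c}" if "a \<in> {i, j, k}" for a
    proof -
      have "c \<in> set ys" using ys(4) True by (auto simp: h_def)
      moreover have "c \<in> set (L a)" using spiderD(5)[OF L that] .
      moreover have "set ys \<inter> set (L a) \<subseteq> {c}" using ys(4) True that by (auto simp: h_def)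
      ultimately show ?thesis by blast
    qed
    have "gpath R (rev ys)" "hd (rev ys) = c" "last (rev ys) = p l" "set (rev ys) \<subseteq> A"
      using ys ne True gpath_rev[OF sym, of ys] by (auto simp: hd_rev last_rev h_def)
    then have "spider R A c L' p {i, j, k, l}"
      using L m[of i] m[of j] m[of k] unfolding spider_def
      by (simp add: L' Int_commute)
    then show thesis by (rule spider)
  next
    case False
    have split_leg: thesis if abd: "{a, b, d} = {i, j, k}" "distinct [a, b, d]" and h: "h \<in> set (L a)" for a b d
    proof -
      have mem: "a \<in> {i, j, k}" "b \<in> {i, j, k}" "d \<in> {i, j, k}" using abd(1) by auto
      note La = spiderD[OF L mem(1)] and Lb = spiderD[OF L mem(2)] and Ld = spiderD[OF L mem(3)]
      \<comment> \<open>The outer part \<open>h # vs\<close> keeps the foot of \<open>a\<close> and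
        joins the path to the foot of \<open>l\<close>; the inner part \<open>us\<close> keeps the
        centre and the other two legs.\<close>
      obtain us vs where uv: "L a = us @ h # vs" using h by (auto simp: in_set_conv_decomp)
      have us: "us \<noteq> []" using La(2) uv False by auto
      have ga: "gpath R (us @ h # vs)" using La(1) uv by simp
      have g: "gpath R us" "gpath R (h # vs)" "(last us, h) \<in> R" "set us \<inter> set (h # vs) = {}"
        using gpath_appendD[OF ga] us by auto
      have cus: "c \<in> set us" using La(2) uv us by (cases us) auto
      let ?U = "set (h # vs) \<union> set ys" and ?W = "set us \<union> set (L b) \<union> set (L d)"
      have hin: "h \<in> set ys" using ys(1) hd_last_in_gpath(2) by (simp add: h_def)
      have unionI: "conn R (S \<union> T)" if "conn R S" "conn R T" "z \<in> S" "z \<in> T" for S T z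
      proof -
        have "(x, y) \<in> (R \<inter> (S \<union> T) \<times> (S \<union> T))\<^sup>*" if "x \<in> S \<union> T" "y \<in> S \<union> T" for x y
        proof -
          have "(x, z) \<in> (R \<inter> (S \<union> T) \<times> (S \<union> T))\<^sup>*" "(z, y) \<in> (R \<inter> (S \<union> T) \<times> (S \<union> T))\<^sup>*"
            using that \<open>conn R S\<close> \<open>conn R T\<close> \<open>z \<in> S\<close> \<open>z \<in> T\<close>
              conn_mono_rtrancl[of S "S \<union> T" _ _ R] conn_mono_rtrancl[of T "S \<union> T" _ _ R]
            unfolding conn_def by blast+
          then show ?thesis by (rule rtrancl_trans)
        qed
        then show ?thesis using that unfolding conn_def by blast
      qed
      have conns: "conn R (set us)" "conn R (set (h # vs))" "conn R (set ys)" "conn R (set (L b))" "conn R (set (L d))"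
        using g ys(1) Lb(1) Ld(1) by (auto intro!: conn_gpath[OF sym] simp del: set_simps)
      have cU: "conn R ?U" by (rule unionI[OF conns(2,3), of h]) (use hin in auto)
      have cW: "conn R ?W"
        by (rule unionI[OF unionI[OF conns(1,4) cus Lb(5)] conns(5), of c]) (use cus Ld(5) in auto)
      have hno: "h \<notin> set (L b)" "h \<notin> set (L d)"
        using La(6)[OF mem(2)] La(6)[OF mem(3)] abd(2) h False by auto
      have T: "set ys \<inter> ?T = {h}" using ys(4) by (simp add: h_def)
      have sub: "set (L a) \<subseteq> ?T" "set (L b) \<subseteq> ?T" "set (L d) \<subseteq> ?T" using mem by auto
      have 1: "set ys \<inter> ?W = {}"
      proof -
        have "set ys \<inter> ?W \<subseteq> {h}" using T sub uv by auto
        moreover have "h \<notin> ?W" using hno g(4) by auto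
        ultimately show ?thesis by blast
      qed
      have 2: "set (h # vs) \<inter> ?W = {}"
      proof -
        have "set (h # vs) \<inter> (set (L b) \<union> set (L d)) \<subseteq> {c}"
          using La(6)[OF mem(2)] La(6)[OF mem(3)] abd(2) uv by auto
        then show ?thesis using cus g(4) by auto
      qed
      have "adj R ?U ?W"
      proof -
        have "(h, last us) \<in> R" using g(3) sym by (rule symD[rotated])
        then show ?thesis unfolding adj_def using us by fastforce
      qed
      moreover have "p a \<in> ?U" using La(3) uv hd_last_in_gpath(2)[OF g(2)] by auto
      moreover have "p l \<in> ?U" using ys(1,2) hd_last_in_gpath(1) by fastforce
      moreover have "p b \<in> ?W" using Lb(1,3) hd_last_in_gpath(2) by fastforce
      moreover have "p d \<in> ?W" using Ld(1,3) hd_last_in_gpath(2) by fastforce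
      moreover have "?U \<subseteq> A" "?W \<subseteq> A" using La(4) Lb(4) Ld(4) ys(3) uv by auto
      moreover have "distinct [a, l, b, d]" "{a, l, b, d} = {i, j, k, l}" using abd dist mem by auto
      moreover have "?U \<inter> ?W = {}" using 1 2 by blast
      ultimately show thesis using split[of a l b d ?U ?W] cU cW by blast
    qed
    have "h \<in> ?T" using ys(4) by (auto simp: h_def)
    then consider "h \<in> set (L i)" | "h \<in> set (L j)" | "h \<in> set (L k)" by blast
    then show thesis
    proof cases
      case 1
      then show thesis using split_leg[of i j k] dist by auto
    next
      case 2
      then show thesis using split_leg[of j i k] dist by auto
    next
      case 3
      then show thesis using split_leg[of k i j] dist by auto
    qed
  qed
qed

section \<open>Drawings\<close>

locale drawn_graph =
  fixes G :: "'a pair_pre_digraph" and pos :: "'a \<Rightarrow> complex" and \<gamma> :: "'a \<times> 'a \<Rightarrow> real \<Rightarrow> complex"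
    and V :: "'a set" and R :: "('a \<times> 'a) set"
  defines "V \<equiv> pverts G" and "R \<equiv> parcs G"
  assumes sgraph: "sgraph V R" and drawing: "plane_drawing G pos \<gamma>"
begin

lemmas R_sym = sgraphD(5)[OF sgraph]

lemma sym_R: "sym R"
  using sgraph by (simp add: sgraph_def)

lemma pos_inj: "inj_on pos V"
  using drawing by (simp add: plane_drawing_def V_def)

lemma edge_drawing:
  assumes "(u, v) \<in> R"
  shows "arc (\<gamma> (u, v))" "pathstart (\<gamma> (u, v)) = pos u" "pathfinish (\<gamma> (u, v)) = pos v"
    "\<gamma> (v, u) = reversepath (\<gamma> (u, v))" "path_image (\<gamma> (u, v)) \<inter> pos ` V = {pos u, pos v}"
  using drawing assms unfolding plane_drawing_def V_def R_def by blast+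

lemma edges_meet:
  assumes "(u, v) \<in> R" "(x, y) \<in> R" "{u, v} \<noteq> {x, y}"
  shows "path_image (\<gamma> (u, v)) \<inter> path_image (\<gamma> (x, y)) \<subseteq> pos ` ({u, v} \<inter> {x, y})"
  using drawing assms unfolding plane_drawing_def R_def by blast

text \<open>Edges are given separately from vertices, as a path uses only some of the edges among
  its vertices.\<close>

definition draw :: "'a set \<Rightarrow> ('a \<times> 'a) set \<Rightarrow> complex set" where
  "draw K F = pos ` K \<union> (\<Union>e\<in>F. path_image (\<gamma> e))"

text \<open>Both orientations of an edge have the same image, hence the condition on the
  converse.\<close>

lemma draw_Int:
  assumes K: "K \<subseteq> V" "K' \<subseteq> V" and F: "F \<subseteq> R \<inter> K \<times> K" "F' \<subseteq> R \<inter> K' \<times> K'"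
    and disj: "F \<inter> F' = {}" "F \<inter> F'\<inverse> = {}"
  shows "draw K F \<inter> draw K' F' \<subseteq> pos ` (K \<inter> K')"
proof
  have vertex: "pos u \<in> pos ` (L \<inter> L')"
    if u: "u \<in> L" "L \<subseteq> V" "L' \<subseteq> V" "E \<subseteq> R \<inter> L' \<times> L'" "e \<in> E" "pos u \<in> path_image (\<gamma> e)" for u L L' E e
  proof -
    obtain a b where ab: "e = (a, b)" by (cases e)
    have e: "e = (a, b)" "(a, b) \<in> R" "a \<in> L'" "b \<in> L'" using ab u(4,5) by auto
    have "pos u \<in> path_image (\<gamma> (a, b)) \<inter> pos ` V" using u(1,2,6) e(1) by auto
    then have "pos u = pos a \<or> pos u = pos b" using edge_drawing(5)[OF e(2)] by blast
    then have "u = a \<or> u = b" using inj_onD[OF pos_inj] u(1-3) e(3,4) by blast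
    then show ?thesis using u(1) e(3,4) by blast
  qed
  fix z assume z: "z \<in> draw K F \<inter> draw K' F'"
  then consider u u' where "u \<in> K" "u' \<in> K'" "z = pos u" "z = pos u'"
    | u e where "u \<in> K" "e \<in> F'" "z = pos u" "z \<in> path_image (\<gamma> e)"
    | u e where "u \<in> K'" "e \<in> F" "z = pos u" "z \<in> path_image (\<gamma> e)"
    | e e' where "e \<in> F" "e' \<in> F'" "z \<in> path_image (\<gamma> e)" "z \<in> path_image (\<gamma> e')"
    unfolding draw_def by blast
  then show "z \<in> pos ` (K \<inter> K')"
  proof cases
    case 1
    then have "u = u'" using inj_onD[OF pos_inj, of u u'] K by auto
    then show ?thesis using 1 by blast
  next
    case 2
    then show ?thesis using vertex[of u K K' F' e] K F by blast
  next
    case 3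
    then show ?thesis using vertex[of u K' K F e] K F by blast
  next
    case 4
    obtain a b c d where e: "e = (a, b)" "e' = (c, d)" by (cases e; cases e')
    have mem: "(a, b) \<in> R" "(c, d) \<in> R" "a \<in> K" "b \<in> K" "c \<in> K'" "d \<in> K'" using 4 e F by auto
    have "(a, b) \<noteq> (c, d)" "(a, b) \<noteq> (d, c)" using 4 e disj by auto
    then have "{a, b} \<noteq> {c, d}" by (auto simp: doubleton_eq_iff)
    then have "z \<in> pos ` ({a, b} \<inter> {c, d})" using edges_meet[OF mem(1,2)] 4 e by blast
    then show ?thesis using mem by blast
  qed
qed

lemma draw_disjoint:
  assumes "K \<subseteq> V" "K' \<subseteq> V" "F \<subseteq> R \<inter> K \<times> K" "F' \<subseteq> R \<inter> K' \<times> K'" "K \<inter> K' = {}"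
  shows "draw K F \<inter> draw K' F' = {}"
proof -
  have "F \<inter> F' = {}" "F \<inter> F'\<inverse> = {}" using assms(3-5) by blast+
  then show ?thesis using draw_Int[OF assms(1-4)] assms(5) by blast
qed

lemma connected_draw:
  assumes "conn R K" "K \<subseteq> V"
  shows "connected (draw K (R \<inter> K \<times> K))"
proof -
  let ?D = "draw K (R \<inter> K \<times> K)"
  have edge: "connected_component ?D z (pos u)" if "(u, v) \<in> R \<inter> K \<times> K" "z \<in> path_image (\<gamma> (u, v))" for u v z
    unfolding connected_component_def
  proof (intro exI[of _ "path_image (\<gamma> (u, v))"] conjI)
    have "(u, v) \<in> R" using that(1) by blast
    note ed = edge_drawing[OF this]
    show "connected (path_image (\<gamma> (u, v)))" using ed(1) by (rule connected_arc_image)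
    show "path_image (\<gamma> (u, v)) \<subseteq> ?D" using that(1) unfolding draw_def by blast
    show "pos u \<in> path_image (\<gamma> (u, v))" using pathstart_in_path_image[of "\<gamma> (u, v)"] ed(2) by simp
  qed (fact that(2))
  have verts: "connected_component ?D (pos u) (pos v)" if "u \<in> K" "v \<in> K" for u v
  proof -
    have "(u, v) \<in> (R \<inter> K \<times> K)\<^sup>*" using assms(1) that by (auto simp: conn_def)
    then show ?thesis
    proof (induction rule: rtrancl_induct)
      case base
      show ?case using that(1) by (auto simp: draw_def)
    next
      case (step v w)
      have "(v, w) \<in> R" using step.hyps by blast
      then have "pos w \<in> path_image (\<gamma> (v, w))"
        using pathfinish_in_path_image[of "\<gamma> (v, w)"] edge_drawing(3) by metis
      then have "connected_component ?D (pos w) (pos v)" using edge step.hyps(2) by blast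
      then show ?case using step.IH connected_component_sym connected_component_trans by metis
    qed
  qed
  have near: "\<exists>u\<in>K. connected_component ?D z (pos u)" if "z \<in> ?D" for z
  proof -
    from that consider u where "u \<in> K" "z = pos u" | u v where "(u, v) \<in> R \<inter> K \<times> K" "z \<in> path_image (\<gamma> (u, v))"
      unfolding draw_def by blast
    then show ?thesis
    proof cases
      case 1
      then show ?thesis using verts by blast
    next
      case 2
      then show ?thesis using edge by blast
    qed
  qed
  show ?thesis
    unfolding connected_iff_connected_component
  proof (intro ballI)
    fix y z assume "y \<in> ?D" "z \<in> ?D"
    then obtain u v where "u \<in> K" "v \<in> K" "connected_component ?D y (pos u)" "connected_component ?D z (pos v)"
      using near by blast
    then show "connected_component ?D y z"
      using verts connected_component_sym connected_component_trans by metis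
  qed
qed

definition curve :: "'a list \<Rightarrow> complex set" where
  "curve xs = draw (set xs) (path_arcs xs)"

lemma path_arcs_in: "gpath R xs \<Longrightarrow> path_arcs xs \<subseteq> R \<inter> set xs \<times> set xs"
  using path_arcs_subset gpathD(3) by blast

lemma arc_between_curve:
  "gpath R xs \<Longrightarrow> 2 \<le> length xs \<Longrightarrow> set xs \<subseteq> V \<Longrightarrow> arc_between (pos (hd xs)) (pos (last xs)) (curve xs)"
proof (induction xs rule: induct_list012)
  case (3 x y zs)
  have xy: "(x, y) \<in> R" and g: "gpath R (y # zs)" and x: "x \<notin> set (y # zs)" using 3(3) by (auto simp: gpath_def)
  note ed = edge_drawing[OF xy]
  have ends: "pos x \<in> path_image (\<gamma> (x, y))" "pos y \<in> path_image (\<gamma> (x, y))"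
    using pathstart_in_path_image[of "\<gamma> (x, y)"] pathfinish_in_path_image[of "\<gamma> (x, y)"] ed(2,3) by auto
  show ?case
  proof (cases "zs = []")
    case True
    then have "curve (x # y # zs) = path_image (\<gamma> (x, y))"
      using ends by (auto simp: curve_def draw_def)
    then show ?thesis unfolding arc_between_def using ed True by auto
  next
    case False
    then have "2 \<le> length (y # zs)" by (cases zs) auto
    then have "arc_between (pos (hd (y # zs))) (pos (last (y # zs))) (curve (y # zs))"
      using 3 g by auto
    then obtain h where h: "arc h" "pathstart h = pos y" "pathfinish h = pos (last (y # zs))"
      "path_image h = curve (y # zs)" by (auto simp: arc_between_def)
    have "path_image (\<gamma> (x, y)) \<subseteq> draw {x, y} {(x, y)}" by (auto simp: draw_def)
    moreover have "draw {x, y} {(x, y)} \<inter> curve (y # zs) \<subseteq> pos ` ({x, y} \<inter> set (y # zs))"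
      unfolding curve_def
    proof (rule draw_Int)
      show "{x, y} \<subseteq> V" "set (y # zs) \<subseteq> V" using 3(5) by auto
      show "{(x, y)} \<subseteq> R \<inter> {x, y} \<times> {x, y}" using xy by simp
      show "path_arcs (y # zs) \<subseteq> R \<inter> set (y # zs) \<times> set (y # zs)" using path_arcs_in[OF g] .
      then show "{(x, y)} \<inter> path_arcs (y # zs) = {}" "{(x, y)} \<inter> (path_arcs (y # zs))\<inverse> = {}"
        using x by blast+
    qed
    moreover have "{x, y} \<inter> set (y # zs) = {y}" using x by auto
    ultimately have "path_image (\<gamma> (x, y)) \<inter> path_image h \<subseteq> {pos y}" unfolding h(4) by auto
    then have "arc (\<gamma> (x, y) +++ h)" using ed h by (intro arc_join) auto
    moreover have "path_image (\<gamma> (x, y) +++ h) = curve (x # y # zs)"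
    proof -
      have "path_image (\<gamma> (x, y) +++ h) = path_image (\<gamma> (x, y)) \<union> curve (y # zs)"
        using ed h by (simp add: path_image_join)
      also have "\<dots> = curve (x # y # zs)" using ends(1) by (auto simp: curve_def draw_def)
      finally show ?thesis .
    qed
    ultimately show ?thesis unfolding arc_between_def using ed h by (intro exI[of _ "\<gamma> (x, y) +++ h"]) auto
  qed
qed auto

lemma pos_in_curve: "v \<in> set xs \<Longrightarrow> pos v \<in> curve xs"
  by (simp add: curve_def draw_def)

text \<open>The length bound excludes that both paths are the single edge between \<open>c\<close>
  and \<open>d\<close>; otherwise \<open>gpath_ends_length\<close> shows that they share no
  edge.\<close>

lemma curve_Int:
  assumes "gpath R xs" "gpath R ys" "set xs \<subseteq> V" "set ys \<subseteq> V" "hd xs = c" "last xs = d"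
    and "set xs \<inter> set ys = {c, d}" "3 \<le> length xs"
  shows "curve xs \<inter> curve ys \<subseteq> {pos c, pos d}"
proof -
  have no: False if "(a, b) \<in> path_arcs xs" "(a, b) \<in> path_arcs ys \<or> (b, a) \<in> path_arcs ys" for a b
  proof -
    have "{a, b} \<subseteq> set xs" "{a, b} \<subseteq> set ys" using that path_arcs_subset[of xs] path_arcs_subset[of ys] by auto
    then have "{a, b} \<subseteq> {hd xs, last xs}" using assms(5-7) by blast
    then show False using gpath_ends_length[OF assms(1) that(1)] assms(8) by simp
  qed
  have "curve xs \<inter> curve ys \<subseteq> pos ` (set xs \<inter> set ys)"
    unfolding curve_def
    by (rule draw_Int[OF assms(3,4) path_arcs_in[OF assms(1)] path_arcs_in[OF assms(2)]]) (use no in auto)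
  then show ?thesis using assms(7) by auto
qed

lemma component_avoiding_curve:
  assumes "conn R K" "K \<subseteq> V" "u \<in> K" "v \<in> K"
    and "\<And>xs. xs \<in> X \<Longrightarrow> gpath R xs \<and> set xs \<subseteq> V \<and> set xs \<inter> K = {}"
  shows "connected_component (- \<Union>(curve ` X)) (pos u) (pos v)"
  unfolding connected_component_def
proof (intro exI[of _ "draw K (R \<inter> K \<times> K)"] conjI)
  show "connected (draw K (R \<inter> K \<times> K))" using connected_draw[OF assms(1,2)] .
  show "pos u \<in> draw K (R \<inter> K \<times> K)" "pos v \<in> draw K (R \<inter> K \<times> K)" using assms by (auto simp: draw_def)
  have "draw K (R \<inter> K \<times> K) \<inter> curve xs = {}" if "xs \<in> X" for xs
    unfolding curve_def using assms(5)[OF that] assms(2)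
    by (intro draw_disjoint path_arcs_in) auto
  then show "draw K (R \<inter> K \<times> K) \<subseteq> - \<Union>(curve ` X)" by blast
qed

text \<open>The midpoint of an edge serves as a point off all the curves that is joined to both of its ends.\<close>
lemma midpoint_component:
  assumes uv: "(u, v) \<in> R"
    and X: "\<And>xs. xs \<in> X \<Longrightarrow> gpath R xs \<and> set xs \<subseteq> V \<and> u \<notin> set xs"
  shows "connected_component (- \<Union>(curve ` X)) (\<gamma> (u, v) (1/2)) (pos u)"
  unfolding connected_component_def
proof (intro exI[of _ "\<gamma> (u, v) ` {0..1/2}"] conjI)
  note ed = edge_drawing[OF uv]
  have uvV: "u \<in> V" "v \<in> V" using sgraphD(3,4)[OF sgraph uv] .
  have "path (\<gamma> (u, v))" using ed(1) by (rule arc_imp_path)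
  then have "continuous_on {0..1/2} (\<gamma> (u, v))" unfolding path_def by (rule continuous_on_subset) auto
  then show "connected (\<gamma> (u, v) ` {0..1/2})" by (rule connected_continuous_image) simp
  show "\<gamma> (u, v) (1/2) \<in> \<gamma> (u, v) ` {0..1/2}" by simp
  have "\<gamma> (u, v) 0 = pos u" using ed(2) by (simp add: pathstart_def)
  then show "pos u \<in> \<gamma> (u, v) ` {0..1/2}" by (metis atLeastAtMost_iff image_eqI order_refl zero_le_divide_1_iff zero_le_numeral)
  have "\<gamma> (u, v) t \<notin> curve xs" if t: "t \<in> {0..1/2}" and xs: "xs \<in> X" for t xs
  proof
    assume in_c: "\<gamma> (u, v) t \<in> curve xs"
    have "\<gamma> (u, v) t \<in> draw {u, v} {(u, v)}" using t by (auto simp: draw_def path_image_def)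
    moreover have "draw {u, v} {(u, v)} \<inter> curve xs \<subseteq> pos ` ({u, v} \<inter> set xs)"
      unfolding curve_def
    proof (rule draw_Int)
      show "path_arcs xs \<subseteq> R \<inter> set xs \<times> set xs" using path_arcs_in X[OF xs] by blast
      then show "{(u, v)} \<inter> path_arcs xs = {}" "{(u, v)} \<inter> (path_arcs xs)\<inverse> = {}" using X[OF xs] by blast+
    qed (use uv uvV X[OF xs] in auto)
    ultimately have "\<gamma> (u, v) t = pos v" using in_c X[OF xs] by auto
    moreover have "\<gamma> (u, v) 1 = pos v" using ed(3) by (simp add: pathfinish_def)
    moreover have "inj_on (\<gamma> (u, v)) {0..1}" using ed(1) by (simp add: arc_def)
    ultimately have "t = 1" using t inj_onD[of "\<gamma> (u, v)" "{0..1}" t 1] by simp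
    then show False using t by simp
  qed
  then show "\<gamma> (u, v) ` {0..1/2} \<subseteq> - \<Union>(curve ` X)" by blast
qed

lemma midpoint_sym: "(u, v) \<in> R \<Longrightarrow> \<gamma> (v, u) (1/2) = \<gamma> (u, v) (1/2)"
  using edge_drawing(4)[of u v] by (simp add: reversepath_def)

end

section \<open>Kuratowski minors\<close>

text \<open>Each path is a leg in \<open>A\<close>, a path through \<open>B i\<close> and a reversed
  leg in \<open>A'\<close>. The vertex \<open>b i\<close> is recorded as a point off the
  poles.\<close>

lemma spider_links:
  assumes sym: "sym R" and L: "spider R A c L p I" and L': "spider R A' c' L' q I" and AA: "A \<inter> A' = {}"
    and B: "\<And>i. i \<in> I \<Longrightarrow> conn R (B i)" "\<And>i. i \<in> I \<Longrightarrow> B i \<inter> A = {}" "\<And>i. i \<in> I \<Longrightarrow> B i \<inter> A' = {}"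
      "\<And>i j. i \<in> I \<Longrightarrow> j \<in> I \<Longrightarrow> i \<noteq> j \<Longrightarrow> B i \<inter> B j = {}"
    and b: "\<And>i. i \<in> I \<Longrightarrow> b i \<in> B i \<and> b' i \<in> B i \<and> (p i, b i) \<in> R \<and> (b' i, q i) \<in> R"
  obtains X where "\<And>i. i \<in> I \<Longrightarrow> gpath R (X i)" "\<And>i. i \<in> I \<Longrightarrow> hd (X i) = c" "\<And>i. i \<in> I \<Longrightarrow> last (X i) = c'"
    "\<And>i. i \<in> I \<Longrightarrow> b i \<in> set (X i)" "\<And>i. i \<in> I \<Longrightarrow> set (X i) \<subseteq> set (L i) \<union> B i \<union> set (L' i)"
    "\<And>i. i \<in> I \<Longrightarrow> 3 \<le> length (X i)"
    "\<And>i j. i \<in> I \<Longrightarrow> j \<in> I \<Longrightarrow> i \<noteq> j \<Longrightarrow> set (X i) \<inter> set (X j) = {c, c'}"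
proof -
  have "\<forall>i\<in>I. \<exists>xs. gpath R xs \<and> hd xs = b i \<and> last xs = b' i \<and> set xs \<subseteq> B i"
  proof
    fix i assume i: "i \<in> I"
    have "b i \<in> B i" "b' i \<in> B i" using b[OF i] by auto
    from gpath_between[OF B(1)[OF i] this]
    show "\<exists>xs. gpath R xs \<and> hd xs = b i \<and> last xs = b' i \<and> set xs \<subseteq> B i" by blast
  qed
  from bchoice[OF this] obtain M where
    M: "\<forall>i\<in>I. gpath R (M i) \<and> hd (M i) = b i \<and> last (M i) = b' i \<and> set (M i) \<subseteq> B i" by blast
  define X where "X i = L i @ M i @ rev (L' i)" for i
  have props: "gpath R (X i)" "hd (X i) = c" "last (X i) = c'" "b i \<in> set (X i)"
    "set (X i) \<subseteq> set (L i) \<union> B i \<union> set (L' i)" "3 \<le> length (X i)" if i: "i \<in> I" for i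
  proof -
    note l = spiderD[OF L i] and l' = spiderD[OF L' i]
    have m: "gpath R (M i)" "hd (M i) = b i" "last (M i) = b' i" "set (M i) \<subseteq> B i" using M i by auto
    have ne: "L i \<noteq> []" "M i \<noteq> []" "L' i \<noteq> []" using l(1) m(1) l'(1) gpathD(1) by blast+
    have 1: "gpath R (M i @ rev (L' i))"
    proof (rule gpath_append[OF m(1)])
      show "gpath R (rev (L' i))" using l'(1) gpath_rev[OF sym] by blast
      show "set (M i) \<inter> set (rev (L' i)) = {}" using m(4) l'(4) B(3)[OF i] by auto
      show "(last (M i), hd (rev (L' i))) \<in> R" using m(3) l'(3) b[OF i] by (simp add: hd_rev)
    qed
    show "gpath R (X i)" unfolding X_def
    proof (rule gpath_append[OF l(1) 1])
      show "set (L i) \<inter> set (M i @ rev (L' i)) = {}" using l(4) m(4) l'(4) B(2)[OF i] AA by auto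
      show "(last (L i), hd (M i @ rev (L' i))) \<in> R" using l(3) m(2) ne b[OF i] by simp
    qed
    show "hd (X i) = c" using ne l(2) by (simp add: X_def)
    show "last (X i) = c'" using ne l'(2) by (simp add: X_def last_rev)
    have "b i \<in> set (M i)" using hd_last_in_gpath(1)[OF m(1)] m(2) by simp
    then show "b i \<in> set (X i)" by (simp add: X_def)
    show "set (X i) \<subseteq> set (L i) \<union> B i \<union> set (L' i)" using m(4) by (auto simp: X_def)
    have "0 < length (L i)" "0 < length (M i)" "0 < length (L' i)" using ne by auto
    then show "3 \<le> length (X i)" unfolding X_def length_append length_rev by linarith
  qed
  have "set (X i) \<inter> set (X j) = {c, c'}" if ij: "i \<in> I" "j \<in> I" "i \<noteq> j" for i j
  proof -
    have "c \<in> set (X i)" "c \<in> set (X j)" "c' \<in> set (X i)" "c' \<in> set (X j)"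
      using props(1-3)[OF ij(1)] props(1-3)[OF ij(2)] hd_last_in_gpath by metis+
    moreover have "set (X i) \<inter> set (X j) \<subseteq> {c, c'}"
    proof
      fix z assume z: "z \<in> set (X i) \<inter> set (X j)"
      then have z': "z \<in> set (L i) \<or> z \<in> B i \<or> z \<in> set (L' i)" "z \<in> set (L j) \<or> z \<in> B j \<or> z \<in> set (L' j)"
        using props(5)[OF ij(1)] props(5)[OF ij(2)] by auto
      note A = spiderD(4)[OF L ij(1)] spiderD(4)[OF L ij(2)] spiderD(4)[OF L' ij(1)] spiderD(4)[OF L' ij(2)]
      have "z \<in> set (L i) \<inter> set (L j) \<or> z \<in> set (L' i) \<inter> set (L' j)"
        using z' A AA B(2)[OF ij(1)] B(2)[OF ij(2)] B(3)[OF ij(1)] B(3)[OF ij(2)] B(4)[OF ij] by blast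
      then show "z \<in> {c, c'}" using spiderD(6)[OF L ij] spiderD(6)[OF L' ij] by auto
    qed
    ultimately show ?thesis by blast
  qed
  then show ?thesis using that[of X] props by blast
qed

lemma adj_choice:
  assumes "\<And>i. i \<in> I \<Longrightarrow> adj R A (B i)"
  obtains p b where "\<And>i. i \<in> I \<Longrightarrow> p i \<in> A \<and> b i \<in> B i \<and> (p i, b i) \<in> R"
proof -
  have "\<forall>i\<in>I. \<exists>e. fst e \<in> A \<and> snd e \<in> B i \<and> (fst e, snd e) \<in> R"
    using assms unfolding adj_def by fastforce
  from bchoice[OF this] obtain e where "\<forall>i\<in>I. fst (e i) \<in> A \<and> snd (e i) \<in> B i \<and> (fst (e i), snd (e i)) \<in> R" ..
  then show ?thesis using that[of "\<lambda>i. fst (e i)" "\<lambda>i. snd (e i)"] by blast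
qed

context drawn_graph
begin

text \<open>\<open>A 0\<close> and \<open>A 1\<close> provide the poles of a theta curve with arcs
  through the sets \<open>B i\<close>. Any vertex of \<open>A 2\<close> reaches the i-th arc inside
  \<open>A 2 \<union> B i\<close>, off the other two arcs, against
  \<open>theta_curve_face\<close>.\<close>

lemma no_K33_model:
  fixes A B :: "nat \<Rightarrow> 'a set"
  assumes A: "\<And>i. i < 3 \<Longrightarrow> conn R (A i)" "\<And>i. i < 3 \<Longrightarrow> A i \<subseteq> V"
    and B: "\<And>i. i < 3 \<Longrightarrow> conn R (B i)" "\<And>i. i < 3 \<Longrightarrow> B i \<subseteq> V"
    and disj: "\<And>i j. i < 3 \<Longrightarrow> j < 3 \<Longrightarrow> i \<noteq> j \<Longrightarrow> A i \<inter> A j = {}"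
      "\<And>i j. i < 3 \<Longrightarrow> j < 3 \<Longrightarrow> i \<noteq> j \<Longrightarrow> B i \<inter> B j = {}"
      "\<And>i j. i < 3 \<Longrightarrow> j < 3 \<Longrightarrow> A i \<inter> B j = {}"
    and adj: "\<And>i j. i < 3 \<Longrightarrow> j < (3::nat) \<Longrightarrow> adj R (A i) (B j)"
  shows False
proof -
  let ?I = "{0, 1, 2} :: nat set"
  have I: "i < 3" if "i \<in> ?I" for i using that by auto
  have A012: "A 0 \<subseteq> V" "A 1 \<subseteq> V" "A 2 \<subseteq> V" using A(2) by auto
  have Ad: "A 0 \<inter> A 1 = {}" "\<And>i. i \<in> ?I \<Longrightarrow> A 0 \<inter> B i = {}" "\<And>i. i \<in> ?I \<Longrightarrow> A 1 \<inter> B i = {}"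
    "\<And>i. i \<in> ?I \<Longrightarrow> A 2 \<inter> B i = {}" "A 0 \<inter> A 2 = {}" "A 1 \<inter> A 2 = {}"
    using disj(1)[of 0 1] disj(1)[of 0 2] disj(1)[of 1 2] disj(3)[of 0] disj(3)[of 1] disj(3)[of 2] I by simp_all
  have Bd: "B i \<inter> B j = {}" if "i \<in> ?I" "j \<in> ?I" "i \<noteq> j" for i j using disj(2) I that by blast
  have "adj R (A 0) (B i)" if "i \<in> ?I" for i using adj I[OF that] by simp
  then obtain p b where p: "\<And>i. i \<in> ?I \<Longrightarrow> p i \<in> A 0 \<and> b i \<in> B i \<and> (p i, b i) \<in> R"
    using adj_choice[of ?I R "A 0" B] by blast
  have "adj R (A 1) (B i)" if "i \<in> ?I" for i using adj I[OF that] by simp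
  then obtain q b' where q: "\<And>i. i \<in> ?I \<Longrightarrow> q i \<in> A 1 \<and> b' i \<in> B i \<and> (q i, b' i) \<in> R"
    using adj_choice[of ?I R "A 1" B] by blast
  obtain c L where L: "spider R (A 0) c L p ?I"
    using tripod[OF sym_R A(1), of 0 p 0 1 2] p by auto
  obtain c' L' where L': "spider R (A 1) c' L' q ?I"
    using tripod[OF sym_R A(1), of 1 q 0 1 2] q by auto
  obtain X where X: "\<And>i. i \<in> ?I \<Longrightarrow> gpath R (X i)" "\<And>i. i \<in> ?I \<Longrightarrow> hd (X i) = c" "\<And>i. i \<in> ?I \<Longrightarrow> last (X i) = c'"
    "\<And>i. i \<in> ?I \<Longrightarrow> b i \<in> set (X i)" "\<And>i. i \<in> ?I \<Longrightarrow> set (X i) \<subseteq> set (L i) \<union> B i \<union> set (L' i)"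
    "\<And>i. i \<in> ?I \<Longrightarrow> 3 \<le> length (X i)"
    "\<And>i j. i \<in> ?I \<Longrightarrow> j \<in> ?I \<Longrightarrow> i \<noteq> j \<Longrightarrow> set (X i) \<inter> set (X j) = {c, c'}"
  proof (rule spider_links[OF sym_R L L', of B b b'])
    show "A 0 \<inter> A 1 = {}" by (rule Ad(1))
  next
    fix i assume i: "i \<in> ?I"
    show "conn R (B i)" using B(1) I[OF i] .
    show "B i \<inter> A 0 = {}" "B i \<inter> A 1 = {}" using Ad(2,3) i by blast+
    show "b i \<in> B i \<and> b' i \<in> B i \<and> (p i, b i) \<in> R \<and> (b' i, q i) \<in> R" using p[OF i] q[OF i] R_sym by blast
  next
    fix i j assume "i \<in> ?I" "j \<in> ?I" "i \<noteq> j"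
    then show "B i \<inter> B j = {}" using disj(2) I by blast
  qed blast
  have XS: "set (X i) \<subseteq> A 0 \<union> B i \<union> A 1" if "i \<in> ?I" for i
    using X(5)[OF that] spiderD(4)[OF L that] spiderD(4)[OF L' that] by blast
  have XV: "set (X i) \<subseteq> V" if "i \<in> ?I" for i
    using XS[OF that] A012 B(2)[OF I[OF that]] by blast
  have cc: "c \<in> A 0" "c' \<in> A 1" using spiderD(4,5)[OF L, of 0] spiderD(4,5)[OF L', of 0] by auto
  have arcs: "arc_between (pos c) (pos c') (curve (X i))" if "i \<in> ?I" for i
    using arc_between_curve[OF X(1)[OF that] _ XV[OF that]] X(2,3,6)[OF that] by simp
  have meet: "curve (X i) \<inter> curve (X j) \<subseteq> {pos c, pos c'}" if "i \<in> ?I" "j \<in> ?I" "i \<noteq> j" for i j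
    using curve_Int[OF X(1)[OF that(1)] X(1)[OF that(2)] XV[OF that(1)] XV[OF that(2)] X(2,3)[OF that(1)]
        X(7)[OF that] X(6)[OF that(1)]] .
  have y: "pos (b i) \<in> curve (X i) - {pos c, pos c'}" if i: "i \<in> ?I" for i
  proof -
    have "b i \<in> B i" using p[OF i] by blast
    then have "b i \<noteq> c" "b i \<noteq> c'" "b i \<in> V" "c \<in> V" "c' \<in> V"
      using cc Ad(2,3)[OF i] B(2)[OF I[OF i]] A012 by blast+
    then have "pos (b i) \<noteq> pos c" "pos (b i) \<noteq> pos c'" using inj_onD[OF pos_inj] by metis+
    then show ?thesis using pos_in_curve[OF X(4)[OF i]] by blast
  qed
  obtain e where e: "e \<in> A 2" using A(1)[of 2] by (auto simp: conn_def)
  have comp: "connected_component (- (curve (X j) \<union> curve (X l))) (pos e) (pos (b i))"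
    if i: "i \<in> ?I" "j \<in> ?I" "l \<in> ?I" "i \<noteq> j" "i \<noteq> l" for i j l
  proof -
    have "connected_component (- \<Union>(curve ` {X j, X l})) (pos e) (pos (b i))"
    proof (rule component_avoiding_curve)
      have "conn R (A 2)" "adj R (A 2) (B i)" using A(1) adj I[OF i(1)] by simp_all
      then show "conn R (A 2 \<union> B i)" using conn_Un[OF sym_R _ B(1)[OF I[OF i(1)]]] by blast
      show "A 2 \<union> B i \<subseteq> V" using A012 B(2)[OF I[OF i(1)]] by blast
      show "e \<in> A 2 \<union> B i" "b i \<in> A 2 \<union> B i" using e p[OF i(1)] by blast+
    next
      have avoid: "set (X t) \<inter> (A 2 \<union> B i) = {}" if t: "t \<in> ?I" "i \<noteq> t" for t
        using XS[OF t(1)] Ad(2,3,4)[OF i(1)] Ad(4)[OF t(1)] Ad(5,6) Bd[OF i(1) t] by blast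
      fix xs assume "xs \<in> {X j, X l}"
      then show "gpath R xs \<and> set xs \<subseteq> V \<and> set xs \<inter> (A 2 \<union> B i) = {}"
        using X(1) XV avoid[OF i(2,4)] avoid[OF i(3,5)] i(2,3) by blast
    qed
    then show ?thesis by simp
  qed
  have m: "0 \<in> ?I" "1 \<in> ?I" "2 \<in> ?I" "(0::nat) \<noteq> 1" "(0::nat) \<noteq> 2" "(1::nat) \<noteq> 2" by auto
  show False
    by (rule theta_curve_face[OF arcs[OF m(1)] arcs[OF m(2)] arcs[OF m(3)] meet[OF m(1,2,4)] meet[OF m(1,3,5)]
        meet[OF m(2,3,6)] y[OF m(1)] y[OF m(2)] y[OF m(3)] comp[OF m(1,2,3,4,5)]
        comp[OF m(2,1,3) m(4)[symmetric] m(6)] comp[OF m(3,1,2) m(5)[symmetric] m(6)[symmetric]]])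
qed

text \<open>The sides of the K33 are \<open>U\<close>, \<open>B d\<close>, \<open>B e\<close> and
  \<open>W\<close>, \<open>B a\<close>, \<open>B b\<close>: each half meets its own two sets on the
  opposite side.\<close>

lemma no_split_pole:
  assumes conn: "\<And>i. i \<in> {a, b, d, e} \<Longrightarrow> conn R (B i)" and BV: "\<And>i. i \<in> {a, b, d, e} \<Longrightarrow> B i \<subseteq> V"
    and disj: "\<And>i j. i \<in> {a, b, d, e} \<Longrightarrow> j \<in> {a, b, d, e} \<Longrightarrow> i \<noteq> j \<Longrightarrow> B i \<inter> B j = {}"
    and adj: "\<And>i j. i \<in> {a, b, d, e} \<Longrightarrow> j \<in> {a, b, d, e} \<Longrightarrow> i \<noteq> j \<Longrightarrow> adj R (B i) (B j)"
    and dist: "distinct [a, b, d, (e::nat)]"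
    and U: "U \<subseteq> V" "W \<subseteq> V" "U \<inter> W = {}" "conn R U" "conn R W" "adj R U W"
    and UB: "\<And>i. i \<in> {a, b, d, e} \<Longrightarrow> (U \<union> W) \<inter> B i = {}"
    and att: "adj R U (B a)" "adj R U (B b)" "adj R W (B d)" "adj R W (B e)"
  shows False
proof -
  define X where "X i = (if i = 0 then U else if i = 1 then B d else B e)" for i :: nat
  define Y where "Y i = (if i = 0 then W else if i = 1 then B a else B b)" for i :: nat
  have X: "X 0 = U" "X 1 = B d" "X 2 = B e" and Y: "Y 0 = W" "Y 1 = B a" "Y 2 = B b"
    by (simp_all add: X_def Y_def)
  have mem: "a \<in> {a, b, d, e}" "b \<in> {a, b, d, e}" "d \<in> {a, b, d, e}" "e \<in> {a, b, d, e}" by auto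
  have UB': "U \<inter> B i = {}" "B i \<inter> U = {}" "W \<inter> B i = {}" "B i \<inter> W = {}" if "i \<in> {a, b, d, e}" for i
    using UB[OF that] by auto
  have ne: "a \<noteq> b" "d \<noteq> e" "d \<noteq> a" "d \<noteq> b" "e \<noteq> a" "e \<noteq> b" using dist by auto
  have D: "U \<inter> B a = {}" "U \<inter> B b = {}" "U \<inter> B d = {}" "U \<inter> B e = {}" "B d \<inter> U = {}" "B e \<inter> U = {}"
    "W \<inter> B a = {}" "W \<inter> B b = {}" "B a \<inter> W = {}" "B b \<inter> W = {}" "B d \<inter> W = {}" "B e \<inter> W = {}"
    using UB'[OF mem(1)] UB'[OF mem(2)] UB'[OF mem(3)] UB'[OF mem(4)] by simp_all
  have D': "B a \<inter> B b = {}" "B b \<inter> B a = {}" "B d \<inter> B e = {}" "B e \<inter> B d = {}"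
    "B d \<inter> B a = {}" "B d \<inter> B b = {}" "B e \<inter> B a = {}" "B e \<inter> B b = {}"
    using disj mem ne by metis+
  have E: "adj R (B d) W" "adj R (B e) W" "adj R (B d) (B a)" "adj R (B d) (B b)" "adj R (B e) (B a)" "adj R (B e) (B b)"
    using att(3,4) adj_sym[OF sym_R] adj mem ne by blast+
  show False
  proof (rule no_K33_model[of X Y])
    fix i :: nat assume "i < 3"
    then have i: "i = 0 \<or> i = 1 \<or> i = 2" by auto
    show "conn R (X i)" "conn R (Y i)" using i X Y U(4,5) conn mem by metis+
    show "X i \<subseteq> V" "Y i \<subseteq> V" using i X Y U(1,2) BV mem by metis+
    fix j :: nat assume "j < 3"
    then have j: "j = 0 \<or> j = 1 \<or> j = 2" by auto
    show "X i \<inter> X j = {}" "Y i \<inter> Y j = {}" if "i \<noteq> j" using i j that D D' X Y by metis+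
    show "X i \<inter> Y j = {}" using i j U(3) D D' X Y by metis
    show "adj R (X i) (Y j)" using i j U(6) att(1,2) E X Y by metis
  qed
qed

text \<open>\<open>B 0\<close> and \<open>B 1\<close> become the poles: each contains a four-legged
  spider, since a split is excluded by \<open>no_split_pole\<close>. Three legs of each lead through
  \<open>B 2\<close>, \<open>B 3\<close>, \<open>B 4\<close>, the fourth pair along a direct edge,
  and \<open>four_arcs\<close> applies.\<close>

lemma no_K5_model:
  fixes B :: "nat \<Rightarrow> 'a set"
  assumes B: "\<And>i. i < 5 \<Longrightarrow> conn R (B i)" "\<And>i. i < 5 \<Longrightarrow> B i \<subseteq> V"
    and disj: "\<And>i j. i < 5 \<Longrightarrow> j < 5 \<Longrightarrow> i \<noteq> j \<Longrightarrow> B i \<inter> B j = {}"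
    and adj: "\<And>i j. i < 5 \<Longrightarrow> j < (5::nat) \<Longrightarrow> i \<noteq> j \<Longrightarrow> adj R (B i) (B j)"
  shows False
proof -
  have pole: "\<exists>c L. spider R (B m) c L p {i, j, k, l}"
    if I: "distinct [m, i, j, k, l]" "m < 5" "i < 5" "j < 5" "k < 5" "l < 5"
      and p: "\<And>t. t \<in> {i, j, k, l} \<Longrightarrow> p t \<in> B m \<and> r t \<in> B t \<and> (p t, r t) \<in> R"
    for m i j k l p r
  proof (rule spider_four[OF sym_R B(1)[OF I(2)], of p i j k l])
    show "p i \<in> B m" "p j \<in> B m" "p k \<in> B m" "p l \<in> B m" "distinct [i, j, k, l]" using p I(1) by auto
  next
    fix c L assume "spider R (B m) c L p {i, j, k, l}"
    then show ?thesis by blast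
  next
    fix U W a b d e
    assume dist: "distinct [a, b, d, e]" and eq: "{a, b, d, e} = {i, j, k, l}" and UW: "U \<subseteq> B m" "W \<subseteq> B m"
      "U \<inter> W = {}" "conn R U" "conn R W" "adj R U W" and pm: "p a \<in> U" "p b \<in> U" "p d \<in> W" "p e \<in> W"
    have I4: "t < 5" "t \<noteq> m" if "t \<in> {a, b, d, e}" for t using that I unfolding eq by auto
    have r: "r t \<in> B t" "(p t, r t) \<in> R" if "t \<in> {a, b, d, e}" for t using that p unfolding eq by auto
    have "False"
    proof (rule no_split_pole[of a b d e B U W])
      fix t assume t: "t \<in> {a, b, d, e}"
      show "conn R (B t)" "B t \<subseteq> V" using B I4[OF t] by auto
      show "(U \<union> W) \<inter> B t = {}" using disj[OF I4(1)[OF t] I(2) I4(2)[OF t]] UW by blast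
    next
      fix s t assume s: "s \<in> {a, b, d, e}" and t: "t \<in> {a, b, d, e}" and "s \<noteq> t"
      then show "B s \<inter> B t = {}" "adj R (B s) (B t)" using disj adj I4 by auto
    next
      show "U \<subseteq> V" "W \<subseteq> V" using UW B(2)[OF I(2)] by auto
      show "adj R U (B a)" "adj R U (B b)" "adj R W (B d)" "adj R W (B e)"
        unfolding adj_def using pm r by blast+
    qed (use dist UW in auto)
    then show ?thesis ..
  qed
  have "adj R (B 0) (B i)" if "i \<in> {1, 2, 3, 4}" for i using adj[of 0 i] that by auto
  then obtain p r where p: "\<And>i. i \<in> {1, 2, 3, 4} \<Longrightarrow> p i \<in> B 0 \<and> r i \<in> B i \<and> (p i, r i) \<in> R"
    using adj_choice[of "{1, 2, 3, 4}" R "B 0" B] by blast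
  have "adj R (B 1) (B i)" if "i \<in> {2, 3, 4}" for i using adj[of 1 i] that by auto
  then obtain q' r'' where q': "\<And>i. i \<in> {2, 3, 4} \<Longrightarrow> q' i \<in> B 1 \<and> r'' i \<in> B i \<and> (q' i, r'' i) \<in> R"
    using adj_choice[of "{2, 3, 4}" R "B 1" B] by blast
  \<comment> \<open>At index 0 the attachment is the edge already chosen from \<open>B 0\<close> to
    \<open>B 1\<close>, so that both spiders use the same edge for their direct connection.\<close>
  define q r' where "q = q'(0 := r 1)" and "r' = r''(0 := p 1)"
  have q: "q i \<in> B 1 \<and> r' i \<in> B i \<and> (q i, r' i) \<in> R" if "i \<in> {0, 2, 3, 4}" for i
    using that q'[of i] p[of 1] R_sym by (auto simp: q_def r'_def)
  obtain c L where L: "spider R (B 0) c L p {1, 2, 3, 4}" using pole[of 0 1 2 3 4 p r] p by auto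
  obtain c' L' where L': "spider R (B 1) c' L' q {0, 2, 3, 4}" using pole[of 1 0 2 3 4 q r'] q by auto
  let ?I = "{2, 3, 4} :: nat set"
  have I: "i < 5" "i \<noteq> 0" "i \<noteq> 1" "i \<in> {1, 2, 3, 4}" "i \<in> {0, 2, 3, 4}" if "i \<in> ?I" for i using that by auto
  have LI: "spider R (B 0) c L p ?I" "spider R (B 1) c' L' q ?I"
    using spider_subset[OF L] spider_subset[OF L'] by auto
  obtain X where X: "\<And>i. i \<in> ?I \<Longrightarrow> gpath R (X i)" "\<And>i. i \<in> ?I \<Longrightarrow> hd (X i) = c" "\<And>i. i \<in> ?I \<Longrightarrow> last (X i) = c'"
    "\<And>i. i \<in> ?I \<Longrightarrow> r i \<in> set (X i)" "\<And>i. i \<in> ?I \<Longrightarrow> set (X i) \<subseteq> set (L i) \<union> B i \<union> set (L' i)"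
    "\<And>i. i \<in> ?I \<Longrightarrow> 3 \<le> length (X i)"
    "\<And>i j. i \<in> ?I \<Longrightarrow> j \<in> ?I \<Longrightarrow> i \<noteq> j \<Longrightarrow> set (X i) \<inter> set (X j) = {c, c'}"
  proof (rule spider_links[OF sym_R LI, of B r r'])
    show "B 0 \<inter> B 1 = {}" using disj by simp
  next
    fix i assume i: "i \<in> ?I"
    show "conn R (B i)" using B(1) I[OF i] by blast
    show "B i \<inter> B 0 = {}" "B i \<inter> B 1 = {}" using disj[of i 0] disj[of i 1] I[OF i] by simp_all
    show "r i \<in> B i \<and> r' i \<in> B i \<and> (p i, r i) \<in> R \<and> (r' i, q i) \<in> R"
      using p[OF I(4)[OF i]] q[OF I(5)[OF i]] R_sym by blast
  next
    fix i j assume "i \<in> ?I" "j \<in> ?I" "i \<noteq> j"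
    then show "B i \<inter> B j = {}" using disj I by blast
  qed blast
  define Z where "Z = L 1 @ rev (L' 0)"
  note l = spiderD[OF L insertI1] and l' = spiderD[OF L' insertI1]
  have B01: "B 0 \<inter> B 1 = {}" "B 0 \<subseteq> V" "B 1 \<subseteq> V" using disj[of 0 1] B(2)[of 0] B(2)[of 1] by auto
  have ne: "L 1 \<noteq> []" "L' 0 \<noteq> []" using l(1) l'(1) gpathD(1) by blast+
  have gZ: "gpath R Z" unfolding Z_def
  proof (rule gpath_append[OF l(1)])
    show "gpath R (rev (L' 0))" using l'(1) gpath_rev[OF sym_R] by blast
    show "set (L 1) \<inter> set (rev (L' 0)) = {}" using l(4) l'(4) B01 by auto
    show "(last (L 1), hd (rev (L' 0))) \<in> R" using l(3) l'(3) p[of 1] by (simp add: hd_rev q_def)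
  qed
  have hlZ: "hd Z = c" "last Z = c'" using ne l(2) l'(2) by (simp_all add: Z_def last_rev)
  have ZB: "set Z \<subseteq> B 0 \<union> B 1" and ZV: "set Z \<subseteq> V" using l(4) l'(4) B01 by (auto simp: Z_def)
  have "0 < length (L 1)" "0 < length (L' 0)" using ne by auto
  then have Z2: "2 \<le> length Z" unfolding Z_def length_append length_rev by linarith
  have cc: "c \<in> B 0" "c' \<in> B 1" using l(4,5) l'(4,5) by auto
  have XS: "set (X i) \<subseteq> B 0 \<union> B i \<union> B 1" if "i \<in> ?I" for i
    using X(5)[OF that] spiderD(4)[OF LI(1) that] spiderD(4)[OF LI(2) that] by blast
  have XV: "set (X i) \<subseteq> V" if "i \<in> ?I" for i
    using XS[OF that] B01 B(2)[OF I(1)[OF that]] by blast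
  have XZ: "set (X i) \<inter> set Z = {c, c'}" if i: "i \<in> ?I" for i
  proof -
    have "c \<in> set (X i)" "c' \<in> set (X i)" "c \<in> set Z" "c' \<in> set Z"
      using X(1-3)[OF i] gZ hlZ hd_last_in_gpath by metis+
    moreover have "set (X i) \<inter> set Z \<subseteq> {c, c'}"
    proof
      fix z assume z: "z \<in> set (X i) \<inter> set Z"
      have "B i \<inter> B 0 = {}" "B i \<inter> B 1 = {}" using disj[of i 0] disj[of i 1] I[OF i] by auto
      moreover have "z \<in> set (L i) \<or> z \<in> B i \<or> z \<in> set (L' i)" using z X(5)[OF i] by blast
      moreover have "z \<in> set (L 1) \<or> z \<in> set (L' 0)" using z by (auto simp: Z_def)
      moreover have "set (L i) \<subseteq> B 0" "set (L' i) \<subseteq> B 1"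
        using spiderD(4)[OF LI(1) i] spiderD(4)[OF LI(2) i] by auto
      ultimately have "z \<in> set (L i) \<inter> set (L 1) \<or> z \<in> set (L' i) \<inter> set (L' 0)"
        using l(4) l'(4) B01(1) by blast
      moreover have "set (L i) \<inter> set (L 1) = {c}" "set (L' i) \<inter> set (L' 0) = {c'}"
        using spiderD(6)[OF L I(4)[OF i], of 1] spiderD(6)[OF L' I(5)[OF i], of 0] I[OF i] by auto
      ultimately show "z \<in> {c, c'}" by blast
    qed
    ultimately show ?thesis by blast
  qed
  have arcs: "arc_between (pos c) (pos c') (curve (X i))" if "i \<in> ?I" for i
    using arc_between_curve[OF X(1)[OF that] _ XV[OF that]] X(2,3,6)[OF that] by simp
  have arcZ: "arc_between (pos c) (pos c') (curve Z)"
    using arc_between_curve[OF gZ Z2 ZV] hlZ by simp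
  have meet: "curve (X i) \<inter> curve (X j) \<subseteq> {pos c, pos c'}" if "i \<in> ?I" "j \<in> ?I" "i \<noteq> j" for i j
    using curve_Int[OF X(1)[OF that(1)] X(1)[OF that(2)] XV[OF that(1)] XV[OF that(2)] X(2,3)[OF that(1)]
        X(7)[OF that] X(6)[OF that(1)]] .
  have meetZ: "curve (X i) \<inter> curve Z \<subseteq> {pos c, pos c'}" if i: "i \<in> ?I" for i
    using curve_Int[OF X(1)[OF i] gZ XV[OF i] ZV X(2,3)[OF i] XZ[OF i] X(6)[OF i]] .
  have y: "pos (r i) \<in> curve (X i) - {pos c, pos c'}" if i: "i \<in> ?I" for i
  proof -
    have "r i \<in> B i" using p[OF I(4)[OF i]] by blast
    then have "r i \<noteq> c" "r i \<noteq> c'" "r i \<in> V" "c \<in> V" "c' \<in> V"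
      using cc disj[of i 0] disj[of i 1] B(2)[OF I(1)[OF i]] I[OF i] B01 by auto
    then have "pos (r i) \<noteq> pos c" "pos (r i) \<noteq> pos c'" using inj_onD[OF pos_inj] by metis+
    then show ?thesis using pos_in_curve[OF X(4)[OF i]] by blast
  qed
  have avoid: "gpath R xs \<and> set xs \<subseteq> V \<and> set xs \<inter> B i = {}"
    if i: "i \<in> ?I" and xs: "xs \<in> insert Z (X ` (?I - {i}))" for i xs
  proof -
    have Bi: "B i \<inter> B 0 = {}" "B i \<inter> B 1 = {}" using disj[of i 0] disj[of i 1] I[OF i] by auto
    from xs consider "xs = Z" | j where "j \<in> ?I" "j \<noteq> i" "xs = X j" by blast
    then show ?thesis
    proof cases
      case 1
      then show ?thesis using gZ ZV ZB Bi by blast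
    next
      case 2
      then have "B i \<inter> B j = {}" using disj I i by metis
      then show ?thesis using 2 X(1) XV XS[OF 2(1)] Bi by blast
    qed
  qed
  \<comment> \<open>The witness is the midpoint of an edge between \<open>B i\<close> and
    \<open>B j\<close>: each half of the edge leads into one of the two sets without meeting the
    arcs that avoid this set.\<close>
  have mid: "\<exists>x. x \<notin> curve (X i) \<and> x \<notin> curve (X j)
      \<and> connected_component (- \<Union>(curve ` insert Z (X ` (?I - {i})))) x (pos (r i))
      \<and> connected_component (- \<Union>(curve ` insert Z (X ` (?I - {j})))) x (pos (r j))"
    if ij: "i \<in> ?I" "j \<in> ?I" "i \<noteq> j" for i j
  proof -
    obtain u w where uw: "u \<in> B i" "w \<in> B j" "(u, w) \<in> R"
      using adj[OF I(1)[OF ij(1)] I(1)[OF ij(2)] ij(3)] by (auto simp: adj_def)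
    let ?x = "\<gamma> (u, w) (1/2)"
    have x: "connected_component (- \<Union>(curve ` insert Z (X ` (?I - {t})))) (\<gamma> (v, v') (1/2)) (pos (r t))"
      if v: "(v, v') \<in> R" "v \<in> B t" and t: "t \<in> ?I" for v v' t
    proof -
      have rt: "r t \<in> B t" using p[OF I(4)[OF t]] by blast
      have "connected_component (- \<Union>(curve ` insert Z (X ` (?I - {t})))) (\<gamma> (v, v') (1/2)) (pos v)"
        by (rule midpoint_component[OF v(1)]) (use avoid[OF t] v(2) in blast)
      moreover have "connected_component (- \<Union>(curve ` insert Z (X ` (?I - {t})))) (pos v) (pos (r t))"
        by (rule component_avoiding_curve[OF B(1)[OF I(1)[OF t]] B(2)[OF I(1)[OF t]] v(2) rt avoid[OF t]])
      ultimately show ?thesis by (rule connected_component_trans)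
    qed
    have 1: "connected_component (- \<Union>(curve ` insert Z (X ` (?I - {i})))) ?x (pos (r i))"
      by (rule x[OF uw(3,1) ij(1)])
    have 2: "connected_component (- \<Union>(curve ` insert Z (X ` (?I - {j})))) ?x (pos (r j))"
      using x[OF R_sym[OF uw(3)] uw(2) ij(2)] midpoint_sym[OF uw(3)] by simp
    have "j \<in> ?I - {i}" "i \<in> ?I - {j}" using ij by blast+
    then have "X j \<in> insert Z (X ` (?I - {i}))" "X i \<in> insert Z (X ` (?I - {j}))"
      using imageI[of j "?I - {i}" X] imageI[of i "?I - {j}" X] by (simp_all only: insert_iff simp_thms)
    then have "?x \<notin> curve (X j)" "?x \<notin> curve (X i)"
      using connected_component_in(1)[OF 1] connected_component_in(1)[OF 2] by (meson ComplD UN_I)+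
    then show ?thesis using 1 2 by (intro exI[of _ ?x] conjI)
  qed
  have diff: "?I - {2} = {3, 4}" "?I - {3} = {2, 4}" "?I - {4} = {2, 3}" by auto
  have un: "(\<Union>(curve ` insert Z (X ` {i, j}))) = curve (X i) \<union> curve (X j) \<union> curve Z" for i j by auto
  obtain x where x: "x \<notin> curve (X 2)" "x \<notin> curve (X 3)"
    "connected_component (- (curve (X 3) \<union> curve (X 4) \<union> curve Z)) x (pos (r 2))"
    "connected_component (- (curve (X 2) \<union> curve (X 4) \<union> curve Z)) x (pos (r 3))"
    using mid[of 2 3] unfolding diff un by auto
  obtain x' where x': "x' \<notin> curve (X 2)" "x' \<notin> curve (X 4)"
    "connected_component (- (curve (X 3) \<union> curve (X 4) \<union> curve Z)) x' (pos (r 2))"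
    "connected_component (- (curve (X 2) \<union> curve (X 3) \<union> curve Z)) x' (pos (r 4))"
    using mid[of 2 4] unfolding diff un by auto
  obtain x'' where x'': "x'' \<notin> curve (X 3)" "x'' \<notin> curve (X 4)"
    "connected_component (- (curve (X 2) \<union> curve (X 4) \<union> curve Z)) x'' (pos (r 3))"
    "connected_component (- (curve (X 2) \<union> curve (X 3) \<union> curve Z)) x'' (pos (r 4))"
    using mid[of 3 4] unfolding diff un by auto
  have m: "2 \<in> ?I" "3 \<in> ?I" "4 \<in> ?I" "(2::nat) \<noteq> 3" "(2::nat) \<noteq> 4" "(3::nat) \<noteq> 4" by auto
  show False
    by (rule four_arcs[OF arcs[OF m(1)] arcs[OF m(2)] arcs[OF m(3)] arcZ meet[OF m(1,2,4)] meet[OF m(1,3,5)]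
        meet[OF m(2,3,6)] meetZ[OF m(1)] meetZ[OF m(2)] meetZ[OF m(3)] y[OF m(1)] y[OF m(2)] y[OF m(3)] x x' x''])
qed

end

section \<open>Minors of a plane graph\<close>

text \<open>\<open>\<phi>\<close> assigns the branch sets in the host graph. Non-edges are
  unconstrained, so subgraphs are covered too.\<close>

definition minor_of :: "'a set \<Rightarrow> ('a \<times> 'a) set \<Rightarrow> 'a set \<Rightarrow> ('a \<times> 'a) set \<Rightarrow> bool" where
  "minor_of V\<^sub>0 R\<^sub>0 V R \<longleftrightarrow> sgraph V R \<and> (\<exists>\<phi>.
     (\<forall>v\<in>V. \<phi> v \<subseteq> V\<^sub>0 \<and> conn R\<^sub>0 (\<phi> v)) \<and>
     (\<forall>u\<in>V. \<forall>v\<in>V. u \<noteq> v \<longrightarrow> \<phi> u \<inter> \<phi> v = {}) \<and>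
     (\<forall>u v. (u, v) \<in> R \<longrightarrow> adj R\<^sub>0 (\<phi> u) (\<phi> v)))"

lemma minor_of_refl:
  assumes "sgraph V R"
  shows "minor_of V R V R"
  unfolding minor_of_def
proof (intro conjI assms exI[of _ "\<lambda>v. {v}"] ballI allI impI)
  show "adj R {u} {v}" if "(u, v) \<in> R" for u v using that by (simp add: adj_def)
qed (simp_all add: conn_def)

lemma minor_of_subgraph:
  assumes "minor_of V\<^sub>0 R\<^sub>0 V R" "sgraph U S" "U \<subseteq> V" "S \<subseteq> R"
  shows "minor_of V\<^sub>0 R\<^sub>0 U S"
proof -
  obtain \<phi> where \<phi>: "\<forall>v\<in>V. \<phi> v \<subseteq> V\<^sub>0 \<and> conn R\<^sub>0 (\<phi> v)" "\<forall>u\<in>V. \<forall>v\<in>V. u \<noteq> v \<longrightarrow> \<phi> u \<inter> \<phi> v = {}"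
    "\<forall>u v. (u, v) \<in> R \<longrightarrow> adj R\<^sub>0 (\<phi> u) (\<phi> v)"
    using assms(1) unfolding minor_of_def by (elim conjE exE)
  show ?thesis unfolding minor_of_def
  proof (intro conjI assms(2) exI[of _ \<phi>])
    show "\<forall>v\<in>U. \<phi> v \<subseteq> V\<^sub>0 \<and> conn R\<^sub>0 (\<phi> v)" using \<phi>(1) assms(3) by blast
    show "\<forall>u\<in>U. \<forall>v\<in>U. u \<noteq> v \<longrightarrow> \<phi> u \<inter> \<phi> v = {}" using \<phi>(2) assms(3) by blast
    show "\<forall>u v. (u, v) \<in> S \<longrightarrow> adj R\<^sub>0 (\<phi> u) (\<phi> v)" using \<phi>(3) assms(4) by blast
  qed
qed

lemma adj_mono: "adj R A B \<Longrightarrow> A \<subseteq> A' \<Longrightarrow> B \<subseteq> B' \<Longrightarrow> adj R A' B'"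
  unfolding adj_def by blast

lemma minor_of_contract:
  assumes sym: "sym R\<^sub>0" and m: "minor_of V\<^sub>0 R\<^sub>0 V R" and xy: "(x, y) \<in> R"
  shows "minor_of V\<^sub>0 R\<^sub>0 (V - {y}) (contract x y R)"
proof -
  have R: "sgraph V R" using m by (simp add: minor_of_def)
  obtain \<phi> where \<phi>: "\<forall>v\<in>V. \<phi> v \<subseteq> V\<^sub>0 \<and> conn R\<^sub>0 (\<phi> v)" "\<forall>u\<in>V. \<forall>v\<in>V. u \<noteq> v \<longrightarrow> \<phi> u \<inter> \<phi> v = {}"
    "\<forall>u v. (u, v) \<in> R \<longrightarrow> adj R\<^sub>0 (\<phi> u) (\<phi> v)"
    using m unfolding minor_of_def by (elim conjE exE)
  have V: "x \<in> V" "y \<in> V" "x \<noteq> y" using sgraphD(3,4,6)[OF R] xy by blast+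
  let ?\<psi> = "\<phi>(x := \<phi> x \<union> \<phi> y)"
  have c: "conn R\<^sub>0 (\<phi> x \<union> \<phi> y)" using conn_Un[OF sym] \<phi> V xy by blast
  show ?thesis unfolding minor_of_def
  proof (intro conjI exI[of _ ?\<psi>] ballI allI impI)
    show "sgraph (V - {y}) (contract x y R)" using sgraph_contract[OF R xy] .
  next
    fix v assume "v \<in> V - {y}"
    then show "?\<psi> v \<subseteq> V\<^sub>0" "conn R\<^sub>0 (?\<psi> v)" using \<phi>(1) c V by auto
  next
    fix u v assume "u \<in> V - {y}" "v \<in> V - {y}" "u \<noteq> v"
    then have uv: "u \<in> V" "v \<in> V" "u \<noteq> y" "v \<noteq> y" "u \<noteq> v" by auto
    have d: "\<And>a b. a \<in> V \<Longrightarrow> b \<in> V \<Longrightarrow> a \<noteq> b \<Longrightarrow> \<phi> a \<inter> \<phi> b = {}" using \<phi>(2) by blast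
    show "?\<psi> u \<inter> ?\<psi> v = {}"
      using uv d[of u v] d[of x v] d[of y v] d[of u x] d[of u y] V by auto
  next
    fix u v assume "(u, v) \<in> contract x y R"
    then consider "(u, v) \<in> R" | "u = x" "(y, v) \<in> R" | "v = x" "(u, y) \<in> R"
      by (auto simp: contract_def)
    then obtain u' v' where uv: "(u', v') \<in> R" "\<phi> u' \<subseteq> ?\<psi> u" "\<phi> v' \<subseteq> ?\<psi> v"
    proof cases
      case 1
      then show thesis by (rule that) auto
    next
      case 2
      show thesis by (rule that[OF 2(2)]) (auto simp: 2(1))
    next
      case 3
      show thesis by (rule that[OF 3(2)]) (auto simp: 3(1))
    qed
    have "adj R\<^sub>0 (\<phi> u') (\<phi> v')" using \<phi>(3) uv(1) by blast
    then show "adj R\<^sub>0 (?\<psi> u) (?\<psi> v)" using uv(2,3) by (rule adj_mono)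
  qed
qed

lemma enumerate_finite_set:
  assumes "card S = n" "0 < n"
  shows "\<exists>f::nat \<Rightarrow> 'a. (\<forall>i<n. f i \<in> S) \<and> (\<forall>i<n. \<forall>j<n. i \<noteq> j \<longrightarrow> f i \<noteq> f j)"
proof -
  have "finite S" using assms card.infinite by fastforce
  then obtain f where f: "bij_betw f {0..<n} S" using ex_bij_betw_nat_finite assms by blast
  have "f i \<in> S" if "i < n" for i using bij_betwE[OF f] that by simp
  moreover have "f i \<noteq> f j" if "i < n" "j < n" "i \<noteq> j" for i j
    using inj_onD[OF bij_betw_imp_inj_on[OF f], of i j] that by auto
  ultimately show ?thesis by (intro exI[of _ f]) simp
qed

lemma (in drawn_graph) minor_class_minors: "minor_class (minor_of V R)"
proof
  fix W S assume m: "minor_of V R W S"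
  show S: "sgraph W S" using m by (simp add: minor_of_def)
  obtain \<phi> where \<phi>: "\<forall>v\<in>W. \<phi> v \<subseteq> V \<and> conn R (\<phi> v)" "\<forall>u\<in>W. \<forall>v\<in>W. u \<noteq> v \<longrightarrow> \<phi> u \<inter> \<phi> v = {}"
    "\<forall>u v. (u, v) \<in> S \<longrightarrow> adj R (\<phi> u) (\<phi> v)"
    using m unfolding minor_of_def by (elim conjE exE)
  show "minor_of V R U (S \<inter> U \<times> U)" if "U \<subseteq> W" for U
    by (rule minor_of_subgraph[OF m sgraph_restrict[OF S that] that]) simp
  show "minor_of V R W (S - {(x, y), (y, x)})" for x y
  proof (rule minor_of_subgraph[OF m])
    show "sgraph W (S - {(x, y), (y, x)})" using S unfolding sgraph_def sym_def irrefl_def by blast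
  qed auto
  show "minor_of V R (W - {y}) (contract x y S)" if "(x, y) \<in> S" for x y
    by (rule minor_of_contract[OF sym_R m that])
  show "\<exists>a\<in>T. \<exists>b\<in>T. a \<noteq> b \<and> (a, b) \<notin> S" if T: "card T = 5" for T
  proof (rule ccontr)
    assume "\<not> ?thesis"
    then have all: "\<And>a b. a \<in> T \<Longrightarrow> b \<in> T \<Longrightarrow> a \<noteq> b \<Longrightarrow> (a, b) \<in> S" by blast
    obtain f where f: "\<forall>i<5::nat. f i \<in> T" "\<forall>i<5. \<forall>j<5. i \<noteq> j \<longrightarrow> f i \<noteq> f j"
      using enumerate_finite_set[OF T zero_less_numeral] by (elim exE conjE)
    have edge: "(f i, f j) \<in> S" if "i < 5" "j < 5" "i \<noteq> j" for i j
      using all f that by simp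
    have W: "f i \<in> W" if "i < 5" for i
    proof -
      \<comment> \<open>Any index other than \<open>i\<close> will do: an edge at \<open>f i\<close>
        puts it into \<open>W\<close>.\<close>
      have "(if i = 0 then 1 else 0) < (5::nat)" "i \<noteq> (if i = 0 then 1 else 0)" by auto
      from edge[OF that this] show ?thesis using sgraphD(3)[OF S] by blast
    qed
    show False
    proof (rule no_K5_model[of "\<lambda>i. \<phi> (f i)"])
      show "conn R (\<phi> (f i))" "\<phi> (f i) \<subseteq> V" if "i < 5" for i using \<phi>(1) W[OF that] by auto
      show "\<phi> (f i) \<inter> \<phi> (f j) = {}" "adj R (\<phi> (f i)) (\<phi> (f j))" if "i < 5" "j < 5" "i \<noteq> j" for i j
        using \<phi>(2,3) W f(2) edge[OF that] that by auto
    qed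
  qed
  show "\<not> A \<times> B \<subseteq> S" if AB: "card A = 3" "card B = 3" for A B
  proof
    assume sub: "A \<times> B \<subseteq> S"
    obtain f where f: "\<forall>i<3::nat. f i \<in> A" "\<forall>i<3. \<forall>j<3. i \<noteq> j \<longrightarrow> f i \<noteq> f j"
      using enumerate_finite_set[OF AB(1) zero_less_numeral] by (elim exE conjE)
    obtain g where g: "\<forall>i<3::nat. g i \<in> B" "\<forall>i<3. \<forall>j<3. i \<noteq> j \<longrightarrow> g i \<noteq> g j"
      using enumerate_finite_set[OF AB(2) zero_less_numeral] by (elim exE conjE)
    have edge: "(f i, g j) \<in> S" if "i < 3" "j < 3" for i j using sub f(1) g(1) that by blast
    have W: "f i \<in> W" "g i \<in> W" if "i < 3" for i using sgraphD(3,4)[OF S edge[OF that that]] by auto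
    have ne: "f i \<noteq> g j" if "i < 3" "j < 3" for i j using edge[OF that] sgraphD(6)[OF S] by metis
    show False
    proof (rule no_K33_model[of "\<lambda>i. \<phi> (f i)" "\<lambda>i. \<phi> (g i)"])
      show "conn R (\<phi> (f i))" "\<phi> (f i) \<subseteq> V" "conn R (\<phi> (g i))" "\<phi> (g i) \<subseteq> V" if "i < 3" for i
        using \<phi>(1) W[OF that] by auto
      show "\<phi> (f i) \<inter> \<phi> (f j) = {}" "\<phi> (g i) \<inter> \<phi> (g j) = {}" if "i < 3" "j < 3" "i \<noteq> j" for i j
        using \<phi>(2) W f(2) g(2) that by auto
      show "\<phi> (f i) \<inter> \<phi> (g j) = {}" "adj R (\<phi> (f i)) (\<phi> (g j))" if "i < 3" "j < 3" for i j
        using \<phi>(2,3) W ne[OF that] edge[OF that] that by auto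
    qed
  qed
qed

text \<open>All neighbours in \<open>W\<close> of the first vertex of a longest path in
  \<open>W\<close> lie on that path. One of its two neighbours is not the second vertex, and the
  path is closed there.\<close>

lemma cyclic_set_closed_path:
  assumes R: "sgraph V R" and W: "cyclic_set R W" "W \<subseteq> V"
  obtains xs where "gpath R xs" "set xs \<subseteq> W" "3 \<le> length xs" "(last xs, hd xs) \<in> R"
proof -
  have finW: "finite W" using W(2) sgraphD(1)[OF R] finite_subset by blast
  let ?P = "\<lambda>xs. gpath R xs \<and> set xs \<subseteq> W"
  obtain w where w: "w \<in> W" using W(1) by (auto simp: cyclic_set_def)
  have bound: "length xs \<le> card W" if "?P xs" for xs
    using distinct_card[OF gpathD(2), of R xs] card_mono[OF finW, of "set xs"] that by simp
  have "?P [w]" using w by (simp add: gpath_def)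
  then obtain xs where xs: "gpath R xs" "set xs \<subseteq> W" and max: "\<And>ys. ?P ys \<Longrightarrow> length ys \<le> length xs"
    using ex_has_greatest_nat[of ?P "[w]" length "Suc (card W)"] bound by (auto simp: less_Suc_eq_le)
  obtain v vs where v: "xs = v # vs" using gpathD(1)[OF xs(1)] by (cases xs) auto
  have vW: "v \<in> W" using xs(2) v by simp
  have on: "a \<in> set vs" if "a \<in> W" "(v, a) \<in> R" for a
  proof -
    have "a \<in> set xs"
    proof (rule ccontr)
      assume "a \<notin> set xs"
      then have "gpath R (a # xs)" using xs(1) sgraphD(5)[OF R that(2)] v by (auto simp: gpath_def)
      then show False using max[of "a # xs"] that(1) xs(2) by simp
    qed
    moreover have "a \<noteq> v" using that(2) sgraphD(6)[OF R] by blast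
    ultimately show ?thesis using v by simp
  qed
  obtain a b where ab: "a \<in> W" "b \<in> W" "a \<noteq> b" "(v, a) \<in> R" "(v, b) \<in> R"
    using W(1) vW unfolding cyclic_set_def by blast
  have "vs \<noteq> []" using on[OF ab(1,4)] by auto
  then obtain u us where vs: "vs = u # us" by (cases vs) auto
  obtain c where c: "(v, c) \<in> R" "c \<in> set us"
    using on[OF ab(1,4)] on[OF ab(2,5)] ab vs by auto
  then obtain ys zs where us: "us = ys @ c # zs" by (auto simp: in_set_conv_decomp)
  have eq: "xs = (v # u # ys @ [c]) @ zs" using v vs us by simp
  show ?thesis
  proof (rule that[of "v # u # ys @ [c]"])
    show "gpath R (v # u # ys @ [c])" using gpath_appendD(1)[of R "v # u # ys @ [c]" zs] xs(1) eq by simp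
    show "set (v # u # ys @ [c]) \<subseteq> W" using xs(2) eq by auto
    show "(last (v # u # ys @ [c]), hd (v # u # ys @ [c])) \<in> R" using sgraphD(5)[OF R c(1)] by simp
  qed simp
qed

section \<open>Translation to the walks and degrees of the library\<close>

lemma pawalk_zip:
  "pcas x (zip (x # zs) (zs @ [y])) y \<and> pawalk_verts x (zip (x # zs) (zs @ [y])) = x # zs @ [y]"
  by (induction zs arbitrary: x) auto

lemma zip_successively: "successively (\<lambda>a b. (a, b) \<in> R) (x # zs @ [y]) \<Longrightarrow> set (zip (x # zs) (zs @ [y])) \<subseteq> R"
  by (induction zs arbitrary: x) auto

lemma sgraph_pair_graph:
  assumes "pair_graph G"
  shows "sgraph (pverts G) (parcs G)"
proof -
  interpret pair_graph G by fact
  show ?thesis unfolding sgraph_def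
    using pair_finite_verts in_arcsD1 in_arcsD2 no_loops'[of v v for v] arcs_symmetric
    by (force simp: sym_def irrefl_def)
qed

lemma graph_cycle_in_cyclic_set:
  assumes G: "pair_graph G" and W: "cyclic_set (parcs G) W" "W \<subseteq> pverts G"
  obtains p where "graph_cycle G p" "cycle_verts p \<subseteq> W"
proof -
  interpret pair_graph G by fact
  obtain xs where xs: "gpath (parcs G) xs" "set xs \<subseteq> W" "3 \<le> length xs" "(last xs, hd xs) \<in> parcs G"
    using cyclic_set_closed_path[OF sgraph_pair_graph[OF G] W] .
  obtain x zs where x: "xs = x # zs" using gpathD(1)[OF xs(1)] by (cases xs) auto
  let ?p = "zip (x # zs) (zs @ [x])"
  have "successively (\<lambda>a b. (a, b) \<in> parcs G) (xs @ [x])"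
    using xs(1,4) x unfolding gpath_def successively_append_iff by simp
  then have arcs: "set ?p \<subseteq> parcs G" using zip_successively x by fastforce
  have "distinct (zs @ [x])" using gpathD(2)[OF xs(1)] x by auto
  moreover have "x \<in> pverts G" using xs(2) W(2) x by auto
  ultimately have "cycle ?p"
    unfolding cycle_def awalk_def using arcs pawalk_zip[of x zs x] by (intro exI[of _ x]) auto
  then have "graph_cycle G ?p" using xs(3) x by (simp add: graph_cycle_def)
  moreover have "cycle_verts ?p \<subseteq> set (x # zs)"
    unfolding cycle_verts_def by (metis image_subsetI prod.collapse set_zip_leftD)
  then have "cycle_verts ?p \<subseteq> W" using xs(2) x by blast
  ultimately show ?thesis by (rule that)
qed

lemma has_disjoint_cycles_if_disjoint_cyclic:
  assumes G: "pair_graph G" and "disjoint_cyclic k (pverts G) (parcs G)"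
  shows "has_disjoint_cycles k G"
proof -
  obtain C where C: "\<And>i. i < k \<Longrightarrow> C i \<subseteq> pverts G" "\<And>i. i < k \<Longrightarrow> cyclic_set (parcs G) (C i)"
    "\<And>i j. i < k \<Longrightarrow> j < k \<Longrightarrow> i \<noteq> j \<Longrightarrow> C i \<inter> C j = {}"
    using disjoint_cyclicE[OF assms(2)] by metis
  have "\<exists>p. i < k \<longrightarrow> graph_cycle G p \<and> cycle_verts p \<subseteq> C i" for i
    using graph_cycle_in_cyclic_set[OF G C(2) C(1), of i] by metis
  then obtain D where D: "\<And>i. i < k \<Longrightarrow> graph_cycle G (D i)" "\<And>i. i < k \<Longrightarrow> cycle_verts (D i) \<subseteq> C i"
    by metis
  have "cycle_verts (D i) \<inter> cycle_verts (D j) = {}" if "i < k" "j < k" "i \<noteq> j" for i j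
    using D(2)[OF that(1)] D(2)[OF that(2)] C(3)[OF that] by blast
  then show ?thesis unfolding has_disjoint_cycles_def using D(1) by (intro exI[of _ D]) simp
qed

lemma out_degree_eq_deg: "out_degree (with_proj G) v = deg (parcs G) v"
proof -
  have "parcs G `` {v} = snd ` {e \<in> parcs G. fst e = v}" by force
  moreover have "inj_on snd {e \<in> parcs G. fst e = v}" by (auto simp: inj_on_def)
  ultimately show ?thesis by (simp add: out_degree_def out_arcs_def deg_def card_image)
qed

lemma excess_eq:
  assumes "finite (pverts G)" "1 \<le> k"
  shows "excess k (pverts G) (parcs G) = int (card (high_verts k G)) - int (card (low_verts k G))"
proof -
  let ?d = "deg (parcs G)"
  have "val k d = (if 2 * k \<le> d then 1 else 0) - (if d \<le> 2 * k - 2 then 1 else 0)" for d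
    using assms(2) unfolding val_def by auto
  then have "excess k (pverts G) (parcs G)
      = (\<Sum>v\<in>pverts G. if 2 * k \<le> ?d v then 1 else 0) - (\<Sum>v\<in>pverts G. if ?d v \<le> 2 * k - 2 then 1 else 0)"
    unfolding excess_def by (simp only: sum_subtractf)
  then show ?thesis
    unfolding high_verts_def low_verts_def out_degree_eq_deg using assms(1) by (simp flip: sum.inter_filter)
qed

theorem theorem1p7:
  fixes G :: "'a pair_pre_digraph" and k :: nat
  assumes "k \<ge> 2"
    and "pair_graph G"
    and "planar G"
    and "int (card (high_verts k G)) - int (card (low_verts k G)) \<ge> 2 * int k"
  shows "has_disjoint_cycles k G"
proof -
  have G: "sgraph (pverts G) (parcs G)" using assms(2) by (rule sgraph_pair_graph)
  obtain pos \<gamma> where "plane_drawing G pos \<gamma>" using assms(3) by (auto simp: planar_def)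
  then interpret drawn_graph G pos \<gamma> "pverts G" "parcs G"
    by unfold_locales (use G in simp_all)
  interpret minor_class "minor_of (pverts G) (parcs G)" by (rule minor_class_minors)
  have "2 * int k \<le> excess k (pverts G) (parcs G)"
    using excess_eq[of G k] sgraphD(1)[OF G] assms(1,4) by simp
  then have "disjoint_cyclic k (pverts G) (parcs G)"
    using disjoint_cyclic_if_excess[OF minor_of_refl[OF G] assms(1)] by blast
  then show ?thesis by (rule has_disjoint_cycles_if_disjoint_cyclic[OF assms(2)])
qed

end
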